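(* For every integer $n\geq 8$, $$f_{\mathcal{OP}}(n,P_4)=2n^2-7n+2.$$ Moreover, for every $n\geq 9$, the only $n$-vertex outerplanar graph (up to isomorphism) containing exactly $f_{\mathcal{OP}}(n,P_4)$ copies of $P_4$ is $K_1+P_{n-1}$, the graph obtained from a path on $n-1$ vertices by adding one new vertex adjacent to all $n-1$ path vertices.
   Context: $P_k$ denotes the path on $k$ vertices. For graphs $H$ and $G$, $\mathcal{N}(H,G)$ denotes the number of subgraphs of $G$ isomorphic to $H$. The generalized outerplanar Turán number of $H$ is $f_{\mathcal{OP}}(n,H)=\max\{\mathcal{N}(H,G): G \text{ is an } n\text{-vertex outerplanar graph}\}$. $K_1+P_{n-1}$ denotes the join of a single vertex with $P_{n-1}$. *)

theory Defs
  imports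
    "HOL-Analysis.Analysis"
    "Graph_Theory.Pair_Digraph"
    "Graph_Theory.Digraph_Component"
    "Graph_Theory.Digraph_Isomorphism"
begin

text \<open>
  Finite simple undirected graphs are the \<^term>\<open>pair_graph\<close>s of the library: finite, loop-free
  and symmetric, an edge \<open>uv\<close> being the two arcs \<open>(u, v)\<close> and \<open>(v, u)\<close>.
\<close>

definition path_graph :: "nat \<Rightarrow> nat pair_pre_digraph" where
  "path_graph k = \<lparr> pverts = {..<k},
     parcs = {(i, j). i < k \<and> j < k \<and> (j = Suc i \<or> i = Suc j)} \<rparr>"

definition complete_graph :: "nat \<Rightarrow> nat pair_pre_digraph" where
  "complete_graph k = \<lparr> pverts = {..<k}, parcs = {(i, j). i < k \<and> j < k \<and> i \<noteq> j} \<rparr>"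

definition graph_join ::
    "'a pair_pre_digraph \<Rightarrow> 'b pair_pre_digraph \<Rightarrow> ('a + 'b) pair_pre_digraph" where
  "graph_join G H = \<lparr> pverts = pverts G <+> pverts H,
     parcs = map_prod Inl Inl ` parcs G \<union> map_prod Inr Inr ` parcs H
       \<union> (Inl ` pverts G) \<times> (Inr ` pverts H) \<union> (Inr ` pverts H) \<times> (Inl ` pverts G) \<rparr>"

definition graph_iso :: "'a pair_pre_digraph \<Rightarrow> 'b pair_pre_digraph \<Rightarrow> bool" where
  "graph_iso G H \<longleftrightarrow> digraph_iso (with_proj G) (with_proj H)"

text \<open>
  Only symmetric subgraphs are counted, so every undirected copy of \<open>H\<close> in \<open>G\<close> is counted once.
\<close>

definition num_copies :: "'b pair_pre_digraph \<Rightarrow> 'a pair_pre_digraph \<Rightarrow> nat" where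
  "num_copies H G = card {S. pair_graph S \<and> subgraph (with_proj S) (with_proj G) \<and> graph_iso S H}"

text \<open>
  A crossing-free drawing in the plane: \<open>p\<close> places the vertices, and \<open>\<gamma> {u, v}\<close> is a simple arc
  drawing the edge \<open>uv\<close>, traversed in either direction.
\<close>

definition plane_drawing ::
    "'a pair_pre_digraph \<Rightarrow> ('a \<Rightarrow> complex) \<Rightarrow> ('a set \<Rightarrow> real \<Rightarrow> complex) \<Rightarrow> bool" where
  "plane_drawing G p \<gamma> \<longleftrightarrow>
     inj_on p (pverts G) \<and>
     (\<forall>(u, v) \<in> parcs G.
        arc (\<gamma> {u, v}) \<and>
        {pathstart (\<gamma> {u, v}), pathfinish (\<gamma> {u, v})} = {p u, p v} \<and>
        path_image (\<gamma> {u, v}) \<inter> p ` pverts G = {p u, p v}) \<and>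
     (\<forall>(u, v) \<in> parcs G. \<forall>(x, y) \<in> parcs G. {u, v} \<noteq> {x, y} \<longrightarrow>
        path_image (\<gamma> {u, v}) \<inter> path_image (\<gamma> {x, y}) \<subseteq> p ` pverts G)"

definition drawing_image ::
    "'a pair_pre_digraph \<Rightarrow> ('a \<Rightarrow> complex) \<Rightarrow> ('a set \<Rightarrow> real \<Rightarrow> complex) \<Rightarrow> complex set" where
  "drawing_image G p \<gamma> = p ` pverts G \<union> (\<Union>(u, v) \<in> parcs G. path_image (\<gamma> {u, v}))"

text \<open>
  The image of a drawing of a finite graph is compact, so its \<^const>\<open>outside\<close> is the unique
  unbounded (outer) face.
\<close>

definition outerplanar :: "'a pair_pre_digraph \<Rightarrow> bool" where
  "outerplanar G \<longleftrightarrow>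
     (\<exists>p \<gamma>. plane_drawing G p \<gamma> \<and> p ` pverts G \<subseteq> frontier (outside (drawing_image G p \<gamma>)))"

definition outerplanar_graphs :: "nat \<Rightarrow> 'a pair_pre_digraph set" where
  "outerplanar_graphs n = {G. pair_graph G \<and> card (pverts G) = n \<and> outerplanar G}"

text \<open>
  Every finite graph is isomorphic to one with vertices in \<^typ>\<open>nat\<close>, so the maximum may be
  taken over these; the numbers of copies are bounded because \<open>n\<close> is fixed.
\<close>

definition f_OP :: "nat \<Rightarrow> 'b pair_pre_digraph \<Rightarrow> nat" where
  "f_OP n H = Max (num_copies H ` (outerplanar_graphs n :: nat pair_pre_digraph set))"

end

theory Submission
  imports Defs
begin

text \<open>
  Write \<open>F n = 2 n\<^sup>2 - 7 n + 2\<close>, so that \<open>F n - F (n - 1) = 4 n - 9\<close>.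

  Topology enters through two obstructions. In a drawing with all vertices on the outer face there
  are no three internally disjoint paths with common ends, each having an inner vertex, because
  Janiszewski's theorem puts one of three such arcs inside the curve formed by the other two; and
  no cycle has two crossing chords, because one chord would separate the ends of the other inside
  the cycle.

  Rotating a longest path shows that the second obstruction alone forces two vertices of degree at
  most two. Deleting such a vertex \<open>v\<close> destroys few paths: when \<open>v\<close> has neighbours \<open>a\<close>, \<open>b\<close>, the
  copies of \<open>P\<^sub>4\<close> through \<open>v\<close> are counted by the edges at \<open>N(a)\<close> and \<open>N(b)\<close>. Neighbourhoods span
  forests and any two vertices have at most two common neighbours, which gives at most
  \<open>4 n - 10 - s + k + l\<close> copies, where \<open>s\<close> vertices are adjacent to neither \<open>a\<close> nor \<open>b\<close> and
  \<open>k, l \<le> 1\<close>. The few configurations with \<open>s < k + l\<close> are the fan, graphs with another, better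
  vertex to delete, and one graph on eight vertices. Hence for \<open>n \<ge> 8\<close> deleting a suitable vertex
  destroys at most \<open>4 n - 10\<close> copies unless the graph is the fan or that exception. The values
  \<open>17, 33, 52, 74\<close> bound the count for \<open>n = 5, 6, 7, 8\<close> (they exceed \<open>F\<close> by one for \<open>n = 6, 7\<close>),
  and from \<open>n = 9\<close> on only the fan attains \<open>F n\<close>.
\<close>

text \<open>Here \<open>k\<close> and \<open>l\<close> count the neighbours that the second common
  neighbour \<open>c\<close> of \<open>a\<close> and \<open>b\<close> has among the remaining
  neighbours of \<open>a\<close> and of \<open>b\<close>. They are the only terms that can lift the
  cost of deleting \<open>v\<close> above \<open>4 n - 10\<close>; without a second common
  neighbour, or with \<open>a\<close> and \<open>b\<close> not adjacent, that cost is never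
  exceeded. A cost of \<open>4 n - 10\<close> is one below the growth of \<open>F\<close>, so such a
  deletion gives strict inequality. For \<open>n = 8\<close> this gain is spent on the surplus of 52
  over \<open>F 7 = 51\<close>, since 52 + 22 = 74, and therefore uniqueness starts at 9 only. The
  obstacle is the case of higher cost. There nearly all estimates are equalities: the further
  neighbours of \<open>a\<close> and those of \<open>b\<close> span trees, not merely forests, and a
  leaf of such a tree is again a vertex of degree two, the next candidate for deletion. If it is
  costly too, the whole graph is determined. The small bounds arise from 6 paths on four vertices by
  adding the costs 11, 16, 19 and 22.\<close>

hide_const (open) Digraph_Component.connected

section \<open>Theta curves and crossing chords in the plane\<close>

text \<open>If no arc met the inside of the curve formed by the other two, a point \<open>x\<close> inside the curve
  \<open>g1 \<union> g2\<close> would lie outside both \<open>g1 \<union> g3\<close> and \<open>g2 \<union> g3\<close>. These meet in the connected set \<open>g3\<close>,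
  so by Janiszewski's theorem their union would not separate \<open>x\<close> from infinity.\<close>

lemma theta_inside:
  fixes g1 g2 g3 :: "real \<Rightarrow> complex"
  assumes arcs: "arc g1" "arc g2" "arc g3"
    and start: "pathstart g1 = s" "pathstart g2 = s" "pathstart g3 = s"
    and finish: "pathfinish g1 = t" "pathfinish g2 = t" "pathfinish g3 = t"
    and int: "path_image g1 \<inter> path_image g2 = {s, t}" "path_image g1 \<inter> path_image g3 = {s, t}"
      "path_image g2 \<inter> path_image g3 = {s, t}"
  shows "path_image g1 \<inter> inside (path_image g2 \<union> path_image g3) \<noteq> {} \<or>
    path_image g2 \<inter> inside (path_image g1 \<union> path_image g3) \<noteq> {} \<or>
    path_image g3 \<inter> inside (path_image g1 \<union> path_image g2) \<noteq> {}"
proof (rule ccontr)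
  define P where "P = path_image g1"
  define Q where "Q = path_image g2"
  define R where "R = path_image g3"
  assume "\<not> ?thesis"
  then have none: "P \<inter> inside (Q \<union> R) = {}" "Q \<inter> inside (P \<union> R) = {}" "R \<inter> inside (P \<union> Q) = {}"
    by (auto simp: P_def Q_def R_def)
  have sp: "simple_path (g1 +++ reversepath g2)" "simple_path (g1 +++ reversepath g3)"
    "simple_path (g2 +++ reversepath g3)"
    using assms by (auto simp: simple_path_join_loop_eq arc_reversepath)
  have J12: "inside (P \<union> Q) \<noteq> {} \<and> connected (inside (P \<union> Q)) \<and> frontier (inside (P \<union> Q)) = P \<union> Q"
    using Jordan_inside_outside[OF sp(1)] assms by (simp add: path_image_join P_def Q_def)
  have J13: "connected (inside (P \<union> R)) \<and> frontier (inside (P \<union> R)) = P \<union> R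
      \<and> connected (outside (P \<union> R)) \<and> inside (P \<union> R) \<union> outside (P \<union> R) = - (P \<union> R)"
    using Jordan_inside_outside[OF sp(2)] assms by (simp add: path_image_join P_def R_def)
  have J23: "connected (inside (Q \<union> R)) \<and> frontier (inside (Q \<union> R)) = Q \<union> R
      \<and> connected (outside (Q \<union> R)) \<and> inside (Q \<union> R) \<union> outside (Q \<union> R) = - (Q \<union> R)"
    using Jordan_inside_outside[OF sp(3)] assms by (simp add: path_image_join Q_def R_def)
  have ints: "P \<inter> Q = {s, t}" "P \<inter> R = {s, t}" "Q \<inter> R = {s, t}"
    using int by (auto simp: P_def Q_def R_def)
  have st: "s \<noteq> t"
    using arcs(1) start(1) finish(1) arc_distinct_ends by metis
  have QR: "Q - R \<noteq> {}" "P - R \<noteq> {}"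
    using nonempty_simple_path_endless[OF arc_imp_simple_path[OF arcs(1)]]
      nonempty_simple_path_endless[OF arc_imp_simple_path[OF arcs(2)]] start finish ints
    unfolding P_def Q_def R_def by auto
  have cl: "closed P" "closed Q" "closed R" "compact P" "compact Q" "compact R"
    using arcs by (auto simp: P_def Q_def R_def closed_arc_image compact_arc_image)
  obtain x where x: "x \<in> inside (P \<union> Q)" using J12 by blast
  obtain y where y: "y \<in> outside (P \<union> Q \<union> R)"
    using outside_bounded_nonempty[of "P \<union> Q \<union> R"] cl by (metis all_not_in_conv bounded_Un compact_imp_bounded)
  have in_out: "inside (P \<union> Q) \<inter> (P \<union> Q) = {}" "inside (P \<union> R) \<inter> (P \<union> R) = {}" "inside (Q \<union> R) \<inter> (Q \<union> R) = {}"
    by (auto simp: inside_no_overlap)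
  \<comment> \<open>The connected set \<open>inside X\<close> meets \<open>inside Y\<close> but not
    its frontier \<open>Y\<close>, so it cannot leave it.\<close>
  have sub: "inside X \<subseteq> inside Y"
    if "connected (inside X)" "x \<in> inside X" "x \<in> inside Y" "frontier (inside Y) = Y" "inside X \<inter> Y = {}" for X Y
    using connected_Int_frontier[of "inside X" "inside Y"] that by (metis Diff_eq_empty_iff IntI empty_iff)
  have dis: "inside (P \<union> Q) \<inter> (P \<union> R) = {}" "inside (P \<union> R) \<inter> (P \<union> Q) = {}"
    "inside (P \<union> Q) \<inter> (Q \<union> R) = {}" "inside (Q \<union> R) \<inter> (P \<union> Q) = {}"
    using in_out none by (simp_all add: Int_Un_distrib Int_Un_distrib2 Int_commute)
  \<comment> \<open>If \<open>x\<close> lay in both insides, each would contain the other, and equal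
    frontiers would give \<open>P \<union> Q = P \<union> R\<close>.\<close>
  have x13: "x \<in> outside (P \<union> R)"
  proof (rule ccontr)
    assume "x \<notin> outside (P \<union> R)"
    moreover have "x \<notin> P \<union> R" using x none(3) in_out(1) by blast
    ultimately have xi: "x \<in> inside (P \<union> R)" using J13 by blast
    have "inside (P \<union> Q) \<subseteq> inside (P \<union> R)"
      using sub J12 J13 x xi dis(1) by blast
    moreover have "inside (P \<union> R) \<subseteq> inside (P \<union> Q)"
      using sub J12 J13 x xi dis(2) by blast
    ultimately have "P \<union> Q = P \<union> R" using J12 J13 by (metis subset_antisym)
    then show False using ints QR(1) by blast
  qed
  have x23: "x \<in> outside (Q \<union> R)"
  proof (rule ccontr)
    assume "x \<notin> outside (Q \<union> R)"
    moreover have "x \<notin> Q \<union> R" using x none(3) in_out(1) by blast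
    ultimately have xi: "x \<in> inside (Q \<union> R)" using J23 by blast
    have "inside (P \<union> Q) \<subseteq> inside (Q \<union> R)"
      using sub J12 J23 x xi dis(3) by blast
    moreover have "inside (Q \<union> R) \<subseteq> inside (P \<union> Q)"
      using sub J12 J23 x xi dis(4) by blast
    ultimately have "P \<union> Q = Q \<union> R" using J12 J23 by (metis subset_antisym)
    then show False using ints QR(2) by blast
  qed
  have y': "y \<in> outside (P \<union> R)" "y \<in> outside (Q \<union> R)" "y \<in> outside (P \<union> Q)"
    using y outside_mono[of "P \<union> R" "P \<union> Q \<union> R"] outside_mono[of "Q \<union> R" "P \<union> Q \<union> R"]
      outside_mono[of "P \<union> Q" "P \<union> Q \<union> R"] by blast+
  have "connected_component (- ((P \<union> R) \<union> (Q \<union> R))) x y"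
  proof (rule Janiszewski)
    show "compact (P \<union> R)" "closed (Q \<union> R)" using cl by auto
    have "(P \<union> R) \<inter> (Q \<union> R) = R" using ints by blast
    then show "connected ((P \<union> R) \<inter> (Q \<union> R))"
      using arcs(3) connected_arc_image R_def by metis
    show "connected_component (- (P \<union> R)) x y"
      unfolding connected_component_def using J13 x13 y' by blast
    show "connected_component (- (Q \<union> R)) x y"
      unfolding connected_component_def using J23 x23 y' by blast
  qed
  then have "connected_component (- (P \<union> Q)) x y"
    by (rule connected_component_of_subset) auto
  then have "y \<in> inside (P \<union> Q)" using x inside_same_component by blast
  then show False using y'(3) inside_Int_outside by blast
qed

text \<open>\<open>inside C\<close> is an open neighbourhood of \<open>x\<close> that misses
  \<open>outside D\<close>. This is how the outer face enters: no vertex lies inside a closed curve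
  of the drawing.\<close>

lemma inside_not_frontier_outside:
  fixes C D :: "complex set"
  assumes "closed C" "C \<subseteq> D" "x \<in> inside C"
  shows "x \<notin> frontier (outside D)"
proof
  assume "x \<in> frontier (outside D)"
  then have "x \<in> closure (outside D)" by (simp add: frontier_def)
  then have "inside C \<inter> outside D \<noteq> {}"
    using open_inside[OF assms(1)] assms(3) closure_iff_nhds_not_empty by blast
  then show False using outside_mono[OF assms(2)] inside_Int_outside[of C] by blast
qed

text \<open>The open arc is connected, so on leaving \<open>inside C\<close> it would meet the
  frontier, which is part of \<open>C\<close>; but it meets \<open>C\<close> only at its
  ends.\<close>

lemma arc_interior_subset_inside:
  fixes g :: "real \<Rightarrow> complex"
  assumes "arc g" "closed C" "path_image g \<inter> C \<subseteq> {pathstart g, pathfinish g}"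
    "pathstart g \<in> C" "pathfinish g \<in> C"
    "path_image g \<inter> inside C \<noteq> {}"
  shows "path_image g - {pathstart g, pathfinish g} \<subseteq> inside C"
proof (rule ccontr)
  let ?A = "path_image g - {pathstart g, pathfinish g}"
  assume "\<not> ?A \<subseteq> inside C"
  moreover have "connected ?A"
    using assms(1) by (simp add: arc_imp_simple_path connected_simple_path_endless)
  moreover have "inside C \<inter> C = {}" by (simp add: inside_no_overlap)
  moreover have "?A \<inter> inside C \<noteq> {}" using assms calculation(3) by blast
  ultimately have "?A \<inter> frontier (inside C) \<noteq> {}"
    using connected_Int_frontier[of ?A "inside C"] by blast
  moreover have "frontier (inside C) \<subseteq> C" using assms(2) frontier_inside_subset by blast
  ultimately show False using assms(3) by blast
qed

text \<open>Of the alternatives in \<open>theta_inside\<close>, the first two would place the outer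
  points \<open>x1\<close> or \<open>x2\<close> inside a closed curve.\<close>

lemma theta_not_outer:
  fixes g1 g2 g3 :: "real \<Rightarrow> complex"
  assumes arcs: "arc g1" "arc g2" "arc g3"
    and start: "pathstart g1 = s" "pathstart g2 = s" "pathstart g3 = s"
    and finish: "pathfinish g1 = t" "pathfinish g2 = t" "pathfinish g3 = t"
    and int: "path_image g1 \<inter> path_image g2 = {s, t}" "path_image g1 \<inter> path_image g3 = {s, t}"
      "path_image g2 \<inter> path_image g3 = {s, t}"
    and D: "path_image g1 \<subseteq> D" "path_image g2 \<subseteq> D" "path_image g3 \<subseteq> D"
    and x1: "x1 \<in> path_image g1 - {s, t}" "x1 \<in> frontier (outside D)"
    and x2: "x2 \<in> path_image g2 - {s, t}" "x2 \<in> frontier (outside D)"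
  shows "path_image g3 - {s, t} \<subseteq> inside (path_image g1 \<union> path_image g2)"
proof -
  have *: "path_image g - {s, t} \<subseteq> inside (path_image h \<union> path_image k)"
    if "path_image g \<inter> inside (path_image h \<union> path_image k) \<noteq> {}"
      "arc g" "arc h" "arc k" "pathstart g = s" "pathfinish g = t"
      "path_image g \<inter> path_image h = {s, t}" "path_image g \<inter> path_image k = {s, t}"
    for g h k :: "real \<Rightarrow> complex"
  proof -
    have "path_image g \<inter> (path_image h \<union> path_image k) = {s, t}"
      using that(7,8) by (simp add: Int_Un_distrib)
    then show ?thesis
      using arc_interior_subset_inside[of g "path_image h \<union> path_image k"] that(1-6)
      by (metis IntD2 closed_Un closed_arc_image insertI1 insert_commute order_refl)
  qed
  have cl: "closed (path_image g2 \<union> path_image g3)" "closed (path_image g1 \<union> path_image g3)"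
    using arcs by (auto simp: closed_arc_image)
  have "path_image g1 \<inter> inside (path_image g2 \<union> path_image g3) = {}"
    using *[of g1 g2 g3] inside_not_frontier_outside[OF cl(1), of D x1] arcs start finish int D x1
    by (metis Un_least subset_iff)
  moreover have "path_image g2 \<inter> inside (path_image g1 \<union> path_image g3) = {}"
    using *[of g2 g1 g3] inside_not_frontier_outside[OF cl(2), of D x2] arcs start finish int D x2
    by (metis Int_commute Un_least subset_iff)
  ultimately have "path_image g3 \<inter> inside (path_image g1 \<union> path_image g2) \<noteq> {}"
    using theta_inside[OF arcs start finish int] by blast
  then show ?thesis using *[of g3 g1 g2] arcs start finish int by (metis Int_commute)
qed

text \<open>Continuity transfers the closure of the open unit interval. This lets the ends of an arc
  be treated as limits of its inner points.\<close>

lemma arc_subset_closure_endless: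
  fixes g :: "real \<Rightarrow> complex"
  assumes "arc g"
  shows "path_image g \<subseteq> closure (path_image g - {pathstart g, pathfinish g})"
proof -
  have "g ` closure {0<..<1} \<subseteq> closure (g ` {0<..<1})"
    using arc_imp_path[OF assms]
    by (intro image_closure_subset) (auto simp: path_def closure_greaterThanLessThan closure_subset)
  then show ?thesis
    using simple_path_endless[OF arc_imp_simple_path[OF assms]] by (simp add: path_image_def)
qed

text \<open>Both chords of the curve lie inside it; the first chord splits the inside in two, and
  the second chord would have to join the two parts.\<close>

lemma crossing_chords_not_outer:
  fixes c1 c2 e f :: "real \<Rightarrow> complex"
  assumes arcs: "arc c1" "arc c2" "arc e"
    and start: "pathstart c1 = s" "pathstart c2 = s" "pathstart e = s"
    and finish: "pathfinish c1 = t" "pathfinish c2 = t" "pathfinish e = t"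
    and int: "path_image c1 \<inter> path_image c2 = {s, t}" "path_image c1 \<inter> path_image e = {s, t}"
      "path_image c2 \<inter> path_image e = {s, t}"
    and D: "path_image c1 \<subseteq> D" "path_image c2 \<subseteq> D" "path_image e \<subseteq> D"
    and x1: "x1 \<in> path_image c1 - {s, t}" "x1 \<in> frontier (outside D)"
    and x2: "x2 \<in> path_image c2 - {s, t}" "x2 \<in> frontier (outside D)"
    and f: "arc f" "pathstart f = x1" "pathfinish f = x2" "path_image f \<inter> path_image e = {}"
      "path_image f - {x1, x2} \<subseteq> inside (path_image c1 \<union> path_image c2)"
  shows False
proof -
  have e: "path_image e - {s, t} \<subseteq> inside (path_image c1 \<union> path_image c2)"
    using theta_not_outer[OF arcs start finish int D x1 x2] .
  have st: "s \<noteq> t" using arcs(1) start(1) finish(1) arc_distinct_ends by metis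
  have ne: "path_image e \<inter> inside (path_image c1 \<union> path_image c2) \<noteq> {}"
    using nonempty_simple_path_endless[OF arc_imp_simple_path[OF arcs(3)]] e start finish by auto
  let ?I1 = "inside (path_image c1 \<union> path_image e)"
  let ?I2 = "inside (path_image c2 \<union> path_image e)"
  obtain sp: "?I1 \<inter> ?I2 = {}" "?I1 \<union> ?I2 \<union> (path_image e - {s,t}) = inside (path_image c1 \<union> path_image c2)"
    using split_inside_simple_closed_curve[of c1 s t c2 e] assms ne st
    by (metis arc_imp_simple_path)
  have op: "closed (path_image c1 \<union> path_image e)" "closed (path_image c2 \<union> path_image e)"
    using arcs by (auto simp: closed_arc_image)
  have co: "connected (path_image f - {x1, x2})"
    using f connected_simple_path_endless[of f] arc_imp_simple_path by metis
  have cl: "path_image f \<subseteq> closure (path_image f - {x1, x2})"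
    using arc_subset_closure_endless f by metis
  have fr: "closure ?I1 \<subseteq> ?I1 \<union> (path_image c1 \<union> path_image e)" "closure ?I2 \<subseteq> ?I2 \<union> (path_image c2 \<union> path_image e)"
    using op frontier_inside_subset closure_Un_frontier by (metis Un_mono subset_refl)+
  have "path_image f - {x1, x2} \<subseteq> ?I1 \<union> ?I2" using f(4,5) sp(2) by blast
  then consider "path_image f - {x1, x2} \<subseteq> ?I1" | "path_image f - {x1, x2} \<subseteq> ?I2"
    using connectedD[OF co open_inside[OF op(1)] open_inside[OF op(2)]] sp(1) by blast
  then show False
  proof cases
    case 1
    \<comment> \<open>The end \<open>x2\<close> lies on \<open>c2\<close>, off the boundary of
      \<open>?I1\<close>. As a limit of points of \<open>?I1\<close> it would be inside a closed
      curve of the drawing.\<close>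
    then have "x2 \<in> closure ?I1" using cl closure_mono f(3) pathfinish_in_path_image by blast
    moreover have "x2 \<notin> path_image c1 \<union> path_image e" using x2 int by blast
    ultimately have "x2 \<in> ?I1" using fr(1) by blast
    then show False using inside_not_frontier_outside[OF op(1)] D x2(2) by blast
  next
    case 2
    then have "x1 \<in> closure ?I2" using cl closure_mono f(2) pathstart_in_path_image by blast
    moreover have "x1 \<notin> path_image c2 \<union> path_image e" using x1 int by blast
    ultimately have "x1 \<in> ?I2" using fr(2) by blast
    then show False using inside_not_frontier_outside[OF op(2)] D x1(2) by blast
  qed
qed

section \<open>Obstructions in outerplanar drawings\<close>

fun path_edges :: "'a list \<Rightarrow> 'a set set" where
  "path_edges (u # v # xs) = insert {u, v} (path_edges (v # xs))"
| "path_edges _ = {}"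

lemma path_edges_subset: "e \<in> path_edges xs \<Longrightarrow> e \<subseteq> set xs"
  by (induction xs rule: path_edges.induct) auto

lemma path_edges_append: "path_edges (xs @ y # ys) = path_edges (xs @ [y]) \<union> path_edges (y # ys)"
proof (induction xs rule: path_edges.induct)
  case "2_1"
  then show ?case by simp
next
  case ("2_2" v)
  then show ?case by simp
qed auto

lemma successively_append_Cons:
  "successively P (xs @ y # ys) \<longleftrightarrow> successively P (xs @ [y]) \<and> successively P (y # ys)"
  by (auto simp: successively_append_iff successively_Cons)

lemma path_edges_rev: "path_edges (rev xs) = path_edges xs"
proof (induction xs rule: path_edges.induct)
  case (1 u v xs)
  have "path_edges (rev (u # v # xs)) = path_edges (rev (v # xs)) \<union> path_edges [v, u]"
    using path_edges_append[of "rev xs" v "[u]"] by simp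
  then show ?case using 1 by (auto simp: insert_commute)
qed auto

lemma ends_notin_path_edges:
  assumes "distinct (a # ps @ [b])" "ps \<noteq> []"
  shows "{a, b} \<notin> path_edges (a # ps @ [b])"
proof -
  obtain c qs where ps: "ps = c # qs" using assms(2) by (cases ps) auto
  have "{a, b} \<notin> path_edges (c # qs @ [b])"
    using path_edges_subset[of "{a, b}" "c # qs @ [b]"] assms(1) ps by auto
  then show ?thesis using assms(1) ps by (auto simp: doubleton_eq_iff)
qed

lemma pair_graph_arcD:
  assumes "pair_graph G" "(u, v) \<in> parcs G"
  shows "u \<in> pverts G" "v \<in> pverts G" "u \<noteq> v"
proof -
  interpret pair_graph G by (rule assms(1))
  show "u \<in> pverts G" "v \<in> pverts G" "u \<noteq> v"
    using in_arcsD1[OF assms(2)] in_arcsD2[OF assms(2)] pair_no_loops[OF assms(2)] by auto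
qed

locale outer_drawing =
  fixes G :: "'a pair_pre_digraph" and p :: "'a \<Rightarrow> complex" and \<gamma> :: "'a set \<Rightarrow> real \<Rightarrow> complex"
  assumes graph: "pair_graph G" and drawing: "plane_drawing G p \<gamma>"
    and outer: "p ` pverts G \<subseteq> frontier (outside (drawing_image G p \<gamma>))"
begin

abbreviation E where "E \<equiv> \<lambda>u v. (u, v) \<in> parcs G"

definition trace :: "'a list \<Rightarrow> complex set" where
  "trace xs = (\<Union>e \<in> path_edges xs. path_image (\<gamma> e))"

lemma arc_verts: "E u v \<Longrightarrow> u \<in> pverts G \<and> v \<in> pverts G \<and> u \<noteq> v"
  using pair_graph_arcD[OF graph] by blast

lemma p_eq_iff: "u \<in> pverts G \<Longrightarrow> v \<in> pverts G \<Longrightarrow> p u = p v \<longleftrightarrow> u = v"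
  using drawing by (auto simp: plane_drawing_def inj_on_eq_iff)

lemma edge_arc:
  assumes "E u v"
  shows "arc (\<gamma> {u, v}) \<and>
    {pathstart (\<gamma> {u, v}), pathfinish (\<gamma> {u, v})} = {p u, p v} \<and>
    path_image (\<gamma> {u, v}) \<inter> p ` pverts G = {p u, p v}"
  using drawing[unfolded plane_drawing_def, THEN conjunct2, THEN conjunct1, THEN bspec, OF assms,
      unfolded prod.case] .

lemma edge_arc_meet:
  assumes "E u v" "E x y" "{u, v} \<noteq> {x, y}"
  shows "path_image (\<gamma> {u, v}) \<inter> path_image (\<gamma> {x, y}) \<subseteq> p ` pverts G"
  using drawing[unfolded plane_drawing_def, THEN conjunct2, THEN conjunct2, THEN bspec, OF assms(1),
      unfolded prod.case, THEN bspec, OF assms(2), unfolded prod.case, THEN mp, OF assms(3)] .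

lemma path_edges_E: "successively E xs \<Longrightarrow> e \<in> path_edges xs \<Longrightarrow> \<exists>u v. e = {u, v} \<and> E u v"
  by (induction xs rule: path_edges.induct) auto

lemma trace_subset_drawing: "successively E xs \<Longrightarrow> trace xs \<subseteq> drawing_image G p \<gamma>"
  unfolding trace_def drawing_image_def using path_edges_E by fastforce

text \<open>A common point lies on two different edges, hence is a vertex; a drawn edge contains no
  vertices but its ends, so this vertex belongs to both paths.\<close>

lemma trace_meet:
  assumes "successively E xs" "successively E ys" "path_edges xs \<inter> path_edges ys = {}"
  shows "trace xs \<inter> trace ys \<subseteq> p ` (set xs \<inter> set ys)"
proof
  fix z assume "z \<in> trace xs \<inter> trace ys"
  then obtain e f where ef: "e \<in> path_edges xs" "f \<in> path_edges ys" "z \<in> path_image (\<gamma> e)" "z \<in> path_image (\<gamma> f)"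
    by (auto simp: trace_def)
  obtain u v x y where uv: "e = {u, v}" "E u v" "f = {x, y}" "E x y"
    using path_edges_E assms ef by metis
  have "e \<noteq> f" using assms(3) ef by blast
  then have "z \<in> p ` pverts G" using edge_arc_meet[of u v x y] uv ef by blast
  then obtain w where w: "w \<in> pverts G" "z = p w" by blast
  have "p w \<in> {p u, p v}" "p w \<in> {p x, p y}"
    using edge_arc[of u v] edge_arc[of x y] uv ef w by blast+
  then have "w \<in> e" "w \<in> f" using p_eq_iff arc_verts uv w by auto
  then show "z \<in> p ` (set xs \<inter> set ys)"
    using ef path_edges_subset w by blast
qed

lemma arc_exists:
  assumes "E u v"
  obtains g where "arc g" "pathstart g = p u" "pathfinish g = p v" "path_image g = path_image (\<gamma> {u, v})"
proof (cases "pathstart (\<gamma> {u, v}) = p u")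
  case True
  then have "pathfinish (\<gamma> {u, v}) = p v"
    using edge_arc[OF assms] arc_distinct_ends by (metis doubleton_eq_iff)
  then show ?thesis using that[of "\<gamma> {u, v}"] edge_arc[OF assms] True by blast
next
  case False
  then have "pathstart (\<gamma> {u, v}) = p v" "pathfinish (\<gamma> {u, v}) = p u"
    using edge_arc[OF assms] by (auto simp: doubleton_eq_iff)
  then show ?thesis using that[of "reversepath (\<gamma> {u, v})"] edge_arc[OF assms]
    by (simp add: arc_reversepath)
qed

text \<open>By \<open>trace_meet\<close> the first edge shares only its end \<open>c\<close> with
  the rest of the path, so joining the two gives an arc again.\<close>

lemma arc_of_path:
  assumes "successively E (a # ps @ [b])" "distinct (a # ps @ [b])"
  shows "\<exists>g. arc g \<and> pathstart g = p a \<and> pathfinish g = p b \<and> path_image g = trace (a # ps @ [b])"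
  using assms
proof (induction ps arbitrary: a)
  case Nil
  then obtain g where "arc g" "pathstart g = p a" "pathfinish g = p b" "path_image g = path_image (\<gamma> {a, b})"
    using arc_exists[of a b] by auto
  then show ?case by (auto simp: trace_def)
next
  case (Cons c ps)
  from Cons.prems have ac: "E a c" by auto
  obtain g where g: "arc g" "pathstart g = p a" "pathfinish g = p c" "path_image g = trace [a, c]"
    using arc_exists[OF ac] by (auto simp: trace_def)
  obtain h where h: "arc h" "pathstart h = p c" "pathfinish h = p b" "path_image h = trace (c # ps @ [b])"
    using Cons by fastforce
  have "path_edges [a, c] \<inter> path_edges (c # ps @ [b]) = {}"
    using path_edges_subset[of "{a, c}" "c # ps @ [b]"] Cons.prems by auto
  then have "trace [a, c] \<inter> trace (c # ps @ [b]) \<subseteq> p ` (set [a, c] \<inter> set (c # ps @ [b]))"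
    using Cons.prems ac by (intro trace_meet) auto
  also have "set [a, c] \<inter> set (c # ps @ [b]) = {c}" using Cons.prems by auto
  finally have "arc (g +++ h)" using g h by (intro arc_join) auto
  moreover have "path_image (g +++ h) = trace (a # (c # ps) @ [b])"
    using g h by (simp add: path_image_join trace_def)
  ultimately show ?case using g h by (intro exI[of _ "g +++ h"]) auto
qed

lemma obtain_arc_of_path:
  assumes "successively E (a # ps @ [b])" "distinct (a # ps @ [b])"
  obtains g where "arc g" "pathstart g = p a" "pathfinish g = p b" "path_image g = trace (a # ps @ [b])"
  using arc_of_path[OF assms] that by metis

lemma verts_in_trace:
  assumes "successively E (a # ps @ [b])"
  shows "p ` set (a # ps @ [b]) \<subseteq> trace (a # ps @ [b])"
  using assms
proof (induction ps arbitrary: a)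
  case Nil then show ?case using edge_arc[of a b] by (auto simp: trace_def)
next
  case (Cons c ps)
  then have "p a \<in> path_image (\<gamma> {a, c})" using edge_arc[of a c] by auto
  then show ?case using Cons by (auto simp: trace_def)
qed

lemma successively_verts:
  assumes "successively E (a # ps @ [b])"
  shows "set (a # ps @ [b]) \<subseteq> pverts G"
  using assms
proof (induction ps arbitrary: a)
  case Nil then show ?case using arc_verts by auto
next
  case (Cons c ps) then show ?case using arc_verts by auto
qed

text \<open>The only edge the two paths could share is \<open>{a, b}\<close>, which the nonempty
  \<open>ps\<close> excludes. \<open>qs\<close> may be empty, so that the second path can be a
  chord.\<close>

lemma trace_meet_ends:
  assumes "successively E (a # ps @ [b])" "successively E (a # qs @ [b])"
    "distinct (a # ps @ [b])" "ps \<noteq> []" "set ps \<inter> set qs = {}" "distinct (a # qs @ [b])"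
  shows "trace (a # ps @ [b]) \<inter> trace (a # qs @ [b]) = {p a, p b}"
proof
  have int: "set (a # ps @ [b]) \<inter> set (a # qs @ [b]) = {a, b}"
    using assms(5) by auto
  have "path_edges (a # ps @ [b]) \<inter> path_edges (a # qs @ [b]) = {}"
  proof (rule ccontr)
    assume "path_edges (a # ps @ [b]) \<inter> path_edges (a # qs @ [b]) \<noteq> {}"
    then obtain e where e: "e \<in> path_edges (a # ps @ [b])" "e \<in> path_edges (a # qs @ [b])" by blast
    then have "e \<subseteq> {a, b}" using int path_edges_subset by (metis Int_subset_iff)
    moreover obtain u v where "e = {u, v}" "u \<noteq> v" using path_edges_E[OF assms(1) e(1)] arc_verts by blast
    ultimately have "e = {a, b}" by auto
    then show False using e(1) ends_notin_path_edges assms(3,4) by metis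
  qed
  then show "trace (a # ps @ [b]) \<inter> trace (a # qs @ [b]) \<subseteq> {p a, p b}"
    using trace_meet[OF assms(1,2)] int by auto
  show "{p a, p b} \<subseteq> trace (a # ps @ [b]) \<inter> trace (a # qs @ [b])"
    using verts_in_trace[OF assms(1)] verts_in_trace[OF assms(2)] by auto
qed

lemma inner_point:
  assumes "successively E (a # ps @ [b])" "distinct (a # ps @ [b])" "x \<in> set ps"
  shows "p x \<in> trace (a # ps @ [b]) - {p a, p b}" "p x \<in> frontier (outside (drawing_image G p \<gamma>))"
proof -
  have "a \<in> pverts G" "b \<in> pverts G" "x \<in> pverts G" using successively_verts[OF assms(1)] assms(3) by auto
  then show "p x \<in> trace (a # ps @ [b]) - {p a, p b}"
    "p x \<in> frontier (outside (drawing_image G p \<gamma>))"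
    using verts_in_trace[OF assms(1)] assms(2,3) p_eq_iff outer by auto
qed

text \<open>Inner vertices of the first two paths supply the outer points for
  \<open>theta_not_outer\<close>. The third path may be a single edge.\<close>

lemma chord_inside:
  assumes p1: "successively E (a # ps @ [b])" "distinct (a # ps @ [b])" "ps \<noteq> []"
    and p2: "successively E (a # qs @ [b])" "distinct (a # qs @ [b])" "qs \<noteq> []"
    and p3: "successively E (a # rs @ [b])" "distinct (a # rs @ [b])"
    and disj: "set ps \<inter> set qs = {}" "set ps \<inter> set rs = {}" "set qs \<inter> set rs = {}"
  shows "trace (a # rs @ [b]) - {p a, p b} \<subseteq> inside (trace (a # ps @ [b]) \<union> trace (a # qs @ [b]))"
proof -
  obtain g1 where g1: "arc g1" "pathstart g1 = p a" "pathfinish g1 = p b" "path_image g1 = trace (a # ps @ [b])"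
    by (rule obtain_arc_of_path[OF p1(1,2)])
  obtain g2 where g2: "arc g2" "pathstart g2 = p a" "pathfinish g2 = p b" "path_image g2 = trace (a # qs @ [b])"
    by (rule obtain_arc_of_path[OF p2(1,2)])
  obtain g3 where g3: "arc g3" "pathstart g3 = p a" "pathfinish g3 = p b" "path_image g3 = trace (a # rs @ [b])"
    by (rule obtain_arc_of_path[OF p3(1,2)])
  have "hd ps \<in> set ps" "hd qs \<in> set qs" using p1 p2 by auto
  note x = inner_point[OF p1(1,2) this(1)] inner_point[OF p2(1,2) this(2)]
  note i = trace_meet_ends[OF p1(1) p2(1) p1(2,3) disj(1) p2(2)]
    trace_meet_ends[OF p1(1) p3(1) p1(2,3) disj(2) p3(2)]
    trace_meet_ends[OF p2(1) p3(1) p2(2,3) disj(3) p3(2)]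
  show ?thesis
    using theta_not_outer[OF g1(1) g2(1) g3(1) g1(2) g2(2) g3(2) g1(3) g2(3) g3(3),
        unfolded g1(4) g2(4) g3(4), OF i trace_subset_drawing[OF p1(1)] trace_subset_drawing[OF p2(1)]
        trace_subset_drawing[OF p3(1)] x] .
qed

text \<open>By \<open>chord_inside\<close> an inner vertex of the third path would lie inside the
  curve formed by the other two.\<close>

lemma no_theta:
  assumes p1: "successively E (a # ps @ [b])" "ps \<noteq> []"
    and p2: "successively E (a # qs @ [b])" "qs \<noteq> []"
    and p3: "successively E (a # rs @ [b])" "rs \<noteq> []"
    and dist: "distinct (a # b # ps @ qs @ rs)"
  shows False
proof -
  have d: "distinct (a # ps @ [b])" "distinct (a # qs @ [b])" "distinct (a # rs @ [b])"
    "set ps \<inter> set qs = {}" "set ps \<inter> set rs = {}" "set qs \<inter> set rs = {}"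
    using dist by auto
  have "hd rs \<in> set rs" using p3 by auto
  note x = inner_point[OF p3(1) d(3) this]
  have "closed (trace (a # ps @ [b]))" "closed (trace (a # qs @ [b]))"
    using arc_of_path[OF p1(1) d(1)] arc_of_path[OF p2(1) d(2)] closed_arc_image by metis+
  moreover have "p (hd rs) \<in> inside (trace (a # ps @ [b]) \<union> trace (a # qs @ [b]))"
    using chord_inside[OF p1(1) d(1) p1(2) p2(1) d(2) p2(2) p3(1) d(3-6)] x by blast
  ultimately show False
    using inside_not_frontier_outside[of "trace (a # ps @ [b]) \<union> trace (a # qs @ [b])" "drawing_image G p \<gamma>" "p (hd rs)"]
      x trace_subset_drawing[OF p1(1)] trace_subset_drawing[OF p2(1)] by blast
qed

lemma E_sym: "E u v \<Longrightarrow> E v u"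
proof -
  interpret pair_graph G by (rule graph)
  show "E u v \<Longrightarrow> E v u" using pair_sym_arcs by (auto simp: symmetric_def sym_def)
qed

lemma successively_E_rev: "successively E (rev xs) \<longleftrightarrow> successively E xs"
  unfolding successively_rev by (rule arg_cong2[of _ _ _ _ successively]) (use E_sym in auto)

lemma no_crossing_chords:
  assumes cyc: "successively E (a # ps @ b # qs @ c # rs @ d # ts @ [a])"
    and dist: "distinct (a # ps @ b # qs @ c # rs @ d # ts)"
    and chords: "E a c" "E b d"
  shows False
proof -
  let ?D = "drawing_image G p \<gamma>"
  have s: "successively E (a # (ps @ b # qs) @ [c])" "successively E (c # (rs @ d # ts) @ [a])"
    "successively E (b # (qs @ c # rs) @ [d])" "successively E (d # (ts @ a # ps) @ [b])"
    using cyc successively_append_Cons[of E "a # ps" b "qs @ c # rs @ d # ts @ [a]"]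
      successively_append_Cons[of E "b # qs" c "rs @ d # ts @ [a]"]
      successively_append_Cons[of E "c # rs" d "ts @ [a]"]
      successively_append_Cons[of E "a # ps" b "qs @ [c]"]
      successively_append_Cons[of E "b # qs" c "rs @ [d]"]
      successively_append_Cons[of E "d # ts" a "ps @ [b]"]
    by simp_all
  have s': "successively E (a # (rev ts @ d # rev rs) @ [c])" "successively E (b # (rev ps @ a # rev ts) @ [d])"
    using s(2,4) successively_E_rev[of "c # (rs @ d # ts) @ [a]"] successively_E_rev[of "d # (ts @ a # ps) @ [b]"] by auto
  have d: "distinct (a # (ps @ b # qs) @ [c])" "distinct (a # (rev ts @ d # rev rs) @ [c])"
    "distinct (b # (qs @ c # rs) @ [d])" "distinct (b # (rev ps @ a # rev ts) @ [d])"
    "distinct (a # [] @ [c])" "distinct (b # [] @ [d])"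
    using dist by auto
  have dj: "set (ps @ b # qs) \<inter> set (rev ts @ d # rev rs) = {}" "set (qs @ c # rs) \<inter> set (rev ps @ a # rev ts) = {}"
    using dist by auto
  have e: "successively E (a # [] @ [c])" "successively E (b # [] @ [d])" using chords by auto
  \<comment> \<open>The cycle is cut once at \<open>a\<close>, \<open>c\<close> and once at
    \<open>b\<close>, \<open>d\<close>. Both cuts trace the same curve, so that
    \<open>chord_inside\<close> for the second cut places the chord \<open>bd\<close> inside the
    curve of the first.\<close>
  have same: "trace (b # (qs @ c # rs) @ [d]) \<union> trace (b # (rev ps @ a # rev ts) @ [d])
      = trace (a # (ps @ b # qs) @ [c]) \<union> trace (a # (rev ts @ d # rev rs) @ [c])"
  proof -
    have r: "path_edges (a # (rev ts @ d # rev rs) @ [c]) = path_edges (c # rs @ d # ts @ [a])"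
      "path_edges (b # (rev ps @ a # rev ts) @ [d]) = path_edges (d # ts @ a # ps @ [b])"
      using path_edges_rev[of "c # rs @ d # ts @ [a]"] path_edges_rev[of "d # ts @ a # ps @ [b]"] by simp_all
    have "path_edges (b # (qs @ c # rs) @ [d]) = path_edges (b # qs @ [c]) \<union> path_edges (c # rs @ [d])"
      "path_edges (d # ts @ a # ps @ [b]) = path_edges (d # ts @ [a]) \<union> path_edges (a # ps @ [b])"
      "path_edges (a # (ps @ b # qs) @ [c]) = path_edges (a # ps @ [b]) \<union> path_edges (b # qs @ [c])"
      "path_edges (c # rs @ d # ts @ [a]) = path_edges (c # rs @ [d]) \<union> path_edges (d # ts @ [a])"
      using path_edges_append[of "b # qs" c "rs @ [d]"] path_edges_append[of "d # ts" a "ps @ [b]"]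
        path_edges_append[of "a # ps" b "qs @ [c]"] path_edges_append[of "c # rs" d "ts @ [a]"] by simp_all
    then show ?thesis unfolding trace_def r by blast
  qed
  obtain c1 where c1: "arc c1" "pathstart c1 = p a" "pathfinish c1 = p c" "path_image c1 = trace (a # (ps @ b # qs) @ [c])"
    by (rule obtain_arc_of_path[OF s(1) d(1)])
  obtain c2 where c2: "arc c2" "pathstart c2 = p a" "pathfinish c2 = p c" "path_image c2 = trace (a # (rev ts @ d # rev rs) @ [c])"
    by (rule obtain_arc_of_path[OF s'(1) d(2)])
  obtain e1 where e1: "arc e1" "pathstart e1 = p a" "pathfinish e1 = p c" "path_image e1 = trace (a # [] @ [c])"
    by (rule obtain_arc_of_path[OF e(1) d(5)])
  obtain f where f: "arc f" "pathstart f = p b" "pathfinish f = p d" "path_image f = trace (b # [] @ [d])"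
    by (rule obtain_arc_of_path[OF e(2) d(6)])
  have i: "path_image c1 \<inter> path_image c2 = {p a, p c}" "path_image c1 \<inter> path_image e1 = {p a, p c}"
    "path_image c2 \<inter> path_image e1 = {p a, p c}"
    unfolding c1 c2 e1
    using trace_meet_ends[OF s(1) s'(1) d(1) _ dj(1) d(2)] trace_meet_ends[OF s(1) e(1) d(1) _ _ d(5)]
      trace_meet_ends[OF s'(1) e(1) d(2) _ _ d(5)] by simp_all
  have fi: "path_image f - {p b, p d} \<subseteq> inside (path_image c1 \<union> path_image c2)"
    unfolding f c1 c2 same[symmetric]
    by (rule chord_inside) (use s s' d e dj in auto)
  have "path_edges (b # [] @ [d]) \<inter> path_edges (a # [] @ [c]) = {}"
    using dist by (auto simp: doubleton_eq_iff)
  then have fe: "path_image f \<inter> path_image e1 = {}"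
    unfolding f e1 using trace_meet[OF e(2) e(1)] dist by auto
  have "b \<in> set (ps @ b # qs)" "d \<in> set (rev ts @ d # rev rs)" by auto
  note x = inner_point[OF s(1) d(1) this(1)] inner_point[OF s'(1) d(2) this(2)]
  have D: "path_image c1 \<subseteq> ?D" "path_image c2 \<subseteq> ?D" "path_image e1 \<subseteq> ?D"
    unfolding c1(4) c2(4) e1(4)
    by (rule trace_subset_drawing[OF s(1)] trace_subset_drawing[OF s'(1)] trace_subset_drawing[OF e(1)])+
  have X: "p b \<in> path_image c1 - {p a, p c}" "p d \<in> path_image c2 - {p a, p c}"
    unfolding c1(4) c2(4) by (rule x(1) x(3))+
  show False
    by (rule crossing_chords_not_outer[OF c1(1) c2(1) e1(1) c1(2) c2(2) e1(2) c1(3) c2(3) e1(3) i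
        D X(1) x(2) X(2) x(4) f(1-3) fe fi])
qed

end

section \<open>Vertices of low degree\<close>

text \<open>The first obstruction forbids subdivisions of \<open>K_{2,3}\<close>, the second cycles
  with crossing chords, which are subdivisions of \<open>K_4\<close>. Both speak of \<open>E\<close>
  alone, so they hold on every vertex subset \<open>W\<close>, and vertices can be deleted without
  returning to the drawing.\<close>

locale outer_graph =
  fixes E :: "('a \<times> 'a) set"
  assumes adj_sym: "(u, v) \<in> E \<Longrightarrow> (v, u) \<in> E"
    and adj_irrefl: "(u, u) \<notin> E"
    and no_theta: "\<lbrakk>successively (\<lambda>u v. (u, v) \<in> E) (a # ps @ [b]); ps \<noteq> [];
      successively (\<lambda>u v. (u, v) \<in> E) (a # qs @ [b]); qs \<noteq> [];
      successively (\<lambda>u v. (u, v) \<in> E) (a # rs @ [b]); rs \<noteq> [];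
      distinct (a # b # ps @ qs @ rs)\<rbrakk> \<Longrightarrow> False"
    and no_crossing: "\<lbrakk>successively (\<lambda>u v. (u, v) \<in> E) (a # ps @ b # qs @ c # rs @ d # ts @ [a]);
      distinct (a # ps @ b # qs @ c # rs @ d # ts); (a, c) \<in> E; (b, d) \<in> E\<rbrakk> \<Longrightarrow> False"
begin

abbreviation adj :: "'a \<Rightarrow> 'a \<Rightarrow> bool" where "adj u v \<equiv> (u, v) \<in> E"

definition nb :: "'a set \<Rightarrow> 'a \<Rightarrow> 'a set" where
  "nb W x = {y \<in> W. adj x y}"

definition path_in :: "'a set \<Rightarrow> 'a list \<Rightarrow> bool" where
  "path_in W xs \<longleftrightarrow> distinct xs \<and> set xs \<subseteq> W \<and> successively adj xs"

lemma adj_commute: "adj u v \<longleftrightarrow> adj v u"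
  using adj_sym by blast

lemma successively_adj_rev: "successively adj (rev xs) \<longleftrightarrow> successively adj xs"
  unfolding successively_rev by (rule arg_cong2[of _ _ _ _ successively]) (use adj_sym in auto)

lemma no_crossing_nth:
  assumes d: "distinct cs" and s: "successively adj cs" and cl: "adj (last cs) (hd cs)"
    and i: "0 < q" "q < r" "r < k" "k < length cs"
    and c: "adj (cs ! 0) (cs ! r)" "adj (cs ! q) (cs ! k)"
  shows False
proof -
  define ps where "ps = drop 1 (take q cs)"
  define qs where "qs = drop (Suc q) (take r cs)"
  define rs where "rs = drop (Suc r) (take k cs)"
  define ts where "ts = drop (Suc k) cs"
  have "cs = take k cs @ cs ! k # ts" using id_take_nth_drop[of k cs] i ts_def by simp
  moreover have "take k cs = take r cs @ cs ! r # rs"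
    using id_take_nth_drop[of r "take k cs"] i rs_def by (simp add: min_def)
  moreover have "take r cs = take q cs @ cs ! q # qs"
    using id_take_nth_drop[of q "take r cs"] i qs_def by (simp add: min_def)
  moreover have "take q cs = cs ! 0 # ps"
    using id_take_nth_drop[of 0 "take q cs"] i ps_def by (simp add: min_def)
  ultimately have cs: "cs = cs ! 0 # ps @ cs ! q # qs @ cs ! r # rs @ cs ! k # ts" by simp
  have "cs \<noteq> []" using i by auto
  then have "successively adj (cs @ [cs ! 0])"
    using s cl by (simp add: successively_append_iff hd_conv_nth)
  then have "successively adj (cs ! 0 # ps @ cs ! q # qs @ cs ! r # rs @ cs ! k # ts @ [cs ! 0])"
    using arg_cong[OF cs, of "\<lambda>xs. xs @ [cs ! 0]"] by simp
  moreover have "distinct (cs ! 0 # ps @ cs ! q # qs @ cs ! r # rs @ cs ! k # ts)"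
    using d cs by metis
  ultimately show False using no_crossing c by blast
qed

text \<open>A longest path with end \<open>l\<close> whose start \<open>v\<^sub>0\<close> has at least three neighbours, the second
  being \<open>v\<^sub>i\<close>, can be rotated to start at \<open>v\<^sub>i\<^sub>-\<^sub>1\<close>. Because chords do not cross, the third
  neighbour of \<open>v\<^sub>i\<^sub>-\<^sub>1\<close> precedes it, so that \<open>i\<close> decreases.\<close>

lemma longest_path_low_degree_start:
  assumes fin: "finite W" and xs: "path_in W xs" "xs \<noteq> []"
    and longest: "\<And>ys. path_in W ys \<Longrightarrow> length ys \<le> length xs"
  shows "\<exists>ys. path_in W ys \<and> length ys = length xs \<and> last ys = last xs \<and> card (nb W (hd ys)) \<le> 2"
proof (rule ccontr)
  define K where "K ys \<longleftrightarrow> path_in W ys \<and> length ys = length xs \<and> last ys = last xs" for ys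
  \<comment> \<open>Position 1 holds a neighbour of the start anyway, so the second neighbour is
    sought from position 2 on.\<close>
  define idx where "idx ys = (LEAST i. 2 \<le> i \<and> i < length ys \<and> adj (ys ! 0) (ys ! i))" for ys
  assume "\<not> ?thesis"
  then have big: "card (nb W (hd ys)) \<ge> 3" if "K ys" for ys
    using that K_def by (metis not_less_eq_eq numeral_2_eq_2 numeral_3_eq_3)
  \<comment> \<open>By maximality all neighbours of the start lie on the path; there are at least
    three, so one avoids any two given positions.\<close>
  have nbs: "\<exists>m < length ys. m \<notin> {k, l} \<and> adj (ys ! 0) (ys ! m)" if K: "K ys" for ys k l
  proof (rule ccontr)
    define M where "M = {k, l}"
    have M: "card M \<le> 2" "finite M" unfolding M_def by (cases "k = l"; simp)+
    assume neg: "\<not> ?thesis"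
    have ne: "ys \<noteq> []" using K xs(2) K_def by auto
    have "nb W (ys ! 0) \<subseteq> set ys"
    proof
      fix y assume y: "y \<in> nb W (ys ! 0)"
      show "y \<in> set ys"
      proof (rule ccontr)
        assume "y \<notin> set ys"
        then have "path_in W (y # ys)"
          using y K ne adj_commute by (auto simp: K_def path_in_def nb_def successively_Cons hd_conv_nth)
        then show False using longest[of "y # ys"] K K_def by auto
      qed
    qed
    then have "nb W (ys ! 0) \<subseteq> (!) ys ` M"
      using neg by (force simp: in_set_conv_nth nb_def M_def)
    then have "card (nb W (ys ! 0)) \<le> card M"
      using M by (meson card_image_le card_mono finite_imageI order_trans)
    then show False using big[OF K] M ne by (simp add: hd_conv_nth)
  qed
  have "K xs" using xs K_def by auto
  then obtain ys where K: "K ys" and least: "\<And>zs. K zs \<Longrightarrow> idx ys \<le> idx zs"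
    using ex_has_least_nat[of K xs idx] by blast
  define i where "i = idx ys"
  have dist: "distinct ys" and sub: "set ys \<subseteq> W" and succ: "successively adj ys" and ne: "ys \<noteq> []"
    using K xs(2) by (auto simp: K_def path_in_def)
  obtain m0 where m0: "m0 < length ys" "m0 \<notin> {0, 1}" "adj (ys ! 0) (ys ! m0)"
    using nbs[OF K, of 0 1] by auto
  then have "2 \<le> m0 \<and> m0 < length ys \<and> adj (ys ! 0) (ys ! m0)" by auto
  then have i: "2 \<le> i" "i < length ys" "adj (ys ! 0) (ys ! i)"
    unfolding i_def idx_def by (metis (mono_tags, lifting) LeastI)+
  have i_least: "i \<le> m" if "2 \<le> m" "m < length ys" "adj (ys ! 0) (ys ! m)" for m
    unfolding i_def idx_def by (rule Least_le) (use that in auto)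
  obtain j where j: "j < length ys" "j \<notin> {1, i}" "adj (ys ! 0) (ys ! j)"
    using nbs[OF K, of 1 i] by auto
  have "j \<noteq> 0" using j(3) adj_irrefl by metis
  then have ij: "i < j" using i_least[of j] j by auto
  define zs where "zs = rev (take i ys) @ drop i ys"
  have succ_td: "successively adj (take n ys)" "successively adj (drop n ys)" for n
    using succ successively_append_iff[of adj "take n ys" "drop n ys"] by auto
  have "set zs = set ys" unfolding zs_def by (metis append_take_drop_id set_append set_rev)
  moreover have "distinct zs" unfolding zs_def using dist
    by (metis append_take_drop_id distinct_append distinct_rev set_rev)
  moreover have "successively adj zs"
  proof -
    have "last (rev (take i ys)) = ys ! 0" "hd (drop i ys) = ys ! i"
      using i ne by (simp_all add: last_rev hd_conv_nth hd_drop_conv_nth)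
    then show ?thesis
      unfolding zs_def successively_append_iff successively_adj_rev using succ_td i(3) by auto
  qed
  moreover have "last zs = last ys" "length zs = length ys"
    unfolding zs_def using i by auto
  ultimately have Kz: "K zs" using K sub by (auto simp: K_def path_in_def)
  have zs_nth: "zs ! k = ys ! (i - Suc k)" if "k < i" for k
    using that i by (simp add: zs_def nth_append rev_nth)
  have zs_nth': "zs ! k = ys ! k" if "k \<ge> i" "k < length ys" for k
    using that i by (simp add: zs_def nth_append)
  \<comment> \<open>Positions 1 and \<open>i\<close> of \<open>zs\<close> hold the two neighbours
    that the new start has along the old path; a third one is wanted.\<close>
  obtain m1 where m1: "m1 < length zs" "m1 \<notin> {1, i}" "adj (zs ! 0) (zs ! m1)"
    using nbs[OF Kz, of 1 i] by auto
  have m10: "m1 \<noteq> 0" using m1(3) adj_irrefl by metis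
  have z0: "zs ! 0 = ys ! (i - 1)" using zs_nth[of 0] i by simp
  show False
  proof (cases "m1 < i")
    case True
    then have "2 \<le> m1 \<and> m1 < length zs \<and> adj (zs ! 0) (zs ! m1)" using m1 m10 by auto
    then have "idx zs \<le> m1" unfolding idx_def by (rule Least_le)
    then show False using least[OF Kz] True i_def by auto
  next
    case False
    define m where "m = m1"
    have m: "i < m" "m < length ys" "adj (ys ! (i - 1)) (ys ! m)"
      using False m1 z0 zs_nth'[of m1] \<open>length zs = length ys\<close> by (auto simp: m_def)
    show False
    proof (cases "m \<le> j")
      case True
      \<comment> \<open>The cycle is the initial segment up to position \<open>j\<close>, closed by
        the chord from 0 to \<open>j\<close>. In it the chord from 0 to \<open>i\<close> crosses the
        one from \<open>i - 1\<close> to \<open>m\<close>.\<close>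
      show False
      proof (rule no_crossing_nth[of "take (Suc j) ys" "i - 1" i m])
        have "last (take (Suc j) ys) = ys ! j" "hd (take (Suc j) ys) = ys ! 0"
          using j ne by (simp add: take_Suc_conv_app_nth, cases ys, auto)
        then show "adj (last (take (Suc j) ys)) (hd (take (Suc j) ys))" using j adj_commute by auto
      qed (use dist succ_td i j m True in auto)
    next
      case False
      \<comment> \<open>This cycle runs from 0 to \<open>i - 1\<close>, jumps to \<open>m\<close>,
        returns down to \<open>i\<close> and closes by the chord from \<open>i\<close> to 0. The
        path edge between \<open>i - 1\<close> and \<open>i\<close> is now a chord and crosses the
        one from 0 to \<open>j\<close>.\<close>
      define cs where "cs = take i ys @ rev (drop i (take (Suc m) ys))"
      have len: "length cs = Suc m" using i m by (simp add: cs_def min_def)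
      then have ne_cs: "cs \<noteq> []" by auto
      have cs1: "cs ! k = ys ! k" if "k < i" for k using that i by (simp add: cs_def nth_append)
      have cs2: "cs ! k = ys ! (i + m - k)" if "i \<le> k" "k \<le> m" for k
      proof -
        have L: "length (drop i (take (Suc m) ys)) = Suc m - i" using m by simp
        then have "rev (drop i (take (Suc m) ys)) ! (k - i)
            = drop i (take (Suc m) ys) ! (length (drop i (take (Suc m) ys)) - Suc (k - i))"
          by (intro rev_nth) (use that in auto)
        also have "length (drop i (take (Suc m) ys)) - Suc (k - i) = m - k" using L that by auto
        finally have "rev (drop i (take (Suc m) ys)) ! (k - i) = drop i (take (Suc m) ys) ! (m - k)" .
        then show ?thesis using that i m by (simp add: cs_def nth_append)
      qed
      have "successively adj (drop i (take (Suc m) ys))"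
        using succ_td(1)[of "Suc m"] by (metis append_take_drop_id successively_append_iff)
      moreover have "last (take i ys) = ys ! (i - 1)" using i ne by (auto simp: last_conv_nth min_def)
      moreover have "hd (rev (drop i (take (Suc m) ys))) = ys ! m"
        using i m by (simp add: hd_rev take_Suc_conv_app_nth)
      ultimately have succ_cs: "successively adj cs"
        unfolding cs_def successively_append_iff successively_adj_rev using succ_td m by auto
      have "set (take i ys) \<inter> set (drop i ys) = {}"
        using dist by (metis append_take_drop_id distinct_append)
      then have dist_cs: "distinct cs"
        using dist set_take_subset[of "Suc m - i" "drop i ys"] unfolding cs_def by (auto simp: drop_take)
      show False
      proof (rule no_crossing_nth[of cs "i - 1" "i + m - j" m])
        have "last cs = ys ! i" "hd cs = ys ! 0"
          using last_conv_nth[OF ne_cs] hd_conv_nth[OF ne_cs] len cs1[of 0] cs2[of m] i m by simp_all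
        then show "adj (last cs) (hd cs)" using i adj_commute by auto
        show "adj (cs ! 0) (cs ! (i + m - j))" using cs1[of 0] cs2[of "i + m - j"] i j ij m False by auto
        have "adj (ys ! (i - 1)) (ys ! i)"
          using succ i successively_conv_nth[of adj ys] by (metis Suc_diff_1 bot_nat_0.not_eq_extremum not_numeral_le_zero)
        then show "adj (cs ! (i - 1)) (cs ! m)" using cs1[of "i - 1"] cs2[of m] i m by auto
      qed (use dist_cs succ_cs i ij m False len in auto)
    qed
  qed
qed

text \<open>Rotation at the start of a longest path keeps its end. Rotating, reversing and rotating
  again therefore makes both ends of low degree. Having two such vertices allows one prescribed
  vertex to be avoided later.\<close>

lemma two_low_degree:
  assumes fin: "finite W" and "card W \<ge> 2"
  obtains x y where "x \<in> W" "y \<in> W" "x \<noteq> y" "card (nb W x) \<le> 2" "card (nb W y) \<le> 2"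
proof -
  obtain u v where uv: "u \<in> W" "v \<in> W" "u \<noteq> v"
    using assms by (metis card_le_Suc0_iff_eq not_less_eq_eq numeral_2_eq_2)
  have "\<forall>ys. path_in W ys \<longrightarrow> length ys < Suc (card W)"
    using fin by (auto simp: path_in_def less_Suc_eq_le distinct_card[symmetric] intro: card_mono)
  moreover have "path_in W [u]" using uv by (auto simp: path_in_def)
  ultimately obtain xs where xs: "path_in W xs" "\<And>ys. path_in W ys \<Longrightarrow> length ys \<le> length xs"
    using ex_has_greatest_nat[of "path_in W" "[u]" length "Suc (card W)"] by blast
  have "xs \<noteq> []" using xs(2)[OF \<open>path_in W [u]\<close>] by auto
  show ?thesis
  proof (cases "length xs = 1")
    case True
    have "nb W w = {}" if "w \<in> W" for w
    proof (rule ccontr)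
      assume "nb W w \<noteq> {}"
      then obtain y where "y \<in> W" "adj w y" by (auto simp: nb_def)
      then have "path_in W [w, y]" using that adj_irrefl by (auto simp: path_in_def)
      then show False using xs(2)[of "[w, y]"] True by auto
    qed
    then show ?thesis using that[of u v] uv by auto
  next
    case False
    obtain ys where ys: "path_in W ys" "length ys = length xs" "card (nb W (hd ys)) \<le> 2"
      using longest_path_low_degree_start[OF fin xs(1) \<open>xs \<noteq> []\<close> xs(2)] by blast
    then have rev: "path_in W (rev ys)" using successively_adj_rev by (auto simp: path_in_def)
    have ne: "ys \<noteq> []" using ys \<open>xs \<noteq> []\<close> by auto
    obtain zs where zs: "path_in W zs" "length zs = length xs" "last zs = hd ys" "card (nb W (hd zs)) \<le> 2"
      using longest_path_low_degree_start[OF fin rev] ne xs(2) ys(2) by (auto simp: last_rev)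
    have "length xs \<noteq> 0" using \<open>xs \<noteq> []\<close> by simp
    then have "2 \<le> length zs" using zs(2) False by linarith
    then obtain w ws where w: "zs = w # ws" "ws \<noteq> []" by (cases zs) (auto simp: Suc_le_length_iff)
    then have "hd zs \<noteq> last zs" using zs(1) by (auto simp: path_in_def)
    moreover have "hd zs \<in> W" "last zs \<in> W" using zs(1) w by (auto simp: path_in_def)
    ultimately show ?thesis using that zs ys by metis
  qed
qed

text \<open>Pairs are ordered: \<open>ed X X\<close> counts every edge inside \<open>X\<close> twice.\<close>

definition ed :: "'a set \<Rightarrow> 'a set \<Rightarrow> nat" where
  "ed X Y = card (E \<inter> X \<times> Y)"

lemma ed_Un_left: "finite X \<Longrightarrow> finite X' \<Longrightarrow> finite Y \<Longrightarrow> X \<inter> X' = {} \<Longrightarrow> ed (X \<union> X') Y = ed X Y + ed X' Y"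
  unfolding ed_def by (subst card_Un_disjoint[symmetric]) (auto intro: arg_cong[of _ _ card])

lemma ed_Un_right: "finite X \<Longrightarrow> finite Y \<Longrightarrow> finite Y' \<Longrightarrow> Y \<inter> Y' = {} \<Longrightarrow> ed X (Y \<union> Y') = ed X Y + ed X Y'"
  unfolding ed_def by (subst card_Un_disjoint[symmetric]) (auto intro: arg_cong[of _ _ card])

lemma ed_commute: "ed X Y = ed Y X"
  unfolding ed_def
  by (rule bij_betw_same_card[of prod.swap], rule bij_betw_byWitness[where f' = prod.swap]) (auto intro: adj_sym)

lemma ed_singleton_left: "ed {x} Y = card (nb Y x)"
  unfolding ed_def nb_def
  by (rule bij_betw_same_card[of snd], rule bij_betw_byWitness[where f' = "Pair x"]) auto

lemma ed_empty [simp]: "ed {} Y = 0" "ed X {} = 0"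
  by (auto simp: ed_def)

lemma ed_eq_0: "finite X \<Longrightarrow> finite Y \<Longrightarrow> ed X Y = 0 \<longleftrightarrow> (\<forall>x \<in> X. \<forall>y \<in> Y. \<not> adj x y)"
  unfolding ed_def by (auto simp: card_eq_0_iff)

lemma ed_sum: "finite X \<Longrightarrow> finite Y \<Longrightarrow> ed X Y = (\<Sum>x \<in> X. card (nb Y x))"
proof (induction X rule: finite_induct)
  case (insert x X)
  then show ?case using ed_Un_left[of "{x}" X Y] by (simp add: ed_singleton_left)
qed auto

lemma finite_nb: "finite W \<Longrightarrow> finite (nb W x)"
  by (auto simp: nb_def)

lemma ed_remove:
  assumes "finite W" "w \<in> W"
  shows "ed W W = ed (W - {w}) (W - {w}) + 2 * card (nb W w)"
proof -
  have W: "W = (W - {w}) \<union> {w}" using assms by auto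
  have "ed W W = ed (W - {w}) W + ed {w} W"
    using ed_Un_left[of "W - {w}" "{w}" W] assms W by simp
  also have "ed (W - {w}) W = ed (W - {w}) (W - {w}) + ed (W - {w}) {w}"
    using ed_Un_right[of "W - {w}" "W - {w}" "{w}"] assms W by simp
  also have "ed (W - {w}) {w} = ed {w} (W - {w})" by (rule ed_commute)
  also have "\<dots> = card (nb W w)" unfolding ed_singleton_left
    by (rule arg_cong[of _ _ card]) (auto simp: nb_def adj_irrefl)
  also have "ed {w} W = card (nb W w)" by (rule ed_singleton_left)
  finally show ?thesis by simp
qed

text \<open>This is the edge bound for forests, doubled. Of two low degree vertices of
  \<open>insert a W\<close> one differs from \<open>a\<close>; as \<open>a\<close> is among its
  neighbours, it has at most one in \<open>W\<close> and can be deleted.\<close>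

lemma ed_neighbours:
  assumes "finite W" "W \<noteq> {}" "\<And>w. w \<in> W \<Longrightarrow> adj a w"
  shows "ed W W + 2 \<le> 2 * card W"
  using assms
proof (induction W rule: finite_psubset_induct)
  case (psubset W)
  have a: "a \<notin> W" using psubset adj_irrefl by metis
  have "card (insert a W) \<ge> 2"
    using psubset a by (metis One_nat_def Suc_leI card_gt_0_iff card_insert_disjoint numeral_2_eq_2 Suc_le_mono)
  then obtain w where w: "w \<in> W" "card (nb (insert a W) w) \<le> 2"
    using two_low_degree[of "insert a W"] psubset by (metis finite.insertI insertE)
  have "nb (insert a W) w = insert a (nb W w)"
    using w(1) psubset.prems(2) adj_sym by (auto simp: nb_def)
  then have w1: "card (nb W w) \<le> 1"
    using w a psubset.hyps by (simp add: nb_def card_insert_if)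
  show ?case
  proof (cases "W = {w}")
    case True
    then show ?thesis by (simp add: ed_singleton_left nb_def adj_irrefl)
  next
    case False
    then have "ed (W - {w}) (W - {w}) + 2 \<le> 2 * card (W - {w})"
      using psubset w by (intro psubset.IH) auto
    moreover have "card W = Suc (card (W - {w}))" using w psubset.hyps card_Suc_Diff1 by metis
    ultimately show ?thesis using ed_remove[OF psubset.hyps w(1)] w1 by simp
  qed
qed

text \<open>Three common neighbours would form a \<open>K_{2,3}\<close>.\<close>

lemma common_neighbours:
  assumes "finite W" "u \<noteq> v" "\<And>w. w \<in> W \<Longrightarrow> adj u w \<and> adj v w"
  shows "card W \<le> 2"
proof (rule ccontr)
  assume "\<not> card W \<le> 2"
  then have "3 \<le> card W" by simp
  then obtain T where "T \<subseteq> W" "card T = 3" by (meson obtain_subset_with_card_n)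
  then obtain x y z where xyz: "x \<in> W" "y \<in> W" "z \<in> W" "distinct [x, y, z]"
    by (auto simp: card_3_iff)
  have *: "adj u w \<and> adj w v \<and> u \<noteq> w \<and> v \<noteq> w" if "w \<in> W" for w
    using assms(3)[OF that] adj_sym[of v w] adj_irrefl[of w] by auto
  show False
    by (rule no_theta[of u "[x]" v "[y]" "[z]"])
      (use *[OF xyz(1)] *[OF xyz(2)] *[OF xyz(3)] xyz(4) assms(2) in simp_all)
qed

section \<open>Counting paths through a vertex\<close>

text \<open>Paths are oriented, so every copy of \<open>P\<^sub>4\<close> is counted twice. Reversal exchanges the first
  and the last and the two middle positions, whence a vertex lies on twice as many oriented
  paths as it starts or is second in.\<close>

definition paths4 :: "'a set \<Rightarrow> ('a \<times> 'a \<times> 'a \<times> 'a) set" where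
  "paths4 W = {(w, x, y, z). {w, x, y, z} \<subseteq> W \<and> distinct [w, x, y, z] \<and> adj w x \<and> adj x y \<and> adj y z}"

definition starting :: "'a set \<Rightarrow> 'a \<Rightarrow> ('a \<times> 'a \<times> 'a) set" where
  "starting W v = {(x, y, z). (v, x, y, z) \<in> paths4 W}"

definition second :: "'a set \<Rightarrow> 'a \<Rightarrow> ('a \<times> 'a \<times> 'a) set" where
  "second W v = {(w, y, z). (w, v, y, z) \<in> paths4 W}"

definition through :: "'a set \<Rightarrow> 'a \<Rightarrow> nat" where
  "through W v = card (starting W v) + card (second W v)"

lemma finite_paths4: "finite W \<Longrightarrow> finite (paths4 W)"
  by (rule finite_subset[of _ "W \<times> W \<times> W \<times> W"]) (auto simp: paths4_def)

lemma finite_starting: "finite W \<Longrightarrow> finite (starting W v)"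
  by (rule finite_subset[of _ "W \<times> W \<times> W"]) (auto simp: paths4_def starting_def)

lemma finite_second: "finite W \<Longrightarrow> finite (second W v)"
  by (rule finite_subset[of _ "W \<times> W \<times> W"]) (auto simp: paths4_def second_def)

lemma card_paths4_remove:
  assumes "finite W" "v \<in> W"
  shows "card (paths4 W) = card (paths4 (W - {v})) + 2 * through W v"
proof -
  define f1 f4 f2 f3 :: "'a \<times> 'a \<times> 'a \<Rightarrow> 'a \<times> 'a \<times> 'a \<times> 'a"
    where "f1 = (\<lambda>(x, y, z). (v, x, y, z))" and "f4 = (\<lambda>(x, y, z). (z, y, x, v))"
    and "f2 = (\<lambda>(w, y, z). (w, v, y, z))" and "f3 = (\<lambda>(w, y, z). (z, y, v, w))"
  note f = f1_def f4_def f2_def f3_def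
  have rev: "(w, x, y, z) \<in> paths4 W \<longleftrightarrow> (z, y, x, w) \<in> paths4 W" for w x y z
    by (auto simp: paths4_def intro: adj_sym)
  have "paths4 W = paths4 (W - {v}) \<union> (f1 ` starting W v \<union> f4 ` starting W v) \<union> (f2 ` second W v \<union> f3 ` second W v)"
    (is "_ = ?R")
  proof
    show "?R \<subseteq> paths4 W"
      using rev by (auto simp: f starting_def second_def) (auto simp: paths4_def)
    show "paths4 W \<subseteq> ?R"
    proof
      fix t assume t: "t \<in> paths4 W"
      obtain w x y z where tt: "t = (w, x, y, z)" by (cases t)
      consider "t \<in> paths4 (W - {v})" | "w = v" | "x = v" | "y = v" | "z = v"
        using t tt by (auto simp: paths4_def)
      then show "t \<in> ?R"
      proof cases
        case 2 then have "t = f1 (x, y, z)" "(x, y, z) \<in> starting W v" using t tt by (auto simp: f starting_def)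
        then show ?thesis by blast
      next
        case 3 then have "t = f2 (w, y, z)" "(w, y, z) \<in> second W v" using t tt by (auto simp: f second_def)
        then show ?thesis by blast
      next
        case 4 then have "t = f3 (z, x, w)" "(z, x, w) \<in> second W v"
          using t tt rev[of w x y z] by (auto simp: f second_def)
        then show ?thesis by blast
      next
        case 5 then have "t = f4 (y, x, w)" "(y, x, w) \<in> starting W v"
          using t tt rev[of w x y z] by (auto simp: f starting_def)
        then show ?thesis by blast
      qed blast
    qed
  qed
  also have "card \<dots> = card (paths4 (W - {v})) + (card (f1 ` starting W v) + card (f4 ` starting W v))
      + (card (f2 ` second W v) + card (f3 ` second W v))"
  proof -
    have fin: "finite (paths4 (W - {v}))" "finite (f1 ` starting W v)" "finite (f4 ` starting W v)"
      "finite (f2 ` second W v)" "finite (f3 ` second W v)"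
      using assms(1) by (simp_all add: finite_paths4 finite_starting finite_second)
    \<comment> \<open>The position of \<open>v\<close> in the path, with 0 for absent; it separates
      the five pieces from each other.\<close>
    define sg :: "'a \<times> 'a \<times> 'a \<times> 'a \<Rightarrow> nat" where
      "sg = (\<lambda>(w, x, y, z). if w = v then 1 else if x = v then 2 else if y = v then 3 else if z = v then 4 else 0)"
    have sg: "sg ` paths4 (W - {v}) \<subseteq> {0}" "sg ` (f1 ` starting W v) \<subseteq> {1}" "sg ` (f2 ` second W v) \<subseteq> {2}"
      "sg ` (f3 ` second W v) \<subseteq> {3}" "sg ` (f4 ` starting W v) \<subseteq> {4}"
      by (auto simp: f sg_def starting_def second_def paths4_def)
    have "X \<inter> Y = {}" if "sg ` X \<subseteq> {i}" "sg ` Y \<subseteq> {j}" "i \<noteq> j" for X Y i j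
      using that by blast
    note d = this[OF sg(1) sg(2)] this[OF sg(1) sg(3)] this[OF sg(1) sg(4)] this[OF sg(1) sg(5)]
      this[OF sg(2) sg(3)] this[OF sg(2) sg(4)] this[OF sg(2) sg(5)]
      this[OF sg(5) sg(3)] this[OF sg(5) sg(4)] this[OF sg(3) sg(4)]
    have "f1 ` starting W v \<inter> f4 ` starting W v = {}" "f2 ` second W v \<inter> f3 ` second W v = {}"
      "paths4 (W - {v}) \<inter> (f1 ` starting W v \<union> f4 ` starting W v) = {}"
      "(paths4 (W - {v}) \<union> (f1 ` starting W v \<union> f4 ` starting W v)) \<inter> (f2 ` second W v \<union> f3 ` second W v) = {}"
      using d by (simp_all add: Int_Un_distrib Int_Un_distrib2)
    then show ?thesis using fin by (simp add: card_Un_disjoint)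
  qed
  also have "card (f1 ` starting W v) = card (starting W v)" by (rule card_image) (auto simp: f inj_on_def)
  also have "card (f4 ` starting W v) = card (starting W v)" by (rule card_image) (auto simp: f inj_on_def)
  also have "card (f2 ` second W v) = card (second W v)" by (rule card_image) (auto simp: f inj_on_def)
  also have "card (f3 ` second W v) = card (second W v)" by (rule card_image) (auto simp: f inj_on_def)
  finally show ?thesis by (simp add: through_def)
qed

text \<open>For a vertex \<open>v\<close> with neighbours \<open>a\<close> and \<open>b\<close>, \<open>side\<close> collects the further neighbours of \<open>a\<close>, and
  \<open>rest\<close> the vertices seen by neither end. In an ear the two sides meet in the single
  vertex \<open>c\<close>, and \<open>inner\<close> is a side without it.\<close>

definition side :: "'a set \<Rightarrow> 'a \<Rightarrow> 'a \<Rightarrow> 'a \<Rightarrow> 'a set" where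
  "side W v a b = nb W a - {v, b}"

definition rest :: "'a set \<Rightarrow> 'a \<Rightarrow> 'a \<Rightarrow> 'a set" where
  "rest W a b = W - insert a (insert b (nb W a \<union> nb W b))"

lemma finite_side: "finite W \<Longrightarrow> finite (side W v a b)" and finite_rest: "finite W \<Longrightarrow> finite (rest W a b)"
  by (auto simp: side_def rest_def nb_def)

lemma rest_commute: "rest W a b = rest W b a"
  by (auto simp: rest_def)

text \<open>A triple \<open>(a, b, z)\<close> stands for the path \<open>a v b z\<close> with
  \<open>v\<close> second and, if \<open>a\<close> and \<open>b\<close> are adjacent, also for
  \<open>v a b z\<close>; hence the factor. The \<open>ed\<close> terms count the paths
  \<open>v a y z\<close> with \<open>y\<close> different from \<open>b\<close>, and those with
  \<open>a\<close> and \<open>b\<close> exchanged.\<close>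

lemma through_degree_two:
  assumes fin: "finite W" and v: "v \<in> W" and nv: "nb W v = {a, b}" and ab: "a \<noteq> b"
  shows "through W v = (if adj a b then 2 else 1) * (card (side W v a b) + card (side W v b a))
      + ed (side W v a b) (W - {a}) + ed (side W v b a) (W - {b})"
proof -
  let ?A = "side W v a b" and ?B = "side W v b a"
  have va: "y \<in> W \<Longrightarrow> adj v y \<longleftrightarrow> y = a \<or> y = b" for y using nv by (auto simp: nb_def)
  have va': "y \<in> W \<Longrightarrow> adj y v \<longleftrightarrow> y = a \<or> y = b" for y using va adj_commute by auto
  have in_W: "a \<in> W" "b \<in> W" using nv by (auto simp: nb_def)
  have vab: "v \<noteq> a" "v \<noteq> b" using va'[OF v] adj_irrefl by auto
  define S1 S2 S3 S4 where "S1 = Pair a ` (E \<inter> ?A \<times> (W - {a}))" and "S2 = Pair b ` (E \<inter> ?B \<times> (W - {b}))"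
    and "S3 = (\<lambda>z. (a, b, z)) ` ?B" and "S4 = (\<lambda>z. (b, a, z)) ` ?A"
  note S = S1_def S2_def S3_def S4_def
  have finS: "finite S1" "finite S2" "finite S3" "finite S4"
    using fin finite_side unfolding S by auto
  have card: "card S1 = ed ?A (W - {a})" "card S2 = ed ?B (W - {b})" "card S3 = card ?B" "card S4 = card ?A"
    unfolding S ed_def by (rule card_image, simp add: inj_on_def)+
  have disj: "S1 \<inter> S2 = {}" "S1 \<inter> S3 = {}" "S1 \<inter> S4 = {}" "S2 \<inter> S3 = {}" "S2 \<inter> S4 = {}" "S3 \<inter> S4 = {}"
    using ab unfolding S by (auto simp: side_def)
  have sec: "second W v = S3 \<union> S4"
  proof
    show "second W v \<subseteq> S3 \<union> S4"
      using va va' by (auto simp: second_def paths4_def S side_def nb_def)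
    show "S3 \<union> S4 \<subseteq> second W v"
      using in_W v vab ab va va' adj_irrefl by (auto simp: second_def paths4_def S side_def nb_def)
  qed
  have st: "starting W v = S1 \<union> S2 \<union> (if adj a b then S3 \<union> S4 else {})"
  proof
    show "starting W v \<subseteq> S1 \<union> S2 \<union> (if adj a b then S3 \<union> S4 else {})"
    proof
      fix t assume t: "t \<in> starting W v"
      obtain x y z where tt: "t = (x, y, z)" by (cases t)
      have p: "{x, y, z} \<subseteq> W" "distinct [v, x, y, z]" "adj v x" "adj x y" "adj y z"
        using t tt by (auto simp: starting_def paths4_def)
      then have "x = a \<or> x = b" using va by auto
      then show "t \<in> S1 \<union> S2 \<union> (if adj a b then S3 \<union> S4 else {})"
      proof
        assume x: "x = a"
        show ?thesis
        proof (cases "y = b")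
          case True
          then have "t \<in> S3" "adj a b" using x p tt by (auto simp: S side_def nb_def)
          then show ?thesis by auto
        next
          case False
          then have "t \<in> S1" using x p tt by (auto simp: S side_def nb_def)
          then show ?thesis by auto
        qed
      next
        assume x: "x = b"
        show ?thesis
        proof (cases "y = a")
          case True
          then have "t \<in> S4" "adj a b" using x p tt adj_sym by (auto simp: S side_def nb_def)
          then show ?thesis by auto
        next
          case False
          then have "t \<in> S2" using x p tt by (auto simp: S side_def nb_def)
          then show ?thesis by auto
        qed
      qed
    qed
    have "S1 \<subseteq> starting W v"
    proof
      fix t assume "t \<in> S1"
      then obtain y z where tt: "t = (a, y, z)" "adj y z" "y \<in> W" "adj a y" "y \<noteq> v" "y \<noteq> b" "z \<in> W" "z \<noteq> a"
        by (auto simp: S side_def nb_def)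
      moreover have "y \<noteq> a" "z \<noteq> y" using tt adj_irrefl by auto
      moreover have "z \<noteq> v" using tt va'[of y] \<open>y \<noteq> a\<close> by auto
      ultimately show "t \<in> starting W v" using v vab in_W va by (auto simp: starting_def paths4_def)
    qed
    moreover have "S2 \<subseteq> starting W v"
    proof
      fix t assume "t \<in> S2"
      then obtain y z where tt: "t = (b, y, z)" "adj y z" "y \<in> W" "adj b y" "y \<noteq> v" "y \<noteq> a" "z \<in> W" "z \<noteq> b"
        by (auto simp: S side_def nb_def)
      moreover have "y \<noteq> b" "z \<noteq> y" using tt adj_irrefl by auto
      moreover have "z \<noteq> v" using tt va'[of y] \<open>y \<noteq> b\<close> by auto
      ultimately show "t \<in> starting W v" using v vab in_W va by (auto simp: starting_def paths4_def)
    qed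
    moreover have "S3 \<union> S4 \<subseteq> starting W v" if "adj a b"
      using that in_W v vab ab va adj_sym[OF that] adj_irrefl by (auto simp: starting_def paths4_def S side_def nb_def)
    ultimately show "S1 \<union> S2 \<union> (if adj a b then S3 \<union> S4 else {}) \<subseteq> starting W v" by auto
  qed
  have c34: "card (S3 \<union> S4) = card ?A + card ?B" using finS disj card by (simp add: card_Un_disjoint)
  have c12: "card (S1 \<union> S2) = ed ?A (W - {a}) + ed ?B (W - {b})" using finS disj card by (simp add: card_Un_disjoint)
  have "card (S1 \<union> S2 \<union> (S3 \<union> S4)) = card (S1 \<union> S2) + card (S3 \<union> S4)"
    using finS disj by (intro card_Un_disjoint) auto
  then show ?thesis unfolding through_def sec st using c34 c12 by simp
qed

text \<open>All these paths have the form \<open>v a y z\<close>. The pairs inside the neighbourhood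
  \<open>A\<close> of \<open>a\<close> number at most \<open>2 * card A\<close> by the forest bound,
  and each further vertex has at most two neighbours in \<open>A\<close>.\<close>

lemma through_degree_one:
  assumes fin: "finite W" and v: "v \<in> W" and nv: "nb W v = {a}"
  shows "through W v + 4 \<le> 2 * card W"
proof -
  have va: "y \<in> W \<Longrightarrow> adj v y \<longleftrightarrow> y = a" for y using nv by (auto simp: nb_def)
  have va': "y \<in> W \<Longrightarrow> adj y v \<longleftrightarrow> y = a" for y using va adj_commute by auto
  have aW: "a \<in> W" using nv by (auto simp: nb_def)
  have av: "a \<noteq> v" using va[OF aW] adj_irrefl by metis
  define A where "A = nb W a - {v}"
  define Z where "Z = W - {v, a} - A"
  have fA: "finite A" "finite Z" using fin by (auto simp: A_def Z_def nb_def)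
  have aA: "a \<notin> A" by (auto simp: A_def nb_def adj_irrefl)
  have sec: "second W v = {}"
    using va va' by (auto simp: second_def paths4_def)
  have "starting W v \<subseteq> Pair a ` (E \<inter> A \<times> (A \<union> Z))"
  proof
    fix t assume t: "t \<in> starting W v"
    obtain x y z where tt: "t = (x, y, z)" by (cases t)
    have p: "{x, y, z} \<subseteq> W" "distinct [v, x, y, z]" "adj v x" "adj x y" "adj y z"
      using t tt by (auto simp: starting_def paths4_def)
    then have "x = a" using va by auto
    then have "(y, z) \<in> E \<inter> A \<times> (A \<union> Z)" using p by (auto simp: A_def Z_def nb_def)
    then show "t \<in> Pair a ` (E \<inter> A \<times> (A \<union> Z))" using tt \<open>x = a\<close> by blast
  qed
  then have "card (starting W v) \<le> card (Pair a ` (E \<inter> A \<times> (A \<union> Z)))"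
    using fA by (intro card_mono) auto
  also have "\<dots> = ed A (A \<union> Z)" unfolding ed_def by (rule card_image) (simp add: inj_on_def)
  also have "\<dots> = ed A A + ed A Z" using fA by (intro ed_Un_right) (auto simp: Z_def)
  finally have le: "through W v \<le> ed A A + ed A Z" using sec by (simp add: through_def)
  have "adj a w" if "w \<in> A" for w using that by (simp add: A_def nb_def)
  then have "ed A A \<le> 2 * card A"
    using ed_neighbours[of A a] fA(1) by (cases "A = {}") auto
  moreover have "ed Z A \<le> (\<Sum>z \<in> Z. 2)"
    unfolding ed_sum[OF fA(2,1)]
  proof (rule sum_mono)
    fix z assume "z \<in> Z"
    then show "card (nb A z) \<le> 2"
      using fA by (intro common_neighbours[of _ z a]) (auto simp: Z_def A_def nb_def)
  qed
  moreover have "card W = card A + card Z + 2"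
  proof -
    have "W = A \<union> Z \<union> {v, a}" using v aW by (auto simp: A_def Z_def nb_def)
    moreover have "card (A \<union> Z \<union> {v, a}) = card (A \<union> Z) + card {v, a}"
      using fA aA by (intro card_Un_disjoint) (auto simp: Z_def A_def)
    moreover have "card (A \<union> Z) = card A + card Z" using fA by (intro card_Un_disjoint) (auto simp: Z_def)
    ultimately show ?thesis using av by simp
  qed
  ultimately show ?thesis using le by (simp add: ed_commute[of Z A])
qed

lemma through_degree_zero:
  assumes "nb W v = {}"
  shows "through W v = 0"
proof -
  have "starting W v = {}" "second W v = {}"
    using assms adj_sym by (auto simp: starting_def second_def paths4_def nb_def)
  then show ?thesis by (simp add: through_def)
qed

section \<open>The cost of deleting a vertex of degree two\<close>

definition ear :: "'a set \<Rightarrow> 'a \<Rightarrow> 'a \<Rightarrow> 'a \<Rightarrow> 'a \<Rightarrow> bool" where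
  "ear W v a b c \<longleftrightarrow> v \<in> W \<and> nb W v = {a, b} \<and> a \<noteq> b \<and> c \<in> W \<and> c \<noteq> v \<and> adj a c \<and> adj b c"

definition inner :: "'a set \<Rightarrow> 'a \<Rightarrow> 'a \<Rightarrow> 'a \<Rightarrow> 'a \<Rightarrow> 'a set" where
  "inner W v a b c = side W v a b - {c}"

lemma ear_sym: "ear W v a b c \<Longrightarrow> ear W v b a c"
  by (auto simp: ear_def)

lemma earD:
  assumes "ear W v a b c"
  shows "v \<in> W" "a \<in> W" "b \<in> W" "c \<in> W" "a \<noteq> b" "v \<noteq> a" "v \<noteq> b" "c \<noteq> v" "c \<noteq> a" "c \<noteq> b"
    "adj v a" "adj v b" "adj a v" "adj b v" "adj a c" "adj c a" "adj b c" "adj c b"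
    "\<And>y. y \<in> W \<Longrightarrow> adj v y \<longleftrightarrow> y = a \<or> y = b" "\<And>y. y \<in> W \<Longrightarrow> adj y v \<longleftrightarrow> y = a \<or> y = b"
proof -
  have n: "nb W v = {a, b}" using assms by (simp add: ear_def)
  then show 1: "a \<in> W" "b \<in> W" "adj v a" "adj v b"
    and 2: "\<And>y. y \<in> W \<Longrightarrow> adj v y \<longleftrightarrow> y = a \<or> y = b" by (auto simp: nb_def)
  then show "\<And>y. y \<in> W \<Longrightarrow> adj y v \<longleftrightarrow> y = a \<or> y = b" using adj_commute by auto
  show 3: "v \<in> W" "c \<in> W" "a \<noteq> b" "c \<noteq> v" "adj a c" "adj b c" using assms by (auto simp: ear_def)
  show "adj a v" "adj b v" "adj c a" "adj c b" using 1 3 adj_sym by auto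
  show "v \<noteq> a" "v \<noteq> b" "c \<noteq> a" "c \<noteq> b" using 1 3 adj_irrefl by auto
qed

text \<open>With \<open>v\<close> and \<open>c\<close>, any further vertex of the intersection would
  be a third common neighbour of \<open>a\<close> and \<open>b\<close>.\<close>

lemma side_Int:
  assumes "finite W" "ear W v a b c"
  shows "side W v a b \<inter> side W v b a = {c}"
proof -
  note e = earD[OF assms(2)]
  have "c \<in> side W v a b \<inter> side W v b a" using e by (auto simp: side_def nb_def)
  moreover have "x = c" if x: "x \<in> side W v a b \<inter> side W v b a" for x
  proof (rule ccontr)
    assume "x \<noteq> c"
    then have "card {v, c, x} = 3" using x e by (auto simp: side_def)
    moreover have "card {v, c, x} \<le> 2"
      using x e by (intro common_neighbours[of _ a b]) (auto simp: side_def nb_def)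
    ultimately show False by simp
  qed
  ultimately show ?thesis by blast
qed

lemma innerD:
  assumes "ear W v a b c" "x \<in> inner W v a b c"
  shows "x \<in> W" "adj a x" "adj x a" "x \<noteq> v" "x \<noteq> a" "x \<noteq> b" "x \<noteq> c"
  using assms adj_sym adj_irrefl by (auto simp: inner_def side_def nb_def)

lemma inner_not_adj:
  assumes "finite W" "ear W v a b c" "x \<in> inner W v a b c"
  shows "\<not> adj b x" "\<not> adj x b"
proof -
  show "\<not> adj b x"
  proof
    assume "adj b x"
    then have "x \<in> side W v a b \<inter> side W v b a"
      using innerD[OF assms(2,3)] by (auto simp: side_def nb_def)
    then show False using side_Int[OF assms(1,2)] innerD(7)[OF assms(2,3)] by auto
  qed
  then show "\<not> adj x b" using adj_commute by auto
qed

text \<open>An edge \<open>xy\<close> would give the third path \<open>a x y b\<close> beside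
  \<open>a v b\<close> and \<open>a c b\<close>.\<close>

lemma inner_no_edge:
  assumes "finite W" "ear W v a b c" "x \<in> inner W v a b c" "y \<in> inner W v b a c"
  shows "\<not> adj x y" "x \<noteq> y"
proof -
  note e = earD[OF assms(2)] and x = innerD[OF assms(2,3)] and y = innerD[OF ear_sym[OF assms(2)] assms(4)]
  show xy: "x \<noteq> y" using inner_not_adj[OF assms(1-3)] y by auto
  show "\<not> adj x y"
  proof
    assume "adj x y"
    then show False
      by (intro no_theta[of a "[v]" b "[c]" "[x, y]"]) (use e x y xy in simp_all)
  qed
qed

text \<open>Again a third path beside \<open>a v b\<close> and \<open>a c b\<close>, now
  \<open>a x z y b\<close>.\<close>

lemma inner_no_link:
  assumes "finite W" "ear W v a b c" "x \<in> inner W v a b c" "y \<in> inner W v b a c" "z \<in> rest W a b"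
  shows "\<not> (adj z x \<and> adj z y)"
proof
  note e = earD[OF assms(2)] and x = innerD[OF assms(2,3)] and y = innerD[OF ear_sym[OF assms(2)] assms(4)]
  have xy: "x \<noteq> y" using inner_not_adj[OF assms(1-3)] y by auto
  have z: "z \<noteq> a" "z \<noteq> b" "z \<noteq> v" "z \<noteq> c" "z \<noteq> x" "z \<noteq> y"
    using assms(5) e x y by (auto simp: rest_def nb_def)
  assume "adj z x \<and> adj z y"
  then show False
    by (intro no_theta[of a "[v]" b "[c]" "[x, z, y]"]) (use e x y xy z adj_sym in simp_all)
qed

lemma side_insert: "ear W v a b c \<Longrightarrow> side W v a b = insert c (inner W v a b c)"
  using earD[of W v a b c] by (auto simp: inner_def side_def nb_def)

lemma c_notin_inner [simp]: "c \<notin> inner W v a b c"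
  by (simp add: inner_def)

lemma finite_inner: "finite W \<Longrightarrow> finite (inner W v a b c)"
  by (simp add: inner_def finite_side)

lemma card_side: "finite W \<Longrightarrow> ear W v a b c \<Longrightarrow> card (side W v a b) = Suc (card (inner W v a b c))"
  by (simp add: side_insert finite_inner)

text \<open>The three vertices \<open>v\<close>, \<open>a\<close>, \<open>b\<close> contribute only
  2, because \<open>c\<close> is counted in both sides.\<close>

lemma ear_card:
  assumes "finite W" "ear W v a b c"
  shows "card (side W v a b) + card (side W v b a) + card (rest W a b) + 2 = card W"
proof -
  let ?A = "side W v a b" and ?B = "inner W v b a c" and ?Z = "rest W a b"
  note e = earD[OF assms(2)]
  have fin: "finite ?A" "finite ?B" "finite ?Z" using assms(1) finite_side finite_inner finite_rest by auto
  have AB: "?A \<inter> ?B = {}" using side_Int[OF assms] by (auto simp: inner_def)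
  have W: "W = {v, a, b} \<union> (?A \<union> ?B) \<union> ?Z"
    using e side_insert[OF assms(2)] by (auto simp: side_def inner_def rest_def nb_def)
  have "card ({v, a, b} \<union> (?A \<union> ?B) \<union> ?Z) = card ({v, a, b} \<union> (?A \<union> ?B)) + card ?Z"
    using fin e by (intro card_Un_disjoint) (auto simp: side_def inner_def rest_def nb_def)
  also have "card ({v, a, b} \<union> (?A \<union> ?B)) = card {v, a, b} + card (?A \<union> ?B)"
    using fin e by (intro card_Un_disjoint) (auto simp: side_def inner_def nb_def adj_irrefl)
  also have "card (?A \<union> ?B) = card ?A + card ?B" using fin AB by (intro card_Un_disjoint)
  also have "card {v, a, b} = 3" using e by simp
  finally show ?thesis
    using W card_side[OF assms(1) ear_sym[OF assms(2)]] by simp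
qed

text \<open>Between the sides only \<open>c\<close> sends edges into the other inner set, by
  \<open>inner_no_edge\<close>; this is the origin of \<open>k\<close> and \<open>l\<close>. The 1
  is the pair \<open>(c, b)\<close>.\<close>

lemma ed_side:
  assumes "finite W" "ear W v a b c"
  shows "ed (side W v a b) (W - {a}) = ed (side W v a b) (side W v a b)
    + card (nb (inner W v b a c) c) + 1 + ed (side W v a b) (rest W a b)"
proof -
  let ?A = "side W v a b" and ?B = "inner W v b a c" and ?Z = "rest W a b"
  note e = earD[OF assms(2)]
  have fin: "finite ?A" "finite ?B" "finite ?Z" using assms(1) finite_side finite_inner finite_rest by auto
  have AB: "?A \<inter> ?B = {}" using side_Int[OF assms] by (auto simp: inner_def)
  have W: "W - {a} = (?A \<union> ?B) \<union> (?Z \<union> {v, b})"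
    using e side_insert[OF assms(2)] by (auto simp: side_def inner_def rest_def nb_def adj_irrefl)
  have "ed ?A ((?A \<union> ?B) \<union> (?Z \<union> {v, b})) = ed ?A (?A \<union> ?B) + ed ?A (?Z \<union> {v, b})"
    using fin e by (intro ed_Un_right) (auto simp: side_def inner_def rest_def nb_def adj_irrefl)
  also have "ed ?A (?A \<union> ?B) = ed ?A ?A + ed ?A ?B" using fin AB by (intro ed_Un_right) auto
  also have "ed ?A (?Z \<union> {v, b}) = ed ?A ?Z + ed ?A {v, b}"
    using fin e by (intro ed_Un_right) (auto simp: rest_def nb_def)
  also have "ed ?A {v, b} = 1"
  proof -
    have "E \<inter> ?A \<times> {v, b} = {(c, b)}"
      using e inner_not_adj[OF assms] innerD[OF assms(2)] by (auto simp: side_insert[OF assms(2)])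
    then show ?thesis by (simp add: ed_def)
  qed
  also have "ed ?A ?B = card (nb ?B c)"
  proof -
    have "ed (inner W v a b c) ?B = 0"
      using inner_no_edge[OF assms] assms(1) finite_inner by (subst ed_eq_0) auto
    then show ?thesis
      using ed_Un_left[of "{c}" "inner W v a b c" ?B] fin finite_inner[OF assms(1)]
      by (simp add: side_insert[OF assms(2)] ed_singleton_left)
  qed
  finally show ?thesis using W by simp
qed

text \<open>Two such neighbours \<open>x\<close>, \<open>y\<close> would give the paths
  \<open>a x c\<close>, \<open>a y c\<close> and \<open>a v b c\<close>.\<close>

lemma nb_inner_le_1:
  assumes "finite W" "ear W v a b c"
  shows "card (nb (inner W v a b c) c) \<le> 1"
proof (rule ccontr)
  assume "\<not> card (nb (inner W v a b c) c) \<le> 1"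
  then obtain x y where xy: "x \<in> nb (inner W v a b c) c" "y \<in> nb (inner W v a b c) c" "x \<noteq> y"
    using card_le_Suc0_iff_eq[OF finite_nb[OF finite_inner[OF assms(1)]]] by (metis One_nat_def)
  then have i: "x \<in> inner W v a b c" "y \<in> inner W v a b c" "adj x c" "adj y c"
    using adj_sym by (auto simp: nb_def)
  show False
    by (rule no_theta[of a "[x]" c "[y]" "[v, b]"])
      (use earD[OF assms(2)] i innerD[OF assms(2) i(1)] innerD[OF assms(2) i(2)] xy(3) in simp_all)
qed

lemma ed_side_side:
  assumes "finite W" "ear W v a b c"
  shows "ed (side W v a b) (side W v a b) + 2 \<le> 2 * card (side W v a b)"
proof (rule ed_neighbours[of _ a])
  show "side W v a b \<noteq> {}" using side_insert[OF assms(2)] by blast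
  show "adj a w" if "w \<in> side W v a b" for w using that by (simp add: side_def nb_def)
qed (rule finite_side[OF assms(1)])

lemma nb_side_insert:
  assumes "finite W" "ear W v a b c"
  shows "card (nb (side W v a b) z) = card (nb (inner W v a b c) z) + (if adj z c then 1 else 0)"
proof -
  have "nb (side W v a b) z = (if adj z c then insert c (nb (inner W v a b c) z) else nb (inner W v a b c) z)"
    using side_insert[OF assms(2)] by (auto simp: nb_def)
  moreover have "c \<notin> nb (inner W v a b c) z" by (auto simp: nb_def)
  ultimately show ?thesis using finite_nb[OF finite_inner[OF assms(1)]] by simp
qed

lemma nb_side_le_2:
  assumes "finite W" "z \<noteq> a"
  shows "card (nb (side W v a b) z) \<le> 2"
  by (rule common_neighbours[of _ a z])
    (use assms finite_side[OF assms(1)] finite_nb in \<open>auto simp: nb_def side_def\<close>)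

text \<open>By \<open>inner_no_link\<close> the vertex \<open>z\<close> has inner neighbours on one
  side only, and \<open>c\<close> is counted twice. The value 3 thus means \<open>c\<close> and one
  inner neighbour on one side, \<open>c\<close> alone on the other.\<close>

lemma rest_bound:
  assumes "finite W" "ear W v a b c" "z \<in> rest W a b"
  shows "card (nb (side W v a b) z) + card (nb (side W v b a) z) \<le> 3"
    and "card (nb (side W v a b) z) + card (nb (side W v b a) z) = 3 \<Longrightarrow>
      adj z c \<and> (nb (inner W v a b c) z \<noteq> {} \<or> nb (inner W v b a c) z \<noteq> {})"
proof -
  have z: "z \<noteq> a" "z \<noteq> b" using assms(3) by (auto simp: rest_def)
  have "nb (inner W v a b c) z = {} \<or> nb (inner W v b a c) z = {}"
    using inner_no_link[OF assms(1,2) _ _ assms(3)] by (auto simp: nb_def)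
  then have *: "card (nb (inner W v a b c) z) = 0 \<or> card (nb (inner W v b a c) z) = 0" by auto
  note n = nb_side_insert[OF assms(1,2), of z] nb_side_insert[OF assms(1) ear_sym[OF assms(2)], of z]
    nb_side_le_2[OF assms(1) z(1), of v b] nb_side_le_2[OF assms(1) z(2), of v a]
  show "card (nb (side W v a b) z) + card (nb (side W v b a) z) \<le> 3"
    using * n by (auto split: if_splits)
  show "adj z c \<and> (nb (inner W v a b c) z \<noteq> {} \<or> nb (inner W v b a c) z \<noteq> {})"
    if "card (nb (side W v a b) z) + card (nb (side W v b a) z) = 3"
    using * n that by (auto split: if_splits)
qed

lemma ed_rest:
  assumes "finite W"
  shows "ed (side W v a b) (rest W a b) + ed (side W v b a) (rest W a b)
    = (\<Sum>z \<in> rest W a b. card (nb (side W v a b) z) + card (nb (side W v b a) z))"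
  using assms by (simp add: ed_commute[of _ "rest W a b"] ed_sum finite_side finite_rest sum.distrib)

lemma ed_rest_le:
  assumes "finite W" "ear W v a b c"
  shows "ed (side W v a b) (rest W a b) + ed (side W v b a) (rest W a b) \<le> 3 * card (rest W a b)"
proof -
  have "(\<Sum>z \<in> rest W a b. card (nb (side W v a b) z) + card (nb (side W v b a) z)) \<le> (\<Sum>z \<in> rest W a b. 3)"
    using rest_bound(1)[OF assms] by (rule sum_mono)
  then show ?thesis unfolding ed_rest[OF assms(1)] by simp
qed

lemma through_ear:
  assumes "finite W" "ear W v a b c" "adj a b"
  shows "through W v = 2 * card (side W v a b) + 2 * card (side W v b a)
    + ed (side W v a b) (side W v a b) + ed (side W v b a) (side W v b a)
    + card (nb (inner W v a b c) c) + card (nb (inner W v b a c) c) + 2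
    + (ed (side W v a b) (rest W a b) + ed (side W v b a) (rest W a b))"
proof -
  have "v \<in> W" "nb W v = {a, b}" "a \<noteq> b" using assms(2) by (auto simp: ear_def)
  note through_degree_two[OF assms(1) this]
  then show ?thesis
    using ed_side[OF assms(1,2)] ed_side[OF assms(1) ear_sym[OF assms(2)]] assms(3) rest_commute[of W a b] by simp
qed

text \<open>With sides \<open>A\<close>, \<open>B\<close> and \<open>s\<close> vertices in the rest,
  the forest bounds give \<open>2 |A| - 2\<close> and \<open>2 |B| - 2\<close>, and the rest gives
  \<open>3 s\<close>. Since \<open>|A| + |B| = n - 2 - s\<close>, the sum is
  \<open>4 n - 10 - s + k + l\<close>.\<close>

lemma through_ear_le:
  assumes "finite W" "ear W v a b c" "adj a b"
  shows "through W v + card (rest W a b) + 10 \<le> 4 * card W + card (nb (inner W v a b c) c) + card (nb (inner W v b a c) c)"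
  using through_ear[OF assms] ear_card[OF assms(1,2)] ed_side_side[OF assms(1,2)]
    ed_side_side[OF assms(1) ear_sym[OF assms(2)]] ed_rest_le[OF assms(1,2)] by (simp add: algebra_simps)

text \<open>Compared with adjacent ends, \<open>card ?A + card ?B\<close> paths are lost. This is at
  least 2 and makes up for \<open>k + l\<close>.\<close>

lemma through_nonadjacent:
  assumes "finite W" "ear W v a b c" "\<not> adj a b"
  shows "through W v + 10 \<le> 4 * card W"
proof -
  let ?A = "side W v a b" and ?B = "side W v b a" and ?Z = "rest W a b"
  have v: "v \<in> W" "nb W v = {a, b}" "a \<noteq> b" using assms(2) by (auto simp: ear_def)
  have t: "through W v = card ?A + card ?B + ed ?A (W - {a}) + ed ?B (W - {b})"
    using through_degree_two[OF assms(1) v] assms(3) by simp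
  have "card ?A \<ge> 1" "card ?B \<ge> 1"
    using card_side[OF assms(1,2)] card_side[OF assms(1) ear_sym[OF assms(2)]] by auto
  then show ?thesis
    using t ed_side[OF assms(1,2)] ed_side[OF assms(1) ear_sym[OF assms(2)]] rest_commute[of W a b]
      ear_card[OF assms(1,2)] ed_side_side[OF assms(1,2)]
      ed_side_side[OF assms(1) ear_sym[OF assms(2)]] ed_rest_le[OF assms(1,2)]
      nb_inner_le_1[OF assms(1,2)] nb_inner_le_1[OF assms(1) ear_sym[OF assms(2)]]
    by (simp add: algebra_simps)
qed

text \<open>The sides are disjoint now. At most two edges join them, a vertex of \<open>Z\<close>
  has at most two neighbours in both together, and the forest bounds save 4 as soon as both sides
  are nonempty.\<close>

lemma through_no_common:
  assumes fin: "finite W" and v: "v \<in> W" "nb W v = {a, b}" "a \<noteq> b"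
    and no: "side W v a b \<inter> side W v b a = {}"
  shows "through W v + 12 \<le> 4 * card W"
proof -
  define A B Z where "A = side W v a b" and "B = side W v b a" and "Z = W - {v, a, b} - A - B"
  note d = A_def B_def Z_def
  have fA: "finite A" "finite B" "finite Z" using fin finite_side by (auto simp: d)
  have AB: "A \<inter> B = {}" using no by (simp add: d)
  have va: "adj v a" "adj v b" "a \<in> W" "b \<in> W" "adj a v" "adj b v"
    using v(2) adj_sym by (auto simp: nb_def)
  have vab: "v \<noteq> a" "v \<noteq> b" using va adj_irrefl by auto
  have vy: "\<not> adj y v" if "y \<in> W" "y \<noteq> a" "y \<noteq> b" for y
    using v(2) that adj_sym by (auto simp: nb_def)
  have xA: "x \<in> W \<and> adj a x \<and> adj x a \<and> x \<noteq> v \<and> x \<noteq> b \<and> x \<noteq> a \<and> \<not> adj x b \<and> \<not> adj x v" if "x \<in> A" for x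
  proof -
    have x: "x \<in> W" "adj a x" "x \<noteq> v" "x \<noteq> b" using that by (auto simp: d side_def nb_def)
    moreover have "x \<noteq> a" using x adj_irrefl by auto
    moreover have "\<not> adj b x" using x \<open>x \<noteq> a\<close> that AB by (auto simp: d side_def nb_def)
    ultimately show ?thesis using adj_commute vy by blast
  qed
  have xB: "x \<in> W \<and> adj b x \<and> adj x b \<and> x \<noteq> v \<and> x \<noteq> a \<and> x \<noteq> b \<and> \<not> adj x a \<and> \<not> adj x v" if "x \<in> B" for x
  proof -
    have x: "x \<in> W" "adj b x" "x \<noteq> v" "x \<noteq> a" using that by (auto simp: d side_def nb_def)
    moreover have "x \<noteq> b" using x adj_irrefl by auto
    moreover have "\<not> adj a x" using x \<open>x \<noteq> b\<close> that AB by (auto simp: d side_def nb_def)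
    ultimately show ?thesis using adj_commute vy by blast
  qed
  have ABn: "x \<noteq> y" if "x \<in> A" "y \<in> B" for x y using that AB by auto
  have nA: "card (nb A z) \<le> 2" if "z \<noteq> a" for z
    using that fA xA by (intro common_neighbours[of _ a z]) (auto simp: nb_def)
  have nB: "card (nb B z) \<le> 2" if "z \<noteq> b" for z
    using that fA xB by (intro common_neighbours[of _ b z]) (auto simp: nb_def)
  have edA: "ed A (W - {a}) = ed A A + ed A B + ed A Z"
  proof -
    have "ed A (W - {a}) = card (E \<inter> A \<times> ((A \<union> B) \<union> Z))"
      unfolding ed_def by (rule arg_cong[of _ _ card]) (use xA xB in \<open>auto simp: Z_def\<close>)
    also have "\<dots> = ed A (A \<union> B) + ed A Z"
      unfolding ed_def[symmetric] using fA by (intro ed_Un_right) (auto simp: Z_def)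
    also have "ed A (A \<union> B) = ed A A + ed A B" using fA AB by (intro ed_Un_right) auto
    finally show ?thesis .
  qed
  have edB: "ed B (W - {b}) = ed B B + ed A B + ed B Z"
  proof -
    have "ed B (W - {b}) = card (E \<inter> B \<times> ((B \<union> A) \<union> Z))"
      unfolding ed_def by (rule arg_cong[of _ _ card]) (use xA xB in \<open>auto simp: Z_def\<close>)
    also have "\<dots> = ed B (B \<union> A) + ed B Z"
      unfolding ed_def[symmetric] using fA by (intro ed_Un_right) (auto simp: Z_def)
    also have "ed B (B \<union> A) = ed B B + ed B A" using fA AB by (intro ed_Un_right) auto
    finally show ?thesis by (simp add: ed_commute[of B A])
  qed
  have W: "card W = card A + card B + card Z + 3"
  proof -
    have "W = {v, a, b} \<union> (A \<union> B) \<union> Z" using v(1) va xA xB by (auto simp: Z_def)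
    moreover have "card ({v, a, b} \<union> (A \<union> B) \<union> Z) = card ({v, a, b} \<union> (A \<union> B)) + card Z"
      using fA by (intro card_Un_disjoint) (auto simp: Z_def)
    moreover have "card ({v, a, b} \<union> (A \<union> B)) = card {v, a, b} + card (A \<union> B)"
      using fA xA xB by (intro card_Un_disjoint) auto
    moreover have "card (A \<union> B) = card A + card B" using fA AB by (intro card_Un_disjoint)
    ultimately show ?thesis using v(3) vab by simp
  qed
  have AA: "A \<noteq> {} \<Longrightarrow> ed A A + 2 \<le> 2 * card A"
    using fA xA by (intro ed_neighbours[of _ a]) auto
  have BB: "B \<noteq> {} \<Longrightarrow> ed B B + 2 \<le> 2 * card B"
    using fA xB by (intro ed_neighbours[of _ b]) auto
  have edAB: "ed A B \<le> 2"
  proof (cases "\<exists>x \<in> A. \<exists>y \<in> B. adj x y")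
    case False
    then have "ed A B = 0" using ed_eq_0[OF fA(1,2)] by auto
    then show ?thesis by simp
  next
    case True
    then obtain x y where xy: "x \<in> A" "y \<in> B" "adj x y" by auto
    \<comment> \<open>Two disjoint edges between \<open>A\<close> and \<open>B\<close> would form,
      with \<open>a v b\<close>, three paths from \<open>a\<close> to \<open>b\<close>. Hence these
      edges form a star, whose centre has at most two neighbours on the opposite side.\<close>
    have meet: "x1 = x2 \<or> y1 = y2" if h: "x1 \<in> A" "y1 \<in> B" "adj x1 y1" "x2 \<in> A" "y2 \<in> B" "adj x2 y2" for x1 x2 y1 y2
    proof (rule ccontr)
      assume "\<not> ?thesis"
      then show False
        by (intro no_theta[of a "[v]" b "[x1, y1]" "[x2, y2]"])
          (use h xA[OF h(1)] xA[OF h(4)] xB[OF h(2)] xB[OF h(5)] ABn[OF h(1,2)] ABn[OF h(1,5)] ABn[OF h(4,2)] ABn[OF h(4,5)] va vab v(3) in auto)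
    qed
    show ?thesis
    proof (cases "\<forall>x' \<in> A. \<forall>y' \<in> B. adj x' y' \<longrightarrow> x' = x")
      case True
      then have "E \<inter> A \<times> B \<subseteq> E \<inter> {x} \<times> B" by auto
      then have "ed A B \<le> ed {x} B" unfolding ed_def using fA by (intro card_mono) auto
      also have "\<dots> \<le> 2" unfolding ed_singleton_left using nB xA[OF xy(1)] by auto
      finally show ?thesis .
    next
      case False
      then obtain x' y' where xy': "x' \<in> A" "y' \<in> B" "adj x' y'" "x' \<noteq> x" by auto
      then have "y' = y" using meet[OF xy xy'(1-3)] by auto
      have "y'' = y" if "x'' \<in> A" "y'' \<in> B" "adj x'' y''" for x'' y''
        using meet[OF xy that] meet[OF xy'(1-3) that] xy'(4) \<open>y' = y\<close> by auto
      then have "E \<inter> A \<times> B \<subseteq> E \<inter> A \<times> {y}" by auto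
      then have "ed A B \<le> ed A {y}" unfolding ed_def using fA by (intro card_mono) auto
      also have "\<dots> \<le> 2" unfolding ed_commute[of A] ed_singleton_left using nA xB[OF xy(2)] by auto
      finally show ?thesis .
    qed
  qed
  have z: "card (nb A z) + card (nb B z) \<le> 2" if zZ: "z \<in> Z" for z
  proof -
    have zn: "z \<noteq> a" "z \<noteq> b" "z \<noteq> v" "z \<notin> A" "z \<notin> B" using zZ by (auto simp: Z_def)
    have two: "\<exists>x \<in> S. \<exists>y \<in> S. x \<noteq> y" if "card S = 2" for S :: "'a set"
      using that by (auto simp: card_2_iff)
    \<comment> \<open>Two neighbours in \<open>A\<close> and one in \<open>B\<close> would give
      three paths from \<open>a\<close> to \<open>z\<close>, the last one through \<open>v\<close>
      and \<open>b\<close>.\<close>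
    have B0: "nb B z = {}" if c2: "card (nb A z) = 2"
    proof (rule ccontr)
      assume "nb B z \<noteq> {}"
      then obtain y where y: "y \<in> B" "adj y z" using adj_sym by (auto simp: nb_def)
      obtain x1 x2 where x: "x1 \<in> A" "x2 \<in> A" "adj x1 z" "adj x2 z" "x1 \<noteq> x2"
        using two[OF c2] adj_sym by (auto simp: nb_def)
      show False
        by (rule no_theta[of a "[x1]" z "[x2]" "[v, b, y]"])
          (use x y zn xA[OF x(1)] xA[OF x(2)] xB[OF y(1)] ABn[OF x(1) y(1)] ABn[OF x(2) y(1)] va vab v(3) in auto)
    qed
    have A0: "nb A z = {}" if c2: "card (nb B z) = 2"
    proof (rule ccontr)
      assume "nb A z \<noteq> {}"
      then obtain y where y: "y \<in> A" "adj y z" using adj_sym by (auto simp: nb_def)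
      obtain x1 x2 where x: "x1 \<in> B" "x2 \<in> B" "adj x1 z" "adj x2 z" "x1 \<noteq> x2"
        using two[OF c2] adj_sym by (auto simp: nb_def)
      show False
        by (rule no_theta[of b "[x1]" z "[x2]" "[v, a, y]"])
          (use x y zn xB[OF x(1)] xB[OF x(2)] xA[OF y(1)] ABn[OF y(1) x(1)] ABn[OF y(1) x(2)] va vab v(3) in auto)
    qed
    have le: "card (nb A z) \<le> 2" "card (nb B z) \<le> 2" using nA nB zn by auto
    consider "card (nb A z) = 2" | "card (nb B z) = 2" | "card (nb A z) \<le> 1" "card (nb B z) \<le> 1"
      using le by linarith
    then show ?thesis
    proof cases
      case 1 then show ?thesis using B0[OF 1] by simp
    next
      case 2 then show ?thesis using A0[OF 2] by simp
    qed simp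
  qed
  have "ed Z A + ed Z B = (\<Sum>z \<in> Z. card (nb A z) + card (nb B z))"
    using fA by (simp add: ed_sum sum.distrib)
  also have "\<dots> \<le> (\<Sum>z \<in> Z. 2)" using z by (rule sum_mono)
  finally have edZ: "ed A Z + ed B Z \<le> 2 * card Z" by (simp add: ed_commute[of Z])
  \<comment> \<open>If a side is empty, no edges join the sides; otherwise the two savings of 2
    cover the at most two joining edges, which are counted twice.\<close>
  have "ed A A + ed B B + 2 * ed A B \<le> 2 * card A + 2 * card B"
    using AA BB edAB by (cases "A = {}"; cases "B = {}") auto
  moreover have "through W v \<le> 2 * (card A + card B) + ed A (W - {a}) + ed B (W - {b})"
    using through_degree_two[OF fin v] by (auto simp: d)
  ultimately show ?thesis using edA edB edZ W by (simp add: algebra_simps)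
qed

lemma through_low_degree:
  assumes fin: "finite W" and v: "v \<in> W" "card (nb W v) \<le> 2" and "card W \<ge> 3"
    and big: "4 * card W < through W v + 10"
  obtains a b c where "ear W v a b c" "adj a b"
    "card (rest W a b) < card (nb (inner W v a b c) c) + card (nb (inner W v b a c) c)"
proof -
  have fn: "finite (nb W v)" using fin finite_nb by auto
  consider "nb W v = {}" | a where "nb W v = {a}" | a b where "nb W v = {a, b}" "a \<noteq> b"
  proof -
    have "card (nb W v) = 0 \<or> card (nb W v) = 1 \<or> card (nb W v) = 2" using v(2) by auto
    then show ?thesis using that fn by (auto simp: card_1_singleton_iff card_2_iff)
  qed
  then show ?thesis
  proof cases
    case 1
    then show ?thesis using through_degree_zero[OF 1] big assms(4) by auto
  next
    case 2
    then show ?thesis using through_degree_one[OF fin v(1) 2] big assms(4) by auto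
  next
    case 3
    show ?thesis
    proof (cases "side W v a b \<inter> side W v b a = {}")
      case True
      then show ?thesis using through_no_common[OF fin v(1) 3] big by auto
    next
      case False
      then obtain c where "c \<in> side W v a b" "c \<in> side W v b a" by auto
      then have e: "ear W v a b c" using 3 v(1) by (auto simp: ear_def side_def nb_def)
      then have "adj a b" using through_nonadjacent[OF fin e] big by auto
      then show ?thesis using that[OF e] through_ear_le[OF fin e] big by auto
    qed
  qed
qed

section \<open>Ears of extremal shape\<close>

text \<open>Each edge is counted in both orders. Consequently a defect in the forest bound is at
  least 2.\<close>

lemma even_ed: "finite W \<Longrightarrow> even (ed W W)"
proof (induction W rule: finite_psubset_induct)
  case (psubset W)
  show ?case
  proof (cases "W = {}")
    case False
    then obtain w where w: "w \<in> W" by auto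
    then have "even (ed (W - {w}) (W - {w}))" using psubset by blast
    then show ?thesis using ed_remove[OF psubset.hyps w] by simp
  qed simp
qed

text \<open>If no edge left \<open>C\<close>, the forest bounds for \<open>C\<close> and
  \<open>A - C\<close> would add up to a total defect of 4 instead of 2.\<close>

lemma tree_connected:
  assumes "finite A" "\<And>w. w \<in> A \<Longrightarrow> adj a w" "ed A A + 2 = 2 * card A" "C \<subseteq> A" "C \<noteq> {}" "C \<noteq> A"
  shows "\<exists>x \<in> C. \<exists>y \<in> A - C. adj x y"
proof (rule ccontr)
  assume no: "\<not> ?thesis"
  have fin: "finite C" "finite (A - C)" using assms finite_subset by auto
  have "ed C (A - C) = 0" using no fin by (simp add: ed_eq_0)
  moreover have A: "C \<union> (A - C) = A" using assms(4) by auto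
  moreover have "ed (C \<union> (A - C)) A = ed C A + ed (A - C) A" using fin assms(1) by (intro ed_Un_left) auto
  moreover have "ed C (C \<union> (A - C)) = ed C C + ed C (A - C)" using fin by (intro ed_Un_right) auto
  moreover have "ed (A - C) (C \<union> (A - C)) = ed (A - C) C + ed (A - C) (A - C)" using fin by (intro ed_Un_right) auto
  ultimately have "ed A A = ed C C + ed (A - C) (A - C)" by (simp add: ed_commute[of "A - C" C])
  moreover have "ed C C + 2 \<le> 2 * card C" using assms fin by (intro ed_neighbours[of _ a]) auto
  moreover have "ed (A - C) (A - C) + 2 \<le> 2 * card (A - C)" using assms fin by (intro ed_neighbours[of _ a]) auto
  moreover have "card A = card C + card (A - C)"
    using card_Un_disjoint[OF fin] A by (metis Diff_disjoint)
  ultimately show False using assms(3) by linarith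
qed

lemma W_cases:
  assumes "ear W v a b c" "y \<in> W"
  shows "y \<in> {v, a, b} \<or> y \<in> side W v a b \<or> y \<in> inner W v b a c \<or> y \<in> rest W a b"
  using assms side_insert[OF assms(1)] by (auto simp: side_def inner_def rest_def nb_def)

lemma nb_inner:
  assumes fin: "finite W" and e: "ear W v a b c" and x: "x \<in> inner W v a b c"
  shows "nb W x = insert a (nb (side W v a b) x \<union> nb (rest W a b) x)"
proof
  note d = earD[OF e] and i = innerD[OF e x]
  show "nb W x \<subseteq> insert a (nb (side W v a b) x \<union> nb (rest W a b) x)"
  proof
    fix y assume "y \<in> nb W x"
    then have y: "y \<in> W" "adj x y" by (auto simp: nb_def)
    have "y \<noteq> v" using y i d(20)[of x] by auto
    moreover have "y \<noteq> b" using y inner_not_adj[OF fin e x] by auto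
    moreover have "y \<notin> inner W v b a c" using inner_no_edge[OF fin e x] y by auto
    ultimately show "y \<in> insert a (nb (side W v a b) x \<union> nb (rest W a b) x)"
      using W_cases[OF e y(1)] y by (auto simp: nb_def)
  qed
  show "insert a (nb (side W v a b) x \<union> nb (rest W a b) x) \<subseteq> nb W x"
    using d i by (auto simp: nb_def side_def rest_def)
qed

lemma side_adj: "w \<in> side W v a b \<Longrightarrow> adj a w"
  by (simp add: side_def nb_def)

lemma side_connected:
  assumes "finite W" "ed (side W v a b) (side W v a b) + 2 = 2 * card (side W v a b)"
    "C \<subseteq> side W v a b" "C \<noteq> {}" "C \<noteq> side W v a b"
  shows "\<exists>x \<in> C. \<exists>y \<in> side W v a b - C. adj x y"
  by (rule tree_connected[OF finite_side[OF assms(1)] _ assms(2-)]) (rule side_adj)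

lemma inner_subset_side: "inner W v a b c \<subseteq> side W v a b"
  by (auto simp: inner_def)

lemma nb_side_c:
  assumes "ear W v a b c" shows "nb (side W v a b) c = nb (inner W v a b c) c"
  using side_insert[OF assms] adj_irrefl by (auto simp: nb_def)

text \<open>If the leaf hung on \<open>c\<close>, whose only neighbour in the tree would then be
  \<open>w\<close>, the pair \<open>{w, c}\<close> would be a component of a tree with at least
  three vertices.\<close>

lemma leaf_neighbour:
  assumes fin: "finite W" and e: "ear W v a b c"
    and tree: "ed (side W v a b) (side W v a b) + 2 = 2 * card (side W v a b)"
    and k: "card (nb (inner W v a b c) c) = 1" and two: "card (inner W v a b c) \<ge> 2"
    and w: "w \<in> inner W v a b c" and leaf: "card (nb (side W v a b) w) \<le> 1"
  obtains x where "nb (side W v a b) w = {x}" "x \<in> inner W v a b c"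
proof -
  let ?A = "side W v a b"
  have cA: "card ?A \<ge> 3" using card_side[OF fin e] two by simp
  have wA: "w \<in> ?A" "c \<in> ?A" "w \<noteq> c" using w inner_subset_side[of W v a b c] side_insert[OF e] innerD[OF e w] by blast+
  have "{w} \<noteq> ?A"
  proof
    assume "{w} = ?A"
    then have "card ?A = card {w}" by simp
    then show False using cA by simp
  qed
  then obtain x where x: "x \<in> ?A" "adj w x"
    using side_connected[OF fin tree, of "{w}"] wA by auto
  then have nw: "nb ?A w = {x}"
    using leaf card_le_Suc0_iff_eq[OF finite_nb[OF finite_side[OF fin]]] unfolding One_nat_def by (auto simp: nb_def)
  have "x \<noteq> c"
  proof
    assume xc: "x = c"
    have "w \<in> nb (inner W v a b c) c" using w x xc adj_sym by (auto simp: nb_def)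
    then have "nb (inner W v a b c) c = {w}" using k by (metis card_1_singletonE singletonD)
    then have nc: "nb ?A c = {w}" using nb_side_c[OF e] by simp
    have "{w, c} \<noteq> ?A"
    proof
      assume "{w, c} = ?A"
      then have "card ?A = card {w, c}" by simp
      then show False using cA by (simp add: card_insert_if split: if_splits)
    qed
    then obtain y z where "y \<in> {w, c}" "z \<in> ?A - {w, c}" "adj y z"
      using side_connected[OF fin tree, of "{w, c}"] wA by auto
    then have "z \<in> nb ?A w \<or> z \<in> nb ?A c" by (auto simp: nb_def)
    then show False using nw nc xc \<open>z \<in> ?A - {w, c}\<close> by auto
  qed
  then have "x \<in> inner W v a b c" using x by (simp add: inner_def)
  with nw show ?thesis using that by blast
qed

text \<open>The leaf \<open>w\<close> has exactly the neighbours \<open>a\<close> and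
  \<open>x\<close>, so a high cost makes it an ear over the edge \<open>ax\<close>. The inner
  vertices on the side of \<open>b\<close> belong to the rest of this new ear, which strengthens the
  demand on its two inner neighbourhoods.\<close>

lemma leaf_ear:
  assumes fin: "finite W" and e: "ear W v a b c" and w: "w \<in> inner W v a b c"
    and nw: "nb (side W v a b) w = {x}" and x: "x \<in> inner W v a b c" and Zw: "nb (rest W a b) w = {}"
    and ne: "inner W v b a c \<noteq> {}" and n: "card W \<ge> 3" and big: "4 * card W < through W w + 10"
  obtains c' where "ear W w a x c'" "c' \<in> side W v a b" "nb (side W v a b) x = {w, c'}"
    "card (rest W a x) < card (nb (inner W w a x c') c') + card (nb (inner W w x a c') c')"
    "card (rest W a x) \<ge> 1"
proof -
  let ?A = "side W v a b"
  note d = earD[OF e] and i = innerD[OF e w] and ix = innerD[OF e x]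
  have nW: "nb W w = {a, x}" using nb_inner[OF fin e w] nw Zw by auto
  have "card (nb W w) \<le> 2" using nW by (simp add: card_insert_if)
  then obtain a1 b1 c1 where e1: "ear W w a1 b1 c1"
    "card (rest W a1 b1) < card (nb (inner W w a1 b1 c1) c1) + card (nb (inner W w b1 a1 c1) c1)"
    using through_low_degree[OF fin i(1) _ n big] by metis
  have "{a1, b1} = {a, x}" using e1(1) nW by (simp add: ear_def)
  then have e2: "ear W w a x c1"
    "card (rest W a x) < card (nb (inner W w a x c1) c1) + card (nb (inner W w x a c1) c1)"
    using e1 ear_sym[OF e1(1)] rest_commute[of W a x] by (auto simp: doubleton_eq_iff)
  note d1 = earD[OF e2(1)]
  have "c1 \<noteq> v" using d1(18) d(20)[of x] ix d1(17) by auto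
  moreover have "c1 \<noteq> b" using inner_not_adj[OF fin e x] d1 by auto
  ultimately have cA: "c1 \<in> ?A" using d1 by (auto simp: side_def nb_def)
  have wA: "w \<in> ?A" using w inner_subset_side[of W v a b c] by blast
  have "{w, c1} \<subseteq> nb ?A x" using cA wA d1 by (auto simp: nb_def)
  moreover have "card (nb ?A x) \<le> 2" using nb_side_le_2[OF fin] ix by auto
  moreover have "card {w, c1} = 2" using d1 by auto
  ultimately have nx: "nb ?A x = {w, c1}"
    using finite_nb[OF finite_side[OF fin]] by (metis card_seteq)
  obtain y where y: "y \<in> inner W v b a c" using ne by auto
  note iy = innerD[OF ear_sym[OF e] y]
  have "y \<in> rest W a x"
    using iy inner_not_adj[OF fin ear_sym[OF e] y] inner_no_edge[OF fin e x y] by (auto simp: rest_def nb_def)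
  then have "card (rest W a x) \<ge> 1"
    using finite_rest[OF fin] by (metis One_nat_def Suc_leI card_gt_0_iff empty_iff)
  then show ?thesis using that e2 cA nx by blast
qed

text \<open>The tree on the side of \<open>a\<close> has a leaf other than \<open>c\<close>, and
  deleting this leaf is cheap.\<close>

lemma good_leaf:
  assumes fin: "finite W" and e: "ear W v a b c" and n: "card W \<ge> 3"
    and tree: "ed (side W v a b) (side W v a b) + 2 = 2 * card (side W v a b)"
    and k: "card (nb (inner W v a b c) c) = 1" and two: "card (inner W v a b c) \<ge> 2"
    and noZ: "\<And>x. x \<in> inner W v a b c \<Longrightarrow> nb (rest W a b) x = {}"
    and ne: "inner W v b a c \<noteq> {}"
  shows "\<exists>w \<in> W. through W w + 10 \<le> 4 * card W"
proof -
  let ?A = "side W v a b" and ?A' = "inner W v a b c"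
  have fA: "finite ?A" "finite ?A'" using finite_side finite_inner fin by auto
  have "ed ({c} \<union> ?A') ?A = ed {c} ?A + ed ?A' ?A" using fA by (intro ed_Un_left) auto
  moreover have "ed {c} ?A = 1" using k nb_side_c[OF e] by (simp add: ed_singleton_left)
  ultimately have "ed ?A' ?A + 1 = ed ?A ?A" using side_insert[OF e] by simp
  \<comment> \<open>The degree sum of the tree is \<open>2 * card ?A - 2\<close>. Without
    \<open>c\<close>, of degree one, \<open>2 * card ?A' - 1\<close> remains, too little for degree
    two everywhere.\<close>
  then have sum: "(\<Sum>x \<in> ?A'. card (nb ?A x)) < 2 * card ?A'"
    using tree card_side[OF fin e] ed_sum[OF fA(2,1)] by simp
  have "\<exists>w \<in> ?A'. card (nb ?A w) \<le> 1"
  proof (rule ccontr)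
    assume "\<not> ?thesis"
    then have "(\<Sum>x \<in> ?A'. 2) \<le> (\<Sum>x \<in> ?A'. card (nb ?A x))" by (intro sum_mono) force
    then show False using sum by simp
  qed
  then obtain w where w: "w \<in> ?A'" "card (nb ?A w) \<le> 1" by auto
  obtain x where x: "nb ?A w = {x}" "x \<in> ?A'" using leaf_neighbour[OF fin e tree k two w] by metis
  have "through W w + 10 \<le> 4 * card W"
  proof (rule ccontr)
    assume "\<not> ?thesis"
    then have big: "4 * card W < through W w + 10" by simp
    obtain c' where c': "ear W w a x c'" "c' \<in> ?A" "nb ?A x = {w, c'}"
      "card (rest W a x) < card (nb (inner W w a x c') c') + card (nb (inner W w x a c') c')"
      "card (rest W a x) \<ge> 1"
      using leaf_ear[OF fin e w(1) x noZ[OF w(1)] ne n big] by metis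
    \<comment> \<open>One of the two inner neighbourhoods of the new ear is therefore empty and the
      other has at most one element, while its rest has at least one.\<close>
    have "nb W x = {a, w, c'}" using nb_inner[OF fin e x(2)] noZ[OF x(2)] c'(3) by auto
    then have "inner W w x a c' = {}" by (auto simp: inner_def side_def)
    then have "nb (inner W w x a c') c' = {}" by (simp add: nb_def)
    then show False using c'(4,5) nb_inner_le_1[OF fin c'(1)] by simp
  qed
  then show ?thesis using innerD[OF e w(1)] by blast
qed

section \<open>Bounds for up to six vertices\<close>

lemma card_paths4_3:
  assumes "finite W" "card W \<le> 3"
  shows "card (paths4 W) = 0"
proof -
  have "paths4 W = {}"
  proof (rule ccontr)
    assume "paths4 W \<noteq> {}"
    then obtain w x y z where p: "{w, x, y, z} \<subseteq> W" "distinct [w, x, y, z]" by (auto simp: paths4_def)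
    then have "card {w, x, y, z} \<le> card W" using assms card_mono by metis
    then show False using p assms by auto
  qed
  then show ?thesis by simp
qed

text \<open>The first bound uses \<open>k + l \<le> 2\<close> in
  \<open>4 n - 10 - s + k + l\<close>. The second uses that \<open>k + l\<close> is at most the
  number of inner vertices, \<open>n - 4 - s\<close>, and is better for four and five
  vertices.\<close>

lemma through_low_degree_le:
  assumes fin: "finite W" and v: "v \<in> W" "card (nb W v) \<le> 2" and "card W \<ge> 4"
  shows "through W v + 8 \<le> 4 * card W" "through W v + 14 \<le> 5 * card W"
proof -
  have "through W v + 8 \<le> 4 * card W \<and> through W v + 14 \<le> 5 * card W"
  proof (cases "4 * card W < through W v + 10")
    case True
    have "3 \<le> card W" using assms(4) by simp
    then obtain a b c where e: "ear W v a b c" "adj a b"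
      using through_low_degree[OF fin v _ True] by metis
    note le = through_ear_le[OF fin e] nb_inner_le_1[OF fin e(1)] nb_inner_le_1[OF fin ear_sym[OF e(1)]]
    have "card (nb (inner W v a b c) c) \<le> card (inner W v a b c)" for a b
      using finite_inner[OF fin] by (intro card_mono) (auto simp: nb_def)
    note m = this[of a b] this[of b a]
    show ?thesis
      using le m ear_card[OF fin e(1)] card_side[OF fin e(1)] card_side[OF fin ear_sym[OF e(1)]] by linarith
  next
    case False
    then show ?thesis using assms(4) by auto
  qed
  then show "through W v + 8 \<le> 4 * card W" "through W v + 14 \<le> 5 * card W" by auto
qed

lemma remove_bound:
  assumes "finite W" "v \<in> W" "through W v \<le> t" "card (paths4 (W - {v})) \<le> p"
  shows "card (paths4 W) \<le> p + 2 * t"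
  using card_paths4_remove[OF assms(1,2)] assms(3,4) by simp

lemma low_degree_vertex:
  assumes "finite W" "card W \<ge> 2"
  obtains v where "v \<in> W" "card (nb W v) \<le> 2"
  using two_low_degree[OF assms] by metis

text \<open>Here and below, bounds refer to oriented paths: 12, 34, 66, 104 and 148 stand for 6, 17,
  33, 52 and 74 copies.\<close>

lemma card_paths4_4:
  assumes "finite W" "card W = 4" shows "card (paths4 W) \<le> 12"
proof -
  obtain v where v: "v \<in> W" "card (nb W v) \<le> 2" using low_degree_vertex[of W] assms by auto
  have "through W v \<le> 6" using through_low_degree_le(2)[OF assms(1) v] assms(2) by simp
  moreover have "card (paths4 (W - {v})) \<le> 0" using card_paths4_3[of "W - {v}"] assms v by simp
  ultimately show ?thesis using remove_bound[OF assms(1) v(1)] by fastforce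
qed

lemma card_paths4_5:
  assumes "finite W" "card W = 5" shows "card (paths4 W) \<le> 34"
proof -
  obtain v where v: "v \<in> W" "card (nb W v) \<le> 2" using low_degree_vertex[of W] assms by auto
  have "through W v \<le> 11" using through_low_degree_le(2)[OF assms(1) v] assms(2) by simp
  moreover have "card (paths4 (W - {v})) \<le> 12" using card_paths4_4[of "W - {v}"] assms v by simp
  ultimately show ?thesis using remove_bound[OF assms(1) v(1)] by fastforce
qed

text \<open>A triangle with an ear on each side attains this value.\<close>

lemma card_paths4_6:
  assumes "finite W" "card W = 6" shows "card (paths4 W) \<le> 66"
proof -
  obtain v where v: "v \<in> W" "card (nb W v) \<le> 2" using low_degree_vertex[of W] assms by auto
  have "through W v \<le> 16" using through_low_degree_le(1)[OF assms(1) v] assms(2) by simp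
  moreover have "card (paths4 (W - {v})) \<le> 34" using card_paths4_5[of "W - {v}"] assms v by simp
  ultimately show ?thesis using remove_bound[OF assms(1) v(1)] by fastforce
qed

text \<open>The equation is the equality case of \<open>ed_neighbours\<close>: the remaining vertices span a tree,
  hence a path.\<close>

definition fan_center :: "'a set \<Rightarrow> 'a \<Rightarrow> bool" where
  "fan_center W a \<longleftrightarrow> a \<in> W \<and> (\<forall>w \<in> W - {a}. adj a w)
    \<and> ed (W - {a}) (W - {a}) + 2 = 2 * card (W - {a})"

lemma card_nb_1:
  assumes "card (nb X y) = 1" "x \<in> nb X y" shows "nb X y = {x}"
  using assms by (metis card_1_singletonE singletonD)

text \<open>The configuration with one vertex \<open>z\<close> adjacent to neither end of the ear. For \<open>n = 8\<close> it
  includes the four-cycle with one chord and an ear on each of its sides, which has as many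
  paths as the fan; there the count is obtained by deleting three ears in turn.\<close>

lemma ear_with_one_rest:
  assumes fin: "finite W" and n: "card W \<ge> 8" and e: "ear W v a b c" and ab: "adj a b"
    and treeA: "ed (side W v a b) (side W v a b) + 2 = 2 * card (side W v a b)"
    and treeB: "ed (side W v b a) (side W v b a) + 2 = 2 * card (side W v b a)"
    and k: "card (nb (inner W v a b c) c) = 1" and l: "card (nb (inner W v b a c) c) = 1"
    and rest: "rest W a b = {z}" and zc: "adj z c" and x0: "x0 \<in> inner W v a b c" "adj z x0"
    and through: "through W v + 9 \<le> 4 * card W"
  shows "(\<exists>w \<in> W. through W w + 10 \<le> 4 * card W) \<or> (card W = 8 \<and> card (paths4 W) \<le> 148)"
proof (rule disjCI)
  let ?A = "side W v a b" and ?A' = "inner W v a b c" and ?B = "side W v b a" and ?B' = "inner W v b a c"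
  assume none: "\<not> (card W = 8 \<and> card (paths4 W) \<le> 148)"
  have n3: "card W \<ge> 3" using n by simp
  note d = earD[OF e] and es = ear_sym[OF e]
  have fA: "finite ?A" "finite ?A'" "finite ?B'" using finite_side finite_inner fin by auto
  have restB: "rest W b a = {z}" using rest rest_commute[of W a b] by simp
  have zW: "z \<in> W" "z \<noteq> a" "z \<noteq> b" "\<not> adj a z" "\<not> adj b z" using rest by (auto simp: rest_def nb_def)
  \<comment> \<open>As \<open>z\<close> sees the inner vertex \<open>x0\<close> on the side of
    \<open>a\<close>, \<open>inner_no_link\<close> keeps it away from all inner vertices on the side
    of \<open>b\<close>.\<close>
  have zy: "nb (rest W b a) y = {}" if "y \<in> ?B'" for y
    using inner_no_link[OF fin e x0(1) that, of z] x0(2) rest restB adj_sym by (auto simp: nb_def)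
  show "\<exists>w \<in> W. through W w + 10 \<le> 4 * card W"
  proof (cases "card ?B' \<ge> 2")
    case True
    show ?thesis
      by (rule good_leaf[OF fin es n3 treeB l True zy]) (use x0 in auto)
  next
    case False
    obtain y0 where y0: "nb ?B' c = {y0}" using l by (metis card_1_singletonE)
    then have y0B: "y0 \<in> ?B'" "adj c y0" by (auto simp: nb_def)
    then have "card ?B' > 0" using fA card_gt_0_iff by blast
    then have B1: "card ?B' = 1" using False by linarith
    then have B': "?B' = {y0}" using y0B by (metis card_1_singletonE singletonD)
    have cW: "card ?A' + 6 = card W"
      using ear_card[OF fin e] card_side[OF fin e] card_side[OF fin es] B1 rest by simp
    then have two: "card ?A' \<ge> 2" using n by simp
    have cA: "card ?A \<ge> 3" using two card_side[OF fin e] by simp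
    have x0A: "x0 \<in> ?A" "c \<in> ?A" "x0 \<noteq> c" using x0 inner_subset_side[of W v a b c] side_insert[OF e] innerD[OF e x0(1)] by blast+
    have "{c, x0} \<subseteq> nb ?A z" using x0A zc x0 by (auto simp: nb_def)
    moreover have "card (nb ?A z) \<le> 2" using nb_side_le_2[OF fin zW(2)] .
    moreover have "card {c, x0} = 2" using x0A by auto
    ultimately have nz: "nb ?A z = {c, x0}" using finite_nb[OF fA(1)] by (metis card_seteq)
    have zA: "z \<notin> ?A" using zW by (auto simp: side_def nb_def)
    have aA: "a \<notin> ?A" using adj_irrefl by (auto simp: side_def nb_def)
    \<comment> \<open>A low degree vertex of \<open>H\<close> other than \<open>z\<close> cannot be
      \<open>a\<close>, \<open>c\<close> or \<open>x0\<close>, since each of these has three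
      neighbours in \<open>H\<close>. It is therefore a leaf of the tree that does not see
      \<open>z\<close>.\<close>
    define H where "H = insert a (insert z ?A)"
    have H: "finite H" "card H \<ge> 2" using fA zA aA zW cA by (auto simp: H_def)
    obtain w where w: "w \<in> H" "w \<noteq> z" "card (nb H w) \<le> 2"
      using two_low_degree[OF H] by metis
    have three: "\<not> card (nb H u) \<le> 2" if "{p, q, r} \<subseteq> nb H u" "card {p, q, r} = 3" for p q r u
      using card_mono[OF finite_nb[OF H(1)] that(1)] that(2) by simp
    have "w \<noteq> a"
    proof
      assume wa: "w = a"
      have "?A \<subseteq> nb H a" using side_adj by (auto simp: H_def nb_def)
      then have "card ?A \<le> card (nb H a)" using finite_nb[OF H(1)] card_mono by blast
      then show False using cA w(3) wa by simp
    qed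
    obtain u where u: "nb ?A' c = {u}" using k by (metis card_1_singletonE)
    then have uA: "u \<in> ?A'" "adj c u" by (auto simp: nb_def)
    have "w \<noteq> c"
    proof
      assume wc: "w = c"
      have "{a, z, u} \<subseteq> nb H c"
        using d adj_sym[OF zc] uA inner_subset_side[of W v a b c] by (auto simp: H_def nb_def)
      moreover have "u \<in> ?A" using uA inner_subset_side[of W v a b c] by blast
      then have "u \<noteq> a" "u \<noteq> z" using zA aA by metis+
      then have "card {a, z, u} = 3" using zW(2) by simp
      ultimately show False using three w(3) wc by blast
    qed
    then have wA: "w \<in> ?A'" "w \<in> ?A" using w \<open>w \<noteq> a\<close> by (auto simp: H_def inner_def)
    obtain y where y: "y \<in> ?A" "adj w y"
    proof -
      have "{w} \<noteq> ?A"
      proof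
        assume "{w} = ?A"
        then have "card ?A = card {w}" by simp
        then show False using cA by simp
      qed
      then show ?thesis using side_connected[OF fin treeA, of "{w}"] wA that by auto
    qed
    have wx0: "w \<noteq> x0"
    proof
      assume wx: "w = x0"
      have "{a, z, y} \<subseteq> nb H x0"
        using innerD[OF e x0(1)] adj_sym[OF x0(2)] y wx by (auto simp: H_def nb_def)
      moreover have "y \<noteq> a" "y \<noteq> z" using zA aA y(1) by metis+
      then have "card {a, z, y} = 3" using zW(2) by simp
      ultimately show False using three w(3) wx by blast
    qed
    then have zw: "\<not> adj w z" using nz wA innerD(7)[OF e wA(1)] adj_sym by (auto simp: nb_def)
    then have Zw: "nb (rest W a b) w = {}" using rest by (auto simp: nb_def)
    have "nb H w = insert a (nb ?A w)" using zw innerD[OF e wA(1)] by (auto simp: H_def nb_def)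
    moreover have "a \<notin> nb ?A w" using aA by (auto simp: nb_def)
    ultimately have "card (nb ?A w) \<le> 1" using w(3) finite_nb[OF fA(1)] by simp
    then obtain x where x: "nb ?A w = {x}" "x \<in> ?A'"
      using leaf_neighbour[OF fin e treeA k two wA(1)] by metis
    have "through W w + 10 \<le> 4 * card W"
    proof (rule ccontr)
      assume "\<not> ?thesis"
      then have big: "4 * card W < through W w + 10" by simp
      have "?B' \<noteq> {}" using y0B by auto
      then obtain c' where c': "ear W w a x c'" "c' \<in> ?A" "nb ?A x = {w, c'}"
        "card (rest W a x) < card (nb (inner W w a x c') c') + card (nb (inner W w x a c') c')"
        "card (rest W a x) \<ge> 1"
        using leaf_ear[OF fin e wA(1) x Zw _ n3 big] by metis
      note d' = earD[OF c'(1)]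
      \<comment> \<open>The rest of the new ear is nonempty, so both of its inner neighbourhoods are
        needed. This yields a neighbour \<open>t\<close> of \<open>x\<close> besides
        \<open>w\<close>, \<open>a\<close>, \<open>c'\<close>, which can only be \<open>z\<close>.
        Then \<open>x = x0\<close> and \<open>c' = c\<close>, and the tree has just three
        vertices.\<close>
      have "nb (inner W w x a c') c' \<noteq> {}"
        using c'(4,5) nb_inner_le_1[OF fin c'(1)] by (metis add.right_neutral card.empty leD le_trans less_le_trans)
      then obtain t where t: "t \<in> nb W x" "t \<notin> {w, a, c'}" "adj c' t"
        by (auto simp: nb_def inner_def side_def)
      then have tz: "t = z" "adj x z" using nb_inner[OF fin e x(2)] c'(3) rest by (auto simp: nb_def)
      then have xx: "x = x0" using nz innerD[OF e x(2)] x(2) inner_subset_side[of W v a b c] adj_sym by (auto simp: nb_def)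
      have "c' \<in> nb ?A z" using tz t c'(2) adj_sym by (auto simp: nb_def)
      then have cc: "c' = c" using nz xx d' by auto
      have nx: "nb ?A x0 = {w, c}" using c'(3) xx cc by simp
      have "x0 \<in> nb ?A' c" using d' xx cc x0 adj_sym by (auto simp: nb_def)
      then have nc: "nb ?A c = {x0}" using card_nb_1[OF k] nb_side_c[OF e] by simp
      have A: "?A = {w, x0, c}"
      proof (rule ccontr)
        assume "?A \<noteq> {w, x0, c}"
        then obtain p q where pq: "p \<in> {w, x0, c}" "q \<in> ?A - {w, x0, c}" "adj p q"
          using side_connected[OF fin treeA, of "{w, x0, c}"] wA x0A by auto
        then have "q \<in> nb ?A w \<union> nb ?A x0 \<union> nb ?A c" by (auto simp: nb_def)
        then show False using nx nc x xx pq by auto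
      qed
      then have "card ?A = 3" using wx0 x0A innerD[OF e wA(1)] by simp
      then have n8: "card W = 8" using cW card_side[OF fin e] by simp
      \<comment> \<open>Deleting \<open>v\<close>, \<open>w\<close> and \<open>y0\<close> in turn
        costs at most 23, 19 and 15, that is \<open>4 n - 9\<close> for \<open>n = 8, 7, 6\<close>.
        With 34 oriented paths on the last five vertices, 34 + 2 * 15 + 2 * 19 + 2 * 23 =
        148.\<close>
      define W1 where "W1 = W - {v}"
      define W2 where "W2 = W1 - {w}"
      have iw: "w \<in> W" "w \<noteq> v" using innerD[OF e wA(1)] by auto
      note iy = innerD[OF es y0B(1)]
      have fW: "finite W1" "finite W2" using fin by (auto simp: W1_def W2_def)
      have wW1: "w \<in> W1" using iw by (simp add: W1_def)
      have card1: "card W1 = 7" "card W2 = 6" using n8 d(1) wW1 fin fW by (simp_all add: W1_def W2_def)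
      have nw: "nb W w = {a, x0}" using c'(1) xx by (simp add: ear_def)
      have "nb W1 w = {a, x0}"
        using nw d(6) innerD[OF e x0(1)] by (auto simp: W1_def nb_def)
      then have e1: "ear W1 w a x0 c"
        using wW1 d innerD[OF e x0(1)] d' xx cc iw by (auto simp: ear_def W1_def)
      have yn: "y0 \<noteq> w" "\<not> adj x0 y0" using inner_no_edge[OF fin e _ y0B(1)] wA x0 by auto
      have "y0 \<in> rest W1 a x0"
        using iy yn inner_not_adj[OF fin es y0B(1)] inner_no_edge[OF fin e x0(1) y0B(1)]
        by (auto simp: rest_def nb_def W1_def)
      then have "card (rest W1 a x0) \<ge> 1"
        using finite_rest[OF fW(1)] by (metis One_nat_def Suc_leI card_gt_0_iff empty_iff)
      then have t1: "through W1 w \<le> 19"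
        using through_ear_le[OF fW(1) e1 innerD(2)[OF e x0(1)]] nb_inner_le_1[OF fW(1) e1]
          nb_inner_le_1[OF fW(1) ear_sym[OF e1]] card1 by linarith
      have B: "?B = {c, y0}" using side_insert[OF es] B' by simp
      have "nb W y0 = {b, c}"
      proof -
        have "nb ?B y0 = {c}" using B y0B adj_irrefl adj_sym by (auto simp: nb_def)
        then show ?thesis using nb_inner[OF fin es y0B(1)] zy[OF y0B(1)] by auto
      qed
      then have "nb W2 y0 = {b, c}"
        using d innerD[OF e wA(1)] by (auto simp: W2_def W1_def nb_def)
      then have e2: "ear W2 y0 b c a"
        using iy yn d innerD[OF e wA(1)] adj_sym[OF ab] by (auto simp: ear_def W2_def W1_def)
      have "nb W b \<subseteq> {v, a, c, y0}" using B by (auto simp: side_def)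
      then have "inner W2 y0 b c a = {}" by (auto simp: inner_def side_def W2_def W1_def nb_def)
      then have "card (nb (inner W2 y0 b c a) a) = 0" by (simp add: nb_def)
      then have t2: "through W2 y0 \<le> 15"
        using through_ear_le[OF fW(2) e2 d(17)] nb_inner_le_1[OF fW(2) ear_sym[OF e2]] card1 by linarith
      have y2: "y0 \<in> W2" using e2 by (simp add: ear_def)
      have "card (paths4 (W2 - {y0})) \<le> 34" using fW card1 y2 by (intro card_paths4_5) auto
      then have "card (paths4 W2) \<le> 34 + 2 * 15" using remove_bound[OF fW(2) y2 t2] by blast
      then have "card (paths4 W1) \<le> 34 + 2 * 15 + 2 * 19"
        using remove_bound[OF fW(1) wW1 t1] unfolding W2_def by blast
      moreover have "through W v \<le> 23" using through n8 by simp
      ultimately have "card (paths4 W) \<le> 34 + 2 * 15 + 2 * 19 + 2 * 23"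
        using remove_bound[OF fin d(1)] unfolding W1_def by blast
      then show False using none n8 by simp
    qed
    then show ?thesis using innerD[OF e wA(1)] by blast
  qed
qed

text \<open>Here \<open>s = 0\<close> and \<open>k = l = 1\<close>, with a cost of at most
  \<open>4 n - 8\<close>. By parity a defect in a forest bound saves 2, so both sides are trees.
  Seven vertices force two inner vertices on one side, and \<open>good_leaf\<close> applies there.
  On six vertices the triangle with an ear on each side has no cheap vertex.\<close>

lemma ear_full:
  assumes fin: "finite W" and n: "card W \<ge> 7" and e: "ear W v a b c" and ab: "adj a b"
    and rest: "rest W a b = {}" and kl: "card (nb (inner W v a b c) c) = 1" "card (nb (inner W v b a c) c) = 1"
  shows "\<exists>w \<in> W. through W w + 10 \<le> 4 * card W"
proof (cases "through W v + 10 \<le> 4 * card W")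
  case True
  then show ?thesis using earD[OF e] by blast
next
  case False
  note es = ear_sym[OF e]
  have n3: "card W \<ge> 3" using n by simp
  have fA: "finite (side W v a b)" "finite (side W v b a)" using finite_side[OF fin] by auto
  obtain p q where pq: "ed (side W v a b) (side W v a b) = 2 * p" "ed (side W v b a) (side W v b a) = 2 * q"
    using even_ed[OF fA(1)] even_ed[OF fA(2)] by (auto elim!: evenE)
  have c: "card (side W v a b) + card (side W v b a) + 2 = card W" using ear_card[OF fin e] rest by simp
  have t: "through W v = 2 * card (side W v a b) + 2 * card (side W v b a) + 2 * p + 2 * q + 4"
    using through_ear[OF fin e ab] kl rest pq by simp
  have le: "2 * p + 2 \<le> 2 * card (side W v a b)" "2 * q + 2 \<le> 2 * card (side W v b a)"
    using ed_side_side[OF fin e] ed_side_side[OF fin es] pq by auto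
  have tree: "ed (side W v a b) (side W v a b) + 2 = 2 * card (side W v a b)"
    "ed (side W v b a) (side W v b a) + 2 = 2 * card (side W v b a)"
  proof -
    have "p + 1 \<le> card (side W v a b)" "q + 1 \<le> card (side W v b a)" using le by auto
    moreover have "\<not> p + q + 3 \<le> card (side W v a b) + card (side W v b a)"
      using t c False by linarith
    ultimately have "p + 1 = card (side W v a b)" "q + 1 = card (side W v b a)" by linarith+
    then show "ed (side W v a b) (side W v a b) + 2 = 2 * card (side W v a b)"
      "ed (side W v b a) (side W v b a) + 2 = 2 * card (side W v b a)" unfolding pq by linarith+
  qed
  have ne: "inner W v a b c \<noteq> {}" "inner W v b a c \<noteq> {}" using kl by (auto simp: nb_def)
  have "card (inner W v a b c) \<ge> 2 \<or> card (inner W v b a c) \<ge> 2"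
    using c card_side[OF fin e] card_side[OF fin es] n by linarith
  then show ?thesis
  proof
    assume two: "card (inner W v a b c) \<ge> 2"
    show ?thesis by (rule good_leaf[OF fin e n3 tree(1) kl(1) two _ ne(2)]) (simp add: rest nb_def)
  next
    assume two: "card (inner W v b a c) \<ge> 2"
    show ?thesis by (rule good_leaf[OF fin es n3 tree(2) kl(2) two _ ne(1)]) (simp add: rest rest_commute[of W b a] nb_def)
  qed
qed

text \<open>In the tree on the side of \<open>b\<close> the vertex \<open>c\<close> is isolated, so
  this side is \<open>{c}\<close> alone. Hence \<open>a\<close> sees everything else, and its
  remaining neighbours form the tree \<open>?A\<close> prolonged by the path from \<open>c\<close>
  over \<open>b\<close> to \<open>v\<close>.\<close>

lemma ear_fan:
  assumes fin: "finite W" and e: "ear W v a b c" and ab: "adj a b" and rest: "rest W a b = {}"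
    and l: "nb (inner W v b a c) c = {}"
    and treeA: "ed (side W v a b) (side W v a b) + 2 = 2 * card (side W v a b)"
    and treeB: "ed (side W v b a) (side W v b a) + 2 = 2 * card (side W v b a)"
  shows "fan_center W a"
proof -
  let ?A = "side W v a b"
  note d = earD[OF e] and es = ear_sym[OF e]
  have fA: "finite ?A" using finite_side[OF fin] .
  have B: "side W v b a = {c}"
  proof (rule ccontr)
    assume "side W v b a \<noteq> {c}"
    then obtain y where "y \<in> side W v b a - {c}" "adj c y"
      using side_connected[OF fin treeB, of "{c}"] side_insert[OF es] by auto
    then show False using l by (auto simp: nb_def inner_def)
  qed
  then have W: "W - {a} = insert v (insert b ?A)"
    using W_cases[OF e] d rest adj_irrefl by (auto simp: inner_def side_def nb_def)
  have nA: "v \<notin> ?A" "b \<notin> ?A" by (auto simp: side_def)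
  let ?N = "insert v (insert b ?A)"
  have "nb ?N v = {b}" using d W adj_irrefl by (auto simp: nb_def)
  then have "ed ?N ?N = ed (insert b ?A) (insert b ?A) + 2"
    using ed_remove[of ?N v] fA nA d by simp
  moreover have "nb (insert b ?A) b = {c}"
    using B d adj_irrefl inner_not_adj(1)[OF fin e] side_insert[OF e] by (auto simp: nb_def)
  then have "ed (insert b ?A) (insert b ?A) = ed ?A ?A + 2"
    using ed_remove[of "insert b ?A" b] fA nA by simp
  moreover have "card ?N = card ?A + 2" using fA nA d by simp
  ultimately have "ed (W - {a}) (W - {a}) + 2 = 2 * card (W - {a})" unfolding W using treeA by simp
  moreover have "\<forall>w \<in> W - {a}. adj a w" unfolding W using d ab by (auto simp: side_def nb_def)
  ultimately show ?thesis using d by (simp add: fan_center_def)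
qed

text \<open>From \<open>s < k + l \<le> 2\<close> only \<open>s = 0\<close> and \<open>s = 1\<close>
  remain. With \<open>k = l = 1\<close> excluded for \<open>s = 0\<close> by
  \<open>ear_full\<close>, the upper bound is \<open>4 n - 9\<close> in both cases, and exceeding
  \<open>4 n - 10\<close> turns every estimate into an equality: both sides are trees and, for
  \<open>s = 1\<close>, the remaining vertex sends three edges to the sides. For seven vertices only
  the bound \<open>4 n - 9\<close> is drawn from this.\<close>

lemma through_dichotomy:
  assumes fin: "finite W" and n: "card W \<ge> 7"
  shows "(\<exists>v \<in> W. through W v + 10 \<le> 4 * card W) \<or>
    (\<exists>v \<in> W. through W v + 9 \<le> 4 * card W) \<and>
      (card W \<ge> 8 \<longrightarrow> (\<exists>a. fan_center W a) \<or> card W = 8 \<and> card (paths4 W) \<le> 148)"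
proof (rule disj_imp[THEN iffD2], rule impI)
  assume none: "\<not> (\<exists>v \<in> W. through W v + 10 \<le> 4 * card W)"
  obtain v where v: "v \<in> W" "card (nb W v) \<le> 2" using low_degree_vertex[OF fin] n by auto
  then have big: "4 * card W < through W v + 10" using none by auto
  have n3: "card W \<ge> 3" using n by simp
  obtain a b c where e: "ear W v a b c" "adj a b"
    and s: "card (rest W a b) < card (nb (inner W v a b c) c) + card (nb (inner W v b a c) c)"
    using through_low_degree[OF fin v n3 big] by metis
  note es = ear_sym[OF e(1)]
  note kl = nb_inner_le_1[OF fin e(1)] nb_inner_le_1[OF fin es]
  let ?A = "side W v a b" and ?B = "side W v b a" and ?Z = "rest W a b"
  note facts = through_ear[OF fin e] ear_card[OF fin e(1)] ed_side_side[OF fin e(1)] ed_side_side[OF fin es]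
    ed_rest_le[OF fin e(1)]
  have fZ: "finite ?Z" using finite_rest[OF fin] .
  show "(\<exists>v \<in> W. through W v + 9 \<le> 4 * card W) \<and>
      (card W \<ge> 8 \<longrightarrow> (\<exists>a. fan_center W a) \<or> card W = 8 \<and> card (paths4 W) \<le> 148)"
  proof (cases "card ?Z = 0")
    case True
    then have Z: "?Z = {}" using fZ by simp
    then have R: "ed ?A ?Z + ed ?B ?Z = 0" by simp
    have "\<not> (card (nb (inner W v a b c) c) = 1 \<and> card (nb (inner W v b a c) c) = 1)"
      using ear_full[OF fin n e Z] none by blast
    then have one: "card (nb (inner W v a b c) c) + card (nb (inner W v b a c) c) = 1"
      using kl s by linarith
    have tr: "ed ?A ?A + 2 = 2 * card ?A" "ed ?B ?B + 2 = 2 * card ?B"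
      using facts one True R big by linarith+
    have "through W v + 9 \<le> 4 * card W" using facts one True R by linarith
    moreover have "\<exists>a. fan_center W a"
    proof (cases "card (nb (inner W v b a c) c) = 0")
      case True
      then have "nb (inner W v b a c) c = {}" using finite_nb[OF finite_inner[OF fin]] by simp
      then show ?thesis using ear_fan[OF fin e Z _ tr] by blast
    next
      case False
      then have "card (nb (inner W v a b c) c) = 0" using one by linarith
      then have "nb (inner W v a b c) c = {}" using finite_nb[OF finite_inner[OF fin]] by simp
      then show ?thesis using ear_fan[OF fin es adj_sym[OF e(2)] _ _ tr(2,1)] Z rest_commute[of W a b] by auto
    qed
    ultimately show ?thesis using v by blast
  next
    case False
    then have Z1: "card ?Z = 1" and k: "card (nb (inner W v a b c) c) = 1" and l: "card (nb (inner W v b a c) c) = 1"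
      using s kl by linarith+
    obtain z where z: "?Z = {z}" using Z1 by (metis card_1_singletonE)
    have tr: "ed ?A ?A + 2 = 2 * card ?A" "ed ?B ?B + 2 = 2 * card ?B" "ed ?A ?Z + ed ?B ?Z = 3"
      using facts k l Z1 big by linarith+
    have t9: "through W v + 9 \<le> 4 * card W" using facts k l Z1 by linarith
    have "card (nb ?A z) + card (nb ?B z) = 3" using ed_rest[OF fin, of v a b] tr(3) z by simp
    then have zc: "adj z c" "nb (inner W v a b c) z \<noteq> {} \<or> nb (inner W v b a c) z \<noteq> {}"
      using rest_bound(2)[OF fin e(1), of z] z by auto
    have "card W = 8 \<and> card (paths4 W) \<le> 148" if n8: "card W \<ge> 8"
      using zc(2)
    proof
      assume "nb (inner W v a b c) z \<noteq> {}"
      then obtain x0 where x0: "x0 \<in> inner W v a b c" "adj z x0" by (auto simp: nb_def)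
      show ?thesis using ear_with_one_rest[OF fin n8 e tr(1,2) k l z zc(1) x0 t9] none by blast
    next
      assume "nb (inner W v b a c) z \<noteq> {}"
      then obtain x0 where x0: "x0 \<in> inner W v b a c" "adj z x0" by (auto simp: nb_def)
      have z': "rest W b a = {z}" using z rest_commute[of W a b] by simp
      show ?thesis using ear_with_one_rest[OF fin n8 es adj_sym[OF e(2)] tr(2,1) l k z' zc(1) x0 t9] none by blast
    qed
    then show ?thesis using t9 v by blast
  qed
qed

lemma card_paths4_7:
  assumes "finite W" "card W = 7" shows "card (paths4 W) \<le> 104"
proof -
  have "7 \<le> card W" using assms(2) by simp
  from through_dichotomy[OF assms(1) this] obtain v where "v \<in> W" "through W v + 9 \<le> 4 * card W"
    by fastforce
  then obtain v where v: "v \<in> W" "through W v \<le> 19" using assms by auto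
  have "card (paths4 (W - {v})) \<le> 66" using card_paths4_6[of "W - {v}"] assms v by simp
  then show ?thesis using remove_bound[OF assms(1) v] by fastforce
qed

section \<open>Fans\<close>

definition path_labelling :: "(nat \<Rightarrow> 'a) \<Rightarrow> 'a set \<Rightarrow> bool" where
  "path_labelling f A \<longleftrightarrow> bij_betw f {..<card A} A \<and>
    (\<forall>i < card A. \<forall>j < card A. adj (f i) (f j) \<longleftrightarrow> j = Suc i \<or> i = Suc j)"

lemma path_labelling_rev:
  assumes "path_labelling f A"
  shows "path_labelling (\<lambda>i. f (card A - Suc i)) A"
proof -
  let ?m = "card A"
  have "bij_betw (\<lambda>i. ?m - Suc i) {..<?m} {..<?m}"
    by (rule bij_betw_byWitness[where f' = "\<lambda>i. ?m - Suc i"]) auto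
  then have "bij_betw (f \<circ> (\<lambda>i. ?m - Suc i)) {..<?m} A"
    using assms by (auto simp: path_labelling_def intro: bij_betw_trans)
  moreover have "adj (f (?m - Suc i)) (f (?m - Suc j)) \<longleftrightarrow> j = Suc i \<or> i = Suc j" if "i < ?m" "j < ?m" for i j
  proof -
    have "adj (f (?m - Suc i)) (f (?m - Suc j)) \<longleftrightarrow> ?m - Suc j = Suc (?m - Suc i) \<or> ?m - Suc i = Suc (?m - Suc j)"
      using assms that by (auto simp: path_labelling_def)
    then show ?thesis using that by auto
  qed
  ultimately show ?thesis by (simp add: path_labelling_def o_def)
qed

text \<open>Delete a leaf \<open>w\<close> and label the remaining path by induction. The neighbour
  \<open>y\<close> of \<open>w\<close> is an end of that path, which is reversed if
  necessary.\<close>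

lemma tree_path_labelling:
  assumes "finite A" "A \<noteq> {}" "\<And>w. w \<in> A \<Longrightarrow> adj a w" "ed A A + 2 = 2 * card A"
  shows "\<exists>f. path_labelling f A"
  using assms
proof (induction A rule: finite_psubset_induct)
  case (psubset A)
  have a: "a \<notin> A" using psubset.prems(2) adj_irrefl by metis
  have "card (insert a A) \<ge> 2"
    using psubset a by (metis One_nat_def Suc_leI card_gt_0_iff card_insert_disjoint numeral_2_eq_2 Suc_le_mono)
  then obtain w where w: "w \<in> A" "card (nb (insert a A) w) \<le> 2"
    using two_low_degree[of "insert a A"] psubset.hyps by (metis finite.insertI insertE)
  have "nb (insert a A) w = insert a (nb A w)"
    using w(1) psubset.prems(2) adj_sym by (auto simp: nb_def)
  then have w1: "card (nb A w) \<le> 1"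
    using w a psubset.hyps by (simp add: nb_def card_insert_if)
  show ?case
  proof (cases "A = {w}")
    case True
    then have "path_labelling (\<lambda>_. w) A" by (simp add: path_labelling_def bij_betw_def inj_on_def adj_irrefl lessThan_Suc)
    then show ?thesis by blast
  next
    case False
    have cA: "card A = Suc (card (A - {w}))" using w psubset.hyps card_Suc_Diff1 by metis
    obtain y where y: "y \<in> A" "adj w y"
      using tree_connected[OF psubset.hyps psubset.prems(2,3), of "{w}"] w False by auto
    then have nw: "nb A w = {y}"
      using w1 card_le_Suc0_iff_eq[OF finite_nb[OF psubset.hyps]] unfolding One_nat_def by (auto simp: nb_def)
    have yw: "y \<noteq> w" using y adj_irrefl by auto
    have "ed (A - {w}) (A - {w}) + 2 = 2 * card (A - {w})"
      using ed_remove[OF psubset.hyps w(1)] nw psubset.prems(3) cA by simp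
    then obtain f where f: "path_labelling f (A - {w})"
      using psubset.IH[of "A - {w}"] w False psubset.prems(2) by blast
    let ?m = "card (A - {w})"
    have bf: "bij_betw f {..<?m} (A - {w})" and af: "\<And>i j. i < ?m \<Longrightarrow> j < ?m \<Longrightarrow> adj (f i) (f j) \<longleftrightarrow> j = Suc i \<or> i = Suc j"
      using f by (auto simp: path_labelling_def)
    have "y \<in> f ` {..<?m}" using bf y yw by (simp add: bij_betw_def)
    then obtain i where i: "i < ?m" "f i = y" by auto
    \<comment> \<open>At an inner position, both path neighbours of \<open>y\<close> and
      \<open>w\<close> would be three common neighbours of \<open>a\<close> and
      \<open>y\<close>.\<close>
    have "i = 0 \<or> Suc i = ?m"
    proof (rule ccontr)
      assume "\<not> ?thesis"
      then have ij: "i - 1 < ?m" "Suc i < ?m" "i = Suc (i - 1)" using i by auto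
      have "adj y (f (i - 1))" "adj y (f (Suc i))" "adj y w"
        using af[of i "i - 1"] af[of i "Suc i"] ij i y adj_sym by auto
      moreover have fA: "f (i - 1) \<in> A - {w}" "f (Suc i) \<in> A - {w}" using bf ij by (auto simp: bij_betw_def)
      ultimately have sub: "{f (i - 1), f (Suc i), w} \<subseteq> nb A y" using w by (auto simp: nb_def)
      have "f (i - 1) \<noteq> f (Suc i)" using bf ij by (auto simp: bij_betw_def dest!: inj_onD)
      then have "card {f (i - 1), f (Suc i), w} = 3" using fA by auto
      moreover have "card {f (i - 1), f (Suc i), w} \<le> 2"
      proof (rule common_neighbours[of _ a y])
        show "a \<noteq> y" using a y by auto
        show "adj a u \<and> adj y u" if "u \<in> {f (i - 1), f (Suc i), w}" for u
          using that sub psubset.prems(2) by (auto simp: nb_def)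
      qed simp
      ultimately show False by simp
    qed
    then obtain g where g: "path_labelling g (A - {w})" "g (?m - 1) = y"
    proof
      assume "i = 0"
      then show ?thesis using that[OF path_labelling_rev[OF f]] i by auto
    next
      assume "Suc i = ?m"
      then have "?m - 1 = i" by auto
      then show ?thesis using that[OF f] i by auto
    qed
    have bg: "bij_betw g {..<?m} (A - {w})" and ag: "\<And>i j. i < ?m \<Longrightarrow> j < ?m \<Longrightarrow> adj (g i) (g j) \<longleftrightarrow> j = Suc i \<or> i = Suc j"
      using g by (auto simp: path_labelling_def)
    define h where "h = g(?m := w)"
    have hm: "h ?m = w" "\<And>j. j < ?m \<Longrightarrow> h j = g j" by (auto simp: h_def)
    have "bij_betw h {..<card A} A"
    proof -
      have "bij_betw h {..<?m} (A - {w})" using bg hm(2) bij_betw_cong[of "{..<?m}" h g] by auto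
      moreover have "bij_betw h {?m} {w}" using hm(1) by (simp add: bij_betw_def)
      moreover have "(A - {w}) \<inter> {w} = {}" by simp
      ultimately have "bij_betw h ({..<?m} \<union> {?m}) ((A - {w}) \<union> {w})" by (rule bij_betw_combine)
      moreover have "{..<?m} \<union> {?m} = {..<card A}"
        by (simp only: cA lessThan_Suc Un_insert_right Un_empty_right)
      moreover have "(A - {w}) \<union> {w} = A" using w(1) by blast
      ultimately show ?thesis by metis
    qed
    moreover have wg: "adj w (g j) \<longleftrightarrow> Suc j = ?m" if j: "j < ?m" for j
    proof -
      have "g j \<in> A" using bg j by (auto simp: bij_betw_def)
      then have "adj w (g j) \<longleftrightarrow> g j = y" using nw by (auto simp: nb_def)
      also have "\<dots> \<longleftrightarrow> j = ?m - 1"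
        using bg g(2) j inj_on_eq_iff[of g "{..<?m}" j "?m - 1"] by (auto simp: bij_betw_def)
      finally show ?thesis using j by auto
    qed
    have "adj (h i) (h j) \<longleftrightarrow> j = Suc i \<or> i = Suc j" if ij: "i < card A" "j < card A" for i j
    proof -
      have "i \<le> ?m" "j \<le> ?m" using ij unfolding cA by (simp_all only: less_Suc_eq_le)
      then consider "i < ?m" "j < ?m" | "i = ?m" "j < ?m" | "i < ?m" "j = ?m" | "i = ?m" "j = ?m"
        unfolding le_less by blast
      then show ?thesis
      proof cases
        case 1 then show ?thesis using hm ag by simp
      next
        case 2 then show ?thesis using hm wg by auto
      next
        case 3 then show ?thesis using hm wg adj_commute by auto
      next
        case 4 then show ?thesis using hm adj_irrefl by auto
      qed
    qed
    ultimately show ?thesis unfolding path_labelling_def by blast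
  qed
qed

definition fan_labelling :: "'a \<Rightarrow> (nat \<Rightarrow> 'a) \<Rightarrow> nat \<Rightarrow> bool" where
  "fan_labelling a f m \<longleftrightarrow> inj_on f {..<m} \<and> a \<notin> f ` {..<m} \<and> (\<forall>i < m. adj a (f i)) \<and>
    (\<forall>i < m. \<forall>j < m. adj (f i) (f j) \<longleftrightarrow> j = Suc i \<or> i = Suc j)"

lemma fan_labelling_Suc: "fan_labelling a f (Suc m) \<Longrightarrow> fan_labelling a f m"
  by (auto simp: fan_labelling_def lessThan_Suc)

text \<open>The vertex deleted is an end of the path. The fan has \<open>n = m + 4\<close> vertices,
  so that the value is \<open>4 n - 9\<close>, except for \<open>m = 0\<close>, where
  \<open>f m\<close> has no predecessor and one path is missing.\<close>

lemma through_fan: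
  assumes fan: "fan_labelling a f (Suc (Suc (Suc m)))"
  defines "W \<equiv> insert a (f ` {..<Suc (Suc (Suc m))})"
  shows "through W (f (Suc (Suc m))) = 4 * m + (if m = 0 then 6 else 7)"
proof -
  let ?M = "Suc (Suc (Suc m))"
  let ?v = "f (Suc (Suc m))" and ?b = "f (Suc m)" and ?u = "f m"
  have inj: "f i = f j \<longleftrightarrow> i = j" if "i < ?M" "j < ?M" for i j
    using fan that by (auto simp: fan_labelling_def inj_on_eq_iff)
  have a: "f i \<noteq> a" "a \<noteq> f i" if "i < ?M" for i using fan that by (auto simp: fan_labelling_def)
  have aa: "adj a (f i)" "adj (f i) a" if "i < ?M" for i using fan that adj_sym by (auto simp: fan_labelling_def)
  have ff: "adj (f i) (f j) \<longleftrightarrow> j = Suc i \<or> i = Suc j" if "i < ?M" "j < ?M" for i j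
    using fan that by (auto simp: fan_labelling_def)
  have fin: "finite W" by (simp add: W_def)
  have nb: "nb W (f i) = insert a (f ` {j. j < ?M \<and> (j = Suc i \<or> i = Suc j)})" if "i < ?M" for i
    using that aa ff by (auto simp: nb_def W_def)
  have nbc: "nb W a = f ` {..<?M}" using aa adj_irrefl by (auto simp: nb_def W_def)
  have "{j. j < ?M \<and> (j = Suc (Suc (Suc m)) \<or> Suc (Suc m) = Suc j)} = {Suc m}" by auto
  then have nv: "nb W ?v = {a, ?b}" using nb[of "Suc (Suc m)"] by simp
  have A: "side W ?v a ?b = f ` {..<Suc m}"
  proof -
    have "{..<?M} = {..<Suc m} \<union> {Suc m, Suc (Suc m)}" by auto
    then have "f ` {..<?M} = f ` {..<Suc m} \<union> {?b, ?v}" by auto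
    moreover have "?b \<notin> f ` {..<Suc m}" "?v \<notin> f ` {..<Suc m}" using inj by auto
    ultimately show ?thesis unfolding side_def nbc by auto
  qed
  have B: "side W ?v ?b a = {?u}"
  proof -
    have "{j. j < ?M \<and> (j = Suc (Suc m) \<or> Suc m = Suc j)} = {m, Suc (Suc m)}" by auto
    then have "nb W ?b = {a, ?u, ?v}" using nb[of "Suc m"] by simp
    then show ?thesis unfolding side_def using a(1)[of m] inj[of m "Suc (Suc m)"] by auto
  qed
  have edA: "ed (f ` {..<Suc m}) (W - {a}) = 2 * m + 1"
  proof -
    have "inj_on f {..<Suc m}" using inj by (auto simp: inj_on_def)
    then have "ed (f ` {..<Suc m}) (W - {a}) = (\<Sum>i<Suc m. card (nb (W - {a}) (f i)))"
      using fin by (simp add: ed_sum sum.reindex)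
    also have "\<dots> = (\<Sum>i<Suc m. if i = 0 then 1 else 2)"
    proof (rule sum.cong)
      fix i assume "i \<in> {..<Suc m}"
      then have i: "i < Suc m" by simp
      have "nb (W - {a}) (f i) = f ` (if i = 0 then {1} else {i - 1, Suc i})"
      proof -
        have "nb (W - {a}) (f i) = nb W (f i) - {a}" by (auto simp: nb_def)
        also have "\<dots> = f ` {j. j < ?M \<and> (j = Suc i \<or> i = Suc j)}" using nb[of i] i a by auto
        also have "{j. j < ?M \<and> (j = Suc i \<or> i = Suc j)} = (if i = 0 then {1} else {i - 1, Suc i})" using i by auto
        finally show ?thesis .
      qed
      then show "card (nb (W - {a}) (f i)) = (if i = 0 then 1 else 2)" using inj[of "i - 1" "Suc i"] i by auto
    qed simp
    also have "\<dots> = 2 * m + 1" by (induction m) auto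
    finally show ?thesis .
  qed
  have edB: "ed {?u} (W - {?b}) = (if m = 0 then 1 else 2)"
  proof -
    have "nb (W - {?b}) ?u = nb W ?u - {?b}" by (auto simp: nb_def)
    also have "\<dots> = (if m = 0 then {a} else {a, f (m - 1)})"
    proof -
      have "{j. j < ?M \<and> (j = Suc m \<or> m = Suc j)} = (if m = 0 then {Suc m} else {m - 1, Suc m})" by auto
      then have "nb W ?u = (if m = 0 then {a, ?b} else {a, f (m - 1), ?b})" using nb[of m] by auto
      then show ?thesis using a[of "Suc m"] inj[of "m - 1" "Suc m"] by (cases m) auto
    qed
    finally show ?thesis using a[of "m - 1"] by (simp add: ed_singleton_left)
  qed
  have "card (f ` {..<Suc m}) = Suc m" using inj by (subst card_image) (auto simp: inj_on_def)
  moreover have "?v \<in> W" "a \<noteq> ?b" "adj a ?b" using a aa by (auto simp: W_def)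
  ultimately show ?thesis
    using through_degree_two[OF fin \<open>?v \<in> W\<close> nv] A B edA edB by auto
qed

text \<open>With \<open>n = m + 4\<close> the count is \<open>2 F n\<close>, rearranged to avoid
  subtraction; each further vertex costs exactly the growth of \<open>F\<close>.\<close>

lemma card_paths4_fan:
  assumes "fan_labelling a f (m + 3)"
  shows "card (paths4 (insert a (f ` {..<m + 3}))) + 6 * (m + 3) + 6 = 4 * (m + 3) ^ 2"
  using assms
proof (induction m)
  case 0
  let ?W = "insert a (f ` {..<Suc (Suc (Suc 0))})"
  have fan: "fan_labelling a f (Suc (Suc (Suc 0)))" using 0 by (simp add: eval_nat_numeral)
  have W: "?W - {f (Suc (Suc 0))} = insert a (f ` {..<Suc (Suc 0)})"
    using fan by (auto simp: fan_labelling_def inj_on_def lessThan_Suc)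
  have "card (insert a (f ` {..<Suc (Suc 0)})) \<le> 3"
    by (simp add: lessThan_Suc card_insert_if)
  then have "card (paths4 (?W - {f (Suc (Suc 0))})) = 0" unfolding W by (intro card_paths4_3) auto
  then have "card (paths4 ?W) = 12"
    using card_paths4_remove[of ?W "f (Suc (Suc 0))"] through_fan[OF fan] by simp
  then show ?case by (simp add: eval_nat_numeral)
next
  case (Suc m)
  let ?W = "insert a (f ` {..<Suc (Suc (Suc (Suc m)))})"
  have fan: "fan_labelling a f (Suc (Suc (Suc (Suc m))))" using Suc.prems by (simp add: eval_nat_numeral)
  have W: "?W - {f (Suc (Suc (Suc m)))} = insert a (f ` {..<m + 3})"
    using fan by (auto simp: fan_labelling_def inj_on_def lessThan_Suc eval_nat_numeral)
  have "fan_labelling a f (m + 3)" using fan_labelling_Suc[OF fan] by (simp add: eval_nat_numeral)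
  then have IH: "card (paths4 (insert a (f ` {..<m + 3}))) + 6 * (m + 3) + 6 = 4 * (m + 3) ^ 2"
    using Suc.IH by blast
  have "card (paths4 ?W) = card (paths4 (insert a (f ` {..<m + 3}))) + 2 * (4 * Suc m + 7)"
    using card_paths4_remove[of ?W "f (Suc (Suc (Suc m)))"] through_fan[OF fan] W by simp
  then have "card (paths4 (insert a (f ` {..<Suc m + 3}))) = card (paths4 (insert a (f ` {..<m + 3}))) + 2 * (4 * Suc m + 7)"
    by (simp add: eval_nat_numeral)
  then show ?case using IH by (simp add: power2_eq_square algebra_simps)
qed

lemma fan_center_labelling:
  assumes "finite W" "fan_center W a" "card W \<ge> 2"
  obtains f where "fan_labelling a f (card W - 1)" "W = insert a (f ` {..<card W - 1})"
proof -
  have a: "a \<in> W" "\<And>w. w \<in> W - {a} \<Longrightarrow> adj a w" "ed (W - {a}) (W - {a}) + 2 = 2 * card (W - {a})"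
    using assms(2) by (auto simp: fan_center_def)
  have c: "card (W - {a}) = card W - 1" using a assms(1) by simp
  then have "W - {a} \<noteq> {}" using assms(3) by (metis card.empty diff_is_0_eq not_less_eq_eq numeral_2_eq_2 One_nat_def)
  then obtain f where f: "path_labelling f (W - {a})"
    using tree_path_labelling[of "W - {a}" a] assms(1) a by blast
  then have b: "bij_betw f {..<card W - 1} (W - {a})" using c by (simp add: path_labelling_def)
  then have "f ` {..<card W - 1} = W - {a}" by (simp add: bij_betw_def)
  then have "fan_labelling a f (card W - 1)" "W = insert a (f ` {..<card W - 1})"
    using f b a c by (auto simp: fan_labelling_def path_labelling_def bij_betw_def)
  then show ?thesis using that by blast
qed

lemma card_paths4_fan_center:
  assumes "finite W" "fan_center W a" "card W \<ge> 4"
  shows "int (card (paths4 W)) = 2 * (2 * (int (card W))\<^sup>2 - 7 * int (card W) + 2)"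
proof -
  obtain f where f: "fan_labelling a f (card W - 1)" "W = insert a (f ` {..<card W - 1})"
    using fan_center_labelling[OF assms(1,2)] assms(3) by auto
  obtain m where m: "card W = m + 4" using assms(3) by (metis add.commute le_Suc_ex)
  then have "card W - 1 = m + 3" by simp
  then have "card (paths4 W) + 6 * (m + 3) + 6 = 4 * (m + 3) ^ 2"
    using card_paths4_fan[of a f m] f by metis
  then have "int (card (paths4 W)) + 6 * (int m + 3) + 6 = 4 * (int m + 3) ^ 2"
    by (metis (mono_tags, lifting) of_nat_add of_nat_mult of_nat_numeral of_nat_power)
  then show ?thesis unfolding m by (simp add: power2_eq_square algebra_simps)
qed

text \<open>Induction by deleting a vertex of cost at most \<open>4 n - 10\<close>; this is below
  the growth of \<open>F\<close>, so such a graph is not extremal from nine vertices on. If there is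
  no such vertex, \<open>through_dichotomy\<close> leaves the fan and the exception on eight
  vertices.\<close>

lemma card_paths4_le:
  assumes "finite W" "card W \<ge> 8"
  shows "int (card (paths4 W)) \<le> 2 * (2 * (int (card W))\<^sup>2 - 7 * int (card W) + 2) \<and>
    (card W \<ge> 9 \<longrightarrow> int (card (paths4 W)) = 2 * (2 * (int (card W))\<^sup>2 - 7 * int (card W) + 2) \<longrightarrow>
      (\<exists>a. fan_center W a))"
  using assms
proof (induction "card W" arbitrary: W)
  case 0
  then show ?case by simp
next
  case (Suc n)
  have n: "card W = Suc n" "n \<ge> 7" using Suc.hyps(2) Suc.prems(2) by auto
  show ?case
  proof (cases "\<exists>v \<in> W. through W v + 10 \<le> 4 * card W")
    case True
    then obtain v where v: "v \<in> W" "through W v + 10 \<le> 4 * card W" by blast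
    have c: "card (W - {v}) = n" "finite (W - {v})" using v n Suc.prems by auto
    have eq: "int (card (paths4 W)) = int (card (paths4 (W - {v}))) + 2 * int (through W v)"
      using card_paths4_remove[OF Suc.prems(1) v(1)] by simp
    have t: "int (through W v) + 10 \<le> 4 * (int n + 1)" using v(2) unfolding n by simp
    show ?thesis
    proof (cases "n = 7")
      \<comment> \<open>The bound for seven vertices exceeds \<open>2 F 7\<close> by 2, and 104 + 2
        * 22 = 148 is just \<open>2 F 8\<close>; strictness is lost at this one step.\<close>
      case True
      then have "card (paths4 (W - {v})) \<le> 104" using card_paths4_7 c by auto
      then show ?thesis using eq t True n by simp
    next
      case False
      then have "n \<ge> 8" using n by simp
      then have "int (card (paths4 (W - {v}))) \<le> 2 * (2 * (int n)\<^sup>2 - 7 * int n + 2)"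
        using Suc.hyps(1)[of "W - {v}"] c by auto
      then have "int (card (paths4 W)) < 2 * (2 * (int (card W))\<^sup>2 - 7 * int (card W) + 2)"
        using eq t unfolding n by (simp add: power2_eq_square algebra_simps)
      then show ?thesis by simp
    qed
  next
    case False
    have "card W \<ge> 7" using Suc.prems by simp
    from through_dichotomy[OF Suc.prems(1) this] False Suc.prems(2)
    have "(\<exists>a. fan_center W a) \<or> card W = 8 \<and> card (paths4 W) \<le> 148" by blast
    then show ?thesis
    proof
      assume fan: "\<exists>a. fan_center W a"
      then have "int (card (paths4 W)) = 2 * (2 * (int (card W))\<^sup>2 - 7 * int (card W) + 2)"
        using card_paths4_fan_center[OF Suc.prems(1)] Suc.prems(2) by auto
      then show ?thesis using fan by simp
    next
      assume "card W = 8 \<and> card (paths4 W) \<le> 148"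
      then show ?thesis by simp
    qed
  qed
qed

end

section \<open>Copies of the path\<close>

text \<open>Arcs are pairs of vertices, so the arc map of an isomorphism is forced to be
  \<open>map_prod h h\<close>.\<close>

lemma graph_iso_iff:
  assumes S: "pair_wf_digraph S"
  shows "graph_iso S H \<longleftrightarrow> (\<exists>h. bij_betw h (pverts S) (pverts H) \<and> map_prod h h ` parcs S = parcs H)"
proof
  interpret pair_wf_digraph S by (rule S)
  assume "graph_iso S H"
  then obtain f where f: "pre_digraph.digraph_isomorphism (with_proj S) f" "with_proj H = app_iso f (with_proj S)"
    by (auto simp: graph_iso_def digraph_iso_def)
  define h where "h = iso_verts f"
  have eqs: "pverts H = h ` pverts S" "parcs H = iso_arcs f ` parcs S" "iso_tail f = fst" "iso_head f = snd"
    using f(2) by (auto simp: with_proj_def app_iso_def h_def)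
  have iso: "inj_on h (pverts S)" "\<And>e. e \<in> parcs S \<Longrightarrow> h (fst e) = fst (iso_arcs f e) \<and> h (snd e) = snd (iso_arcs f e)"
    using f(1) eqs(3,4) by (auto simp: pre_digraph.digraph_isomorphism_def h_def)
  have "map_prod h h e = iso_arcs f e" if "e \<in> parcs S" for e
    using iso(2)[OF that] by (cases e) (auto intro: prod_eqI)
  then have "map_prod h h ` parcs S = parcs H" unfolding eqs(2) by (intro image_cong) auto
  moreover have "bij_betw h (pverts S) (pverts H)" using iso(1) eqs(1) by (simp add: bij_betw_def)
  ultimately show "\<exists>h. bij_betw h (pverts S) (pverts H) \<and> map_prod h h ` parcs S = parcs H" by blast
next
  interpret pair_wf_digraph S by (rule S)
  assume "\<exists>h. bij_betw h (pverts S) (pverts H) \<and> map_prod h h ` parcs S = parcs H"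
  then obtain h where h: "bij_betw h (pverts S) (pverts H)" "map_prod h h ` parcs S = parcs H" by blast
  let ?f = "\<lparr>iso_verts = h, iso_arcs = map_prod h h, iso_head = snd, iso_tail = fst\<rparr>"
  have inj: "inj_on h (pverts S)" using h by (simp add: bij_betw_def)
  have "parcs S \<subseteq> pverts S \<times> pverts S" using in_arcsD1 in_arcsD2 by auto
  then have "inj_on (map_prod h h) (parcs S)"
    using map_prod_inj_on[OF inj inj] inj_on_subset by blast
  then have "pre_digraph.digraph_isomorphism (with_proj S) ?f"
    using inj wf_digraph_axioms by (auto simp: pre_digraph.digraph_isomorphism_def)
  moreover have "with_proj H = app_iso ?f (with_proj S)"
    using h by (simp add: with_proj_def app_iso_def bij_betw_def)
  ultimately show "graph_iso S H" unfolding graph_iso_def digraph_iso_def by blast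
qed

definition path_copy :: "'a \<times> 'a \<times> 'a \<times> 'a \<Rightarrow> 'a pair_pre_digraph" where
  "path_copy = (\<lambda>(w, x, y, z). \<lparr>pverts = {w, x, y, z}, parcs = {(w, x), (x, w), (x, y), (y, x), (y, z), (z, y)}\<rparr>)"

lemma pair_graph_path_copy:
  assumes "distinct [w, x, y, z]"
  shows "pair_graph (path_copy (w, x, y, z))"
  using assms by unfold_locales (auto simp: path_copy_def symmetric_def sym_def)

lemma lessThan_4: "{..<4 :: nat} = {0, 1, 2, 3}"
  by auto

lemma parcs_path_graph_4: "parcs (path_graph 4) = {(0, 1), (1, 0), (1, 2), (2, 1), (2, 3), (3, 2)}"
  by (auto simp: path_graph_def)

lemma graph_iso_path_copy:
  assumes "distinct [w, x, y, z]"
  shows "graph_iso (path_copy (w, x, y, z)) (path_graph 4)"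
proof -
  interpret pair_graph "path_copy (w, x, y, z)" by (rule pair_graph_path_copy[OF assms])
  define h :: "'a \<Rightarrow> nat" where "h u = (if u = w then 0 else if u = x then 1 else if u = y then 2 else 3)" for u
  have "h w = 0" "h x = 1" "h y = 2" "h z = 3" using assms by (auto simp: h_def)
  then have "bij_betw h (pverts (path_copy (w, x, y, z))) (pverts (path_graph 4)) \<and>
      map_prod h h ` parcs (path_copy (w, x, y, z)) = parcs (path_graph 4)"
    unfolding parcs_path_graph_4
    by (auto simp: path_copy_def bij_betw_def path_graph_def lessThan_4 inj_on_def)
  then show ?thesis using graph_iso_iff[OF pair_wf_digraph_axioms] by blast
qed

lemma graph_iso_path_4D:
  assumes S: "pair_wf_digraph S" and iso: "graph_iso S (path_graph 4)"
  obtains w x y z where "distinct [w, x, y, z]" "S = path_copy (w, x, y, z)"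
proof -
  interpret pair_wf_digraph S by (rule S)
  have "pverts (path_graph 4) = {..<4}" by (simp add: path_graph_def)
  then obtain h where h: "bij_betw h (pverts S) {..<4}" "map_prod h h ` parcs S = parcs (path_graph 4)"
    using iso unfolding graph_iso_iff[OF S] by metis
  define g where "g = the_inv_into (pverts S) h"
  have g: "bij_betw g {..<4} (pverts S)" unfolding g_def using h(1) by (rule bij_betw_the_inv_into)
  have gh: "g (h u) = u" if "u \<in> pverts S" for u
    using h(1) that by (auto simp: g_def bij_betw_def the_inv_into_f_f)
  have "map_prod g g ` (map_prod h h ` parcs S) = parcs S"
  proof -
    have "map_prod g g (map_prod h h e) = e" if "e \<in> parcs S" for e
      using that gh in_arcsD1 in_arcsD2 by (cases e) auto
    then show ?thesis by (simp add: image_image)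
  qed
  then have "parcs S = map_prod g g ` {(0, 1), (1, 0), (1, 2), (2, 1), (2, 3), (3, 2)}"
    unfolding h(2) parcs_path_graph_4 by simp
  moreover have "pverts S = g ` {0, 1, 2, 3}" using g by (simp add: bij_betw_def lessThan_4)
  moreover have "distinct [g 0, g 1, g 2, g 3]"
    using g by (auto simp: bij_betw_def lessThan_4 inj_on_def)
  ultimately show ?thesis using that[of "g 0" "g 1" "g 2" "g 3"] by (simp add: path_copy_def)
qed

text \<open>An end of the path is a vertex with one neighbour; from either end the neighbourhoods
  determine the remaining order.\<close>

lemma path_copy_eqD:
  assumes d: "distinct [w, x, y, z]" "distinct [w', x', y', z']"
    and eq: "path_copy (w, x, y, z) = path_copy (w', x', y', z')"
  shows "(w', x', y', z') = (w, x, y, z) \<or> (w', x', y', z') = (z, y, x, w)"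
proof -
  define N where "N u = {v. (u, v) \<in> parcs (path_copy (w, x, y, z))}" for u
  have N: "N w = {x}" "N x = {w, y}" "N y = {x, z}" "N z = {y}"
    using d(1) by (auto simp: N_def path_copy_def)
  have N': "N w' = {x'}" "N x' = {w', y'}" "N y' = {x', z'}" "N z' = {y'}"
    unfolding N_def eq using d(2) by (auto simp: path_copy_def)
  have V: "{w, x, y, z} = {w', x', y', z'}" using eq by (simp add: path_copy_def)
  have "w' \<noteq> x" "w' \<noteq> y" using N N' d by auto
  then consider "w' = w" | "w' = z" using V by auto
  then show ?thesis
  proof cases
    case 1
    then have "x' = x" using N N' by simp
    then have "y' = y" using N N' 1 d by (auto simp: doubleton_eq_iff)
    moreover have "z' = z" using N N' \<open>x' = x\<close> \<open>y' = y\<close> d by (auto simp: doubleton_eq_iff)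
    ultimately show ?thesis using 1 \<open>x' = x\<close> by simp
  next
    case 2
    then have "x' = y" using N N' by simp
    then have "y' = x" using N N' 2 d by (auto simp: doubleton_eq_iff)
    moreover have "z' = w" using N N' \<open>x' = y\<close> \<open>y' = x\<close> d by (auto simp: doubleton_eq_iff)
    ultimately show ?thesis using 2 \<open>x' = y\<close> by simp
  qed
qed

text \<open>\<open>path_copy\<close> maps the oriented paths onto the copies, and each fibre
  consists of a path and its reversal.\<close>

lemma (in outer_graph) num_copies_paths4:
  assumes G: "pair_graph G" and E: "E = parcs G"
  shows "2 * num_copies (path_graph 4) G = card (paths4 (pverts G))"
proof -
  interpret G: pair_graph G by (rule G)
  let ?P = "paths4 (pverts G)"
  have "u \<in> pverts G \<and> v \<in> pverts G" if "(u, v) \<in> E" for u v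
    using that G.in_arcsD1 G.in_arcsD2 unfolding E by blast
  then have P: "(w, x, y, z) \<in> ?P \<longleftrightarrow> distinct [w, x, y, z] \<and> {(w, x), (x, y), (y, z)} \<subseteq> E" for w x y z
    by (auto simp: paths4_def)
  have fin: "finite ?P" using finite_paths4 G.pair_finite_verts by blast
  have img: "{S. pair_graph S \<and> subgraph (with_proj S) (with_proj G) \<and> graph_iso S (path_graph 4)} = path_copy ` ?P"
  proof
    show "{S. pair_graph S \<and> subgraph (with_proj S) (with_proj G) \<and> graph_iso S (path_graph 4)} \<subseteq> path_copy ` ?P"
    proof
      fix S assume "S \<in> {S. pair_graph S \<and> subgraph (with_proj S) (with_proj G) \<and> graph_iso S (path_graph 4)}"
      then have S: "pair_graph S" "parcs S \<subseteq> E" "graph_iso S (path_graph 4)" by (auto simp: subgraph_def E)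
      interpret S: pair_graph S by (rule S(1))
      obtain w x y z where "distinct [w, x, y, z]" "S = path_copy (w, x, y, z)"
        using graph_iso_path_4D[OF S.pair_wf_digraph_axioms S(3)] by metis
      moreover from this have "(w, x, y, z) \<in> ?P" using S(2) by (auto simp: P path_copy_def)
      ultimately show "S \<in> path_copy ` ?P" by blast
    qed
    show "path_copy ` ?P \<subseteq> {S. pair_graph S \<and> subgraph (with_proj S) (with_proj G) \<and> graph_iso S (path_graph 4)}"
    proof
      fix S assume "S \<in> path_copy ` ?P"
      then obtain w x y z where t: "(w, x, y, z) \<in> ?P" "S = path_copy (w, x, y, z)" by auto
      then have d: "distinct [w, x, y, z]" and sub: "{(w, x), (x, y), (y, z)} \<subseteq> E" by (auto simp: P)
      interpret S: pair_graph S unfolding t(2) by (rule pair_graph_path_copy[OF d])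
      have "parcs S \<subseteq> parcs G" using sub adj_sym unfolding E[symmetric] t(2) by (auto simp: path_copy_def)
      moreover have "pverts S \<subseteq> pverts G" using t by (auto simp: paths4_def path_copy_def)
      ultimately have "subgraph (with_proj S) (with_proj G)"
        using G.wf_digraph_axioms S.wf_digraph_axioms by (auto simp: subgraph_def compatible_def)
      then show "S \<in> {S. pair_graph S \<and> subgraph (with_proj S) (with_proj G) \<and> graph_iso S (path_graph 4)}"
        using S.pair_graph_axioms graph_iso_path_copy[OF d] t(2) by blast
    qed
  qed
  have fib: "card {t \<in> ?P. path_copy t = S} = 2" if S: "S \<in> path_copy ` ?P" for S
  proof -
    obtain w x y z where t: "(w, x, y, z) \<in> ?P" "S = path_copy (w, x, y, z)" using S by auto
    have d: "distinct [w, x, y, z]" using t by (simp add: P)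
    have "{t \<in> ?P. path_copy t = S} = {(w, x, y, z), (z, y, x, w)}"
    proof
      show "{t \<in> ?P. path_copy t = S} \<subseteq> {(w, x, y, z), (z, y, x, w)}"
      proof
        fix s assume s: "s \<in> {t \<in> ?P. path_copy t = S}"
        obtain w' x' y' z' where ss: "s = (w', x', y', z')" by (cases s)
        then have "distinct [w', x', y', z']" "path_copy (w, x, y, z) = path_copy (w', x', y', z')"
          using s t by (auto simp: P)
        then show "s \<in> {(w, x, y, z), (z, y, x, w)}" using path_copy_eqD[OF d] ss by blast
      qed
      have "(z, y, x, w) \<in> ?P" using t(1) adj_sym by (auto simp: P)
      moreover have "path_copy (z, y, x, w) = S" unfolding t(2) by (auto simp: path_copy_def)
      ultimately show "{(w, x, y, z), (z, y, x, w)} \<subseteq> {t \<in> ?P. path_copy t = S}" using t by auto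
    qed
    then show ?thesis using d by auto
  qed
  have "card ?P = (\<Sum>S \<in> path_copy ` ?P. card {t \<in> ?P. path_copy t = S})"
    using sum.image_gen[OF fin, of "\<lambda>_. 1 :: nat" path_copy] by simp
  also have "\<dots> = (\<Sum>S \<in> path_copy ` ?P. 2)" using fib by (rule sum.cong[OF refl])
  finally show ?thesis unfolding num_copies_def img by simp
qed

section \<open>Drawing the fan\<close>

text \<open>Described by a labelling so that one form serves graphs over any vertex type;
  \<open>graph_join_eq_fan\<close> identifies it with the join.\<close>

definition fan :: "'a \<Rightarrow> (nat \<Rightarrow> 'a) \<Rightarrow> nat \<Rightarrow> 'a pair_pre_digraph" where
  "fan a f m = \<lparr>pverts = insert a (f ` {..<m}),
     parcs = Pair a ` f ` {..<m} \<union> (\<lambda>u. (u, a)) ` f ` {..<m} \<union> map_prod f f ` parcs (path_graph m)\<rparr>"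

lemma graph_join_eq_fan: "graph_join (complete_graph 1) (path_graph m) = fan (Inl 0) Inr m"
  by (auto simp: graph_join_def complete_graph_def fan_def path_graph_def)

lemma pair_graph_fan:
  assumes "inj_on f {..<m}" "a \<notin> f ` {..<m}"
  shows "pair_graph (fan a f m)"
proof unfold_locales
  show "finite (parcs (fan a f m))"
  proof -
    have "finite (parcs (path_graph m))"
      by (rule finite_subset[of _ "{..<m} \<times> {..<m}"]) (auto simp: path_graph_def)
    then show ?thesis by (simp add: fan_def)
  qed
  show "symmetric (with_proj (fan a f m))"
    by (auto simp: symmetric_def sym_def fan_def path_graph_def)
  show "fst e \<noteq> snd e" if "e \<in> parcs (fan a f m)" for e
    using that assms by (auto simp: fan_def path_graph_def inj_on_eq_iff)
qed (auto simp: fan_def path_graph_def)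

lemma card_pverts_fan:
  assumes "inj_on f {..<m}" "a \<notin> f ` {..<m}"
  shows "card (pverts (fan a f m)) = Suc m"
  using assms by (simp add: fan_def card_image)

lemma graph_iso_fan:
  assumes f: "inj_on f {..<m}" "a \<notin> f ` {..<m}" and g: "inj_on g {..<m}" "b \<notin> g ` {..<m}"
  shows "graph_iso (fan a f m) (fan b g m)"
proof -
  interpret pair_graph "fan a f m" by (rule pair_graph_fan[OF f])
  define h where "h u = (if u = a then b else g (the_inv_into {..<m} f u))" for u
  have h: "h a = b" "\<And>i. i < m \<Longrightarrow> h (f i) = g i"
    using f by (auto simp: h_def the_inv_into_f_f)
  have "bij_betw h (pverts (fan a f m)) (pverts (fan b g m))"
    unfolding bij_betw_def
  proof
    show "inj_on h (pverts (fan a f m))"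
      using h f g by (auto simp: fan_def inj_on_def) (metis imageI lessThan_iff)+
    show "h ` pverts (fan a f m) = pverts (fan b g m)"
      using h by (auto simp: fan_def image_image)
  qed
  moreover have "map_prod h h ` parcs (fan a f m) = parcs (fan b g m)"
  proof -
    have 1: "map_prod h h ` Pair a ` f ` {..<m} = Pair b ` g ` {..<m}"
      unfolding image_image using h by (intro image_cong) auto
    have 2: "map_prod h h ` (\<lambda>u. (u, a)) ` f ` {..<m} = (\<lambda>u. (u, b)) ` g ` {..<m}"
      unfolding image_image using h by (intro image_cong) auto
    have 3: "map_prod h h ` map_prod f f ` parcs (path_graph m) = map_prod g g ` parcs (path_graph m)"
      unfolding image_image using h by (intro image_cong) (auto simp: path_graph_def)
    show ?thesis by (simp only: fan_def pair_pre_digraph.simps image_Un 1 2 3)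
  qed
  ultimately show ?thesis using graph_iso_iff[OF pair_wf_digraph_axioms] by blast
qed

lemma in_spoke:
  assumes "z \<in> closed_segment 0 (Complex x 1)"
  shows "0 \<le> Im z \<and> Im z \<le> 1 \<and> Re z = Im z * x"
  using assms by (auto simp: in_segment)

lemma in_rim:
  assumes "z \<in> closed_segment (Complex x 1) (Complex (x + 1) 1)"
  shows "Im z = 1 \<and> x \<le> Re z \<and> Re z \<le> x + 1"
proof -
  obtain u where u: "0 \<le> u" "u \<le> 1" "z = (1 - u) *\<^sub>R Complex x 1 + u *\<^sub>R Complex (x + 1) 1"
    using assms by (auto simp: in_segment)
  have "Re z = (1 - u) * x + u * (x + 1)" "Im z = (1 - u) + u" unfolding u(3) by simp_all
  then have "Re z = x + u" "Im z = 1" by (simp_all add: algebra_simps)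
  then show ?thesis using u by simp
qed

lemma fan_arcE:
  assumes "(u, v) \<in> parcs (fan a f m)"
  obtains i where "i < m" "{u, v} = {a, f i}" | i where "Suc i < m" "{u, v} = {f i, f (Suc i)}"
  using assms by (auto simp: fan_def path_graph_def)

text \<open>The complement of the strip is outside \<open>D\<close> because the strip is convex. A
  point on a border line is approached from there by a vertical shift of
  \<open>e / 2\<close>.\<close>

lemma in_frontier_strip:
  fixes D :: "complex set"
  assumes D: "D \<subseteq> {z. 0 \<le> Im z \<and> Im z \<le> 1}" and z: "z \<in> D" "Im z = 0 \<or> Im z = 1"
  shows "z \<in> frontier (outside D)"
proof -
  let ?K = "{z :: complex. 0 \<le> Im z \<and> Im z \<le> 1}"
  have "?K = {z. Im z \<ge> 0} \<inter> {z. Im z \<le> 1}" by auto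
  then have "convex ?K" by (simp add: convex_Int convex_halfspace_Im_ge convex_halfspace_Im_le)
  then have out: "y \<in> outside D" if "y \<notin> ?K" for y
    using convex_in_outside[of ?K y] that outside_mono[OF D] by blast
  have "z \<in> closure (outside D)"
    unfolding closure_approachable
  proof (intro allI impI)
    fix e :: real assume e: "0 < e"
    define y where "y = z + of_real (if Im z = 0 then - e / 2 else e / 2) * \<i>"
    have "y \<notin> ?K" using z(2) e by (auto simp: y_def)
    moreover have "dist y z < e" using e by (auto simp: y_def dist_norm norm_mult)
    ultimately show "\<exists>y \<in> outside D. dist y z < e" using out by blast
  qed
  moreover have "z \<notin> interior (outside D)"
    using z(1) outside_no_overlap[of D] interior_subset by blast
  ultimately show ?thesis by (simp add: frontier_def)
qed

text \<open>The centre is placed at the origin and path vertex number \<open>i\<close> at the point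
  with real part \<open>i\<close> and imaginary part 1; edges are straight. All vertices lie on the
  border of a strip containing the drawing, so \<open>in_frontier_strip\<close> applies.\<close>

lemma outerplanar_fan:
  assumes f: "inj_on f {..<m}" "a \<notin> f ` {..<m}"
  shows "outerplanar (fan a f m)"
proof -
  define p where "p u = (if u = a then 0 else Complex (real (the_inv_into {..<m} f u)) 1)" for u
  have pa: "p a = 0" by (simp add: p_def)
  have pf: "p (f i) = Complex (real i) 1" if "i < m" for i
    using that f by (auto simp: p_def the_inv_into_f_f)
  \<comment> \<open>An edge is an unordered pair, so a direction of its segment has to be chosen.
    The image and the set of ends do not depend on the choice.\<close>
  define \<gamma> where "\<gamma> e = (let q = (SOME q. e = {fst q, snd q}) in linepath (p (fst q)) (p (snd q)))" for e
  have \<gamma>: "\<exists>x y. {x, y} = {u, v} \<and> \<gamma> {u, v} = linepath (p x) (p y)" for u v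
  proof -
    define q where "q = (SOME q. {u, v} = {fst q, snd q})"
    have "{u, v} = {fst q, snd q}" unfolding q_def by (rule someI[of _ "(u, v)"]) simp
    moreover have "\<gamma> {u, v} = linepath (p (fst q)) (p (snd q))" by (simp add: \<gamma>_def q_def Let_def)
    ultimately show ?thesis by metis
  qed
  have image: "path_image (\<gamma> {u, v}) = closed_segment (p u) (p v)" for u v
    using \<gamma>[of u v] by (auto simp: doubleton_eq_iff closed_segment_commute)
  have ends: "{pathstart (\<gamma> {u, v}), pathfinish (\<gamma> {u, v})} = {p u, p v}" for u v
    using \<gamma>[of u v] by (auto simp: doubleton_eq_iff)
  have arc: "arc (\<gamma> {u, v})" if "p u \<noteq> p v" for u v
    using \<gamma>[of u v] that by (auto simp: doubleton_eq_iff arc_linepath)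
  have spoke: "0 \<le> Im z \<and> Im z \<le> 1 \<and> Re z = Im z * real i" if "i < m" "z \<in> path_image (\<gamma> {a, f i})" for i z
    using that in_spoke[of z "real i"] by (simp add: image pa pf)
  have rim: "Im z = 1 \<and> real i \<le> Re z \<and> Re z \<le> real i + 1"
    if "Suc i < m" "z \<in> path_image (\<gamma> {f i, f (Suc i)})" for i z
    using that in_rim[of z "real i"] by (simp add: image pf add.commute)
  have V: "p ` pverts (fan a f m) = insert 0 ((\<lambda>i. Complex (real i) 1) ` {..<m})"
    using pf by (auto simp: fan_def pa image_image)
  have inj: "inj_on p (pverts (fan a f m))"
    using f pf pa by (auto simp: fan_def inj_on_def complex_eq_iff)
  note arcD = pair_graph_arcD[OF pair_graph_fan[OF f]]
  let ?V = "p ` pverts (fan a f m)"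
  have own: "path_image (\<gamma> {u, v}) \<inter> ?V = {p u, p v}" if uv: "(u, v) \<in> parcs (fan a f m)" for u v
  proof
    show "{p u, p v} \<subseteq> path_image (\<gamma> {u, v}) \<inter> ?V"
      using arcD[OF uv] by (auto simp: image)
    show "path_image (\<gamma> {u, v}) \<inter> ?V \<subseteq> {p u, p v}"
      using uv
    proof (cases rule: fan_arcE)
      case (1 i)
      have "z = p a \<or> z = p (f i)" if "z \<in> path_image (\<gamma> {a, f i})" "z \<in> ?V" for z
        using spoke[OF 1(1) that(1)] that(2) unfolding V by (auto simp: pa pf[OF 1(1)])
      moreover have "{p u, p v} = {p a, p (f i)}" using 1(2) by (metis image_empty image_insert)
      ultimately show ?thesis unfolding 1(2) by blast
    next
      case (2 i)
      have "z = p (f i) \<or> z = p (f (Suc i))" if z: "z \<in> path_image (\<gamma> {f i, f (Suc i)})" "z \<in> ?V" for z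
      proof -
        obtain j where j: "j < m" "z = Complex (real j) 1"
          using rim[OF 2(1) z(1)] z(2) unfolding V by auto
        then have "j = i \<or> j = Suc i" using rim[OF 2(1) z(1)] j(2) by auto
        then show ?thesis using j pf 2(1) by auto
      qed
      moreover have "{p u, p v} = {p (f i), p (f (Suc i))}" using 2(2) by (metis image_empty image_insert)
      ultimately show ?thesis unfolding 2(2) by blast
    qed
  qed
  have meet: "z \<in> ?V" if uv: "(u, v) \<in> parcs (fan a f m)" and xy: "(x, y) \<in> parcs (fan a f m)"
    and ne: "{u, v} \<noteq> {x, y}" and z: "z \<in> path_image (\<gamma> {u, v})" "z \<in> path_image (\<gamma> {x, y})" for u v x y z
  proof -
    have sr: "z \<in> ?V" if "i < m" "Suc j < m" "z \<in> path_image (\<gamma> {a, f i})" "z \<in> path_image (\<gamma> {f j, f (Suc j)})" for i j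
    proof -
      have "z = Complex (real i) 1"
        using spoke[OF that(1,3)] rim[OF that(2,4)] by (simp add: complex_eq_iff)
      then show ?thesis using that(1) unfolding V by blast
    qed
    have rr: "z \<in> ?V" if "Suc i < m" "Suc j < m" "i < j" "z \<in> path_image (\<gamma> {f i, f (Suc i)})"
      "z \<in> path_image (\<gamma> {f j, f (Suc j)})" for i j
    proof -
      have "z = Complex (real j) 1"
        using rim[OF that(1,4)] rim[OF that(2,5)] that(3) by (simp add: complex_eq_iff)
      then show ?thesis using that(2) unfolding V by auto
    qed
    show ?thesis
      using uv
    proof (cases rule: fan_arcE)
      case i: (1 i)
      show ?thesis
        using xy
      proof (cases rule: fan_arcE)
        case j: (1 j)
        have "i \<noteq> j" using ne i(2) j(2) by auto
        moreover have "Re z = Im z * real i" "Re z = Im z * real j"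
          using spoke[OF i(1)] spoke[OF j(1)] z unfolding i(2) j(2) by blast+
        ultimately have "z = 0" by (auto simp: complex_eq_iff)
        then show ?thesis unfolding V by simp
      next
        case j: (2 j)
        then show ?thesis using sr[OF i(1) j(1)] z unfolding i(2) j(2) by blast
      qed
    next
      case i: (2 i)
      show ?thesis
        using xy
      proof (cases rule: fan_arcE)
        case j: (1 j)
        then show ?thesis using sr[OF j(1) i(1)] z unfolding i(2) j(2) by blast
      next
        case j: (2 j)
        have "i \<noteq> j" using ne i(2) j(2) by auto
        then show ?thesis using rr[OF i(1) j(1)] rr[OF j(1) i(1)] z unfolding i(2) j(2) by (metis nat_neq_iff)
      qed
    qed
  qed
  have "plane_drawing (fan a f m) p \<gamma>"
    unfolding plane_drawing_def
  proof (intro conjI ballI inj)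
    fix e assume e: "e \<in> parcs (fan a f m)"
    obtain u v where uv: "e = (u, v)" by (cases e)
    have "p u \<noteq> p v"
      using arcD[of u v] e uv inj by (simp add: inj_on_eq_iff)
    then show "case e of (u, v) \<Rightarrow> arc (\<gamma> {u, v}) \<and>
        {pathstart (\<gamma> {u, v}), pathfinish (\<gamma> {u, v})} = {p u, p v} \<and> path_image (\<gamma> {u, v}) \<inter> ?V = {p u, p v}"
      using arc ends own e uv by auto
  next
    fix e assume e: "e \<in> parcs (fan a f m)"
    obtain u v where uv: "e = (u, v)" by (cases e)
    show "case e of (u, v) \<Rightarrow> \<forall>(x, y) \<in> parcs (fan a f m). {u, v} \<noteq> {x, y} \<longrightarrow>
        path_image (\<gamma> {u, v}) \<inter> path_image (\<gamma> {x, y}) \<subseteq> ?V"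
      unfolding uv prod.case
    proof
      fix e' assume e': "e' \<in> parcs (fan a f m)"
      obtain x y where xy: "e' = (x, y)" by (cases e')
      show "case e' of (x, y) \<Rightarrow> {u, v} \<noteq> {x, y} \<longrightarrow> path_image (\<gamma> {u, v}) \<inter> path_image (\<gamma> {x, y}) \<subseteq> ?V"
        unfolding xy prod.case using meet[of u v x y] e uv e' xy by blast
    qed
  qed
  moreover have "?V \<subseteq> frontier (outside (drawing_image (fan a f m) p \<gamma>))"
  proof
    have "Im z = 0 \<or> Im z = 1" if "z \<in> ?V" for z using that unfolding V by auto
    moreover have "0 \<le> Im z \<and> Im z \<le> 1" if "(u, v) \<in> parcs (fan a f m)" "z \<in> path_image (\<gamma> {u, v})" for u v z
      using that(1)
    proof (cases rule: fan_arcE)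
      case (1 i) then show ?thesis using spoke[OF 1(1)] that(2) by metis
    next
      case (2 i) then show ?thesis using rim[OF 2(1)] that(2) by fastforce
    qed
    ultimately have "drawing_image (fan a f m) p \<gamma> \<subseteq> {z. 0 \<le> Im z \<and> Im z \<le> 1}"
      unfolding drawing_image_def by fastforce
    moreover fix z assume z: "z \<in> ?V"
    moreover have "Im z = 0 \<or> Im z = 1" using z unfolding V by auto
    ultimately show "z \<in> frontier (outside (drawing_image (fan a f m) p \<gamma>))"
      by (intro in_frontier_strip) (auto simp: drawing_image_def)
  qed
  ultimately show ?thesis unfolding outerplanar_def by blast
qed

section \<open>From drawings to the extremal number\<close>

lemma outer_graph_outerplanar:
  assumes "G \<in> outerplanar_graphs n"
  shows "outer_graph (parcs G)"
proof -
  have G: "pair_graph G" "outerplanar G" using assms by (auto simp: outerplanar_graphs_def)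
  then obtain p \<gamma> where "outer_drawing G p \<gamma>" by (auto simp: outerplanar_def outer_drawing_def)
  then interpret outer_drawing G p \<gamma> .
  show ?thesis
  proof
    show "(u, u) \<notin> parcs G" for u using arc_verts by blast
  qed (use E_sym no_theta no_crossing_chords in blast)+
qed

lemma fan_in_outerplanar_graphs:
  assumes "inj_on f {..<m}" "a \<notin> f ` {..<m}"
  shows "fan a f m \<in> outerplanar_graphs (Suc m)"
  using pair_graph_fan[OF assms] card_pverts_fan[OF assms] outerplanar_fan[OF assms]
  by (simp add: outerplanar_graphs_def)

lemma num_copies_fan:
  assumes f: "inj_on f {..<m}" "a \<notin> f ` {..<m}" and "m \<ge> 3"
  shows "int (num_copies (path_graph 4) (fan a f m)) = 2 * (int (Suc m))\<^sup>2 - 7 * int (Suc m) + 2"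
proof -
  interpret outer_graph "parcs (fan a f m)"
    using outer_graph_outerplanar[OF fan_in_outerplanar_graphs[OF f]] .
  obtain k where k: "m = k + 3" using assms(3) by (metis add.commute le_Suc_ex)
  have "fan_labelling a f m"
    unfolding fan_labelling_def using f by (auto simp: fan_def path_graph_def inj_on_eq_iff)
  then have "card (paths4 (insert a (f ` {..<m}))) + 6 * m + 6 = 4 * m\<^sup>2"
    using card_paths4_fan[of a f k] k by simp
  moreover have "2 * num_copies (path_graph 4) (fan a f m) = card (paths4 (insert a (f ` {..<m})))"
    using num_copies_paths4[OF pair_graph_fan[OF f] refl] by (simp add: fan_def)
  ultimately have "2 * num_copies (path_graph 4) (fan a f m) + 6 * m + 6 = 4 * m\<^sup>2" by simp
  then have "2 * int (num_copies (path_graph 4) (fan a f m)) + 6 * int m + 6 = 4 * (int m)\<^sup>2"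
    by (metis (mono_tags, lifting) of_nat_add of_nat_mult of_nat_numeral of_nat_power)
  then show ?thesis by (simp add: power2_eq_square algebra_simps)
qed

text \<open>A fan labelling determines all arcs, so an extremal graph equals a \<open>fan\<close>;
  the passage to the join is left to \<open>graph_iso_fan\<close>.\<close>

lemma num_copies_outerplanar:
  assumes G: "G \<in> outerplanar_graphs n" and n: "n \<ge> 8"
  shows "int (num_copies (path_graph 4) G) \<le> 2 * (int n)\<^sup>2 - 7 * int n + 2"
    and "n \<ge> 9 \<Longrightarrow> int (num_copies (path_graph 4) G) = 2 * (int n)\<^sup>2 - 7 * int n + 2 \<Longrightarrow>
      \<exists>a f. inj_on f {..<n - 1} \<and> a \<notin> f ` {..<n - 1} \<and> G = fan a f (n - 1)"
proof -
  interpret outer_graph "parcs G" by (rule outer_graph_outerplanar[OF G])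
  have pg: "pair_graph G" and cn: "card (pverts G) = n" using G by (auto simp: outerplanar_graphs_def)
  interpret G: pair_graph G by (rule pg)
  have fin: "finite (pverts G)" by (rule G.pair_finite_verts)
  have eq: "int (card (paths4 (pverts G))) = 2 * int (num_copies (path_graph 4) G)"
    using num_copies_paths4[OF pg refl] by linarith
  note b = card_paths4_le[OF fin, unfolded cn, OF n]
  show "int (num_copies (path_graph 4) G) \<le> 2 * (int n)\<^sup>2 - 7 * int n + 2"
    using conjunct1[OF b] eq by simp
  assume n9: "n \<ge> 9" and "int (num_copies (path_graph 4) G) = 2 * (int n)\<^sup>2 - 7 * int n + 2"
  then obtain a where "fan_center (pverts G) a" using b eq by auto
  then obtain f where f: "fan_labelling a f (n - 1)" "pverts G = insert a (f ` {..<n - 1})"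
    using fan_center_labelling[OF fin] cn n by (metis le_trans numeral_le_iff semiring_norm(68) semiring_norm(71))
  have i: "inj_on f {..<n - 1}" "a \<notin> f ` {..<n - 1}" using f(1) by (auto simp: fan_labelling_def)
  have "(u, v) \<in> parcs G \<longleftrightarrow> (u, v) \<in> parcs (fan a f (n - 1))" for u v
  proof -
    have "(u, v) \<in> parcs (fan a f (n - 1)) \<Longrightarrow> (u, v) \<in> parcs G"
      using f(1) adj_sym by (auto simp: fan_def path_graph_def fan_labelling_def)
    moreover have "(u, v) \<in> parcs (fan a f (n - 1))" if uv: "(u, v) \<in> parcs G"
    proof -
      have "u \<in> insert a (f ` {..<n - 1})" "v \<in> insert a (f ` {..<n - 1})" "u \<noteq> v"
        using G.in_arcsD1[OF uv] G.in_arcsD2[OF uv] f(2) uv adj_irrefl by auto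
      moreover have "j = Suc i \<or> i = Suc j" if "u = f i" "v = f j" "i < n - 1" "j < n - 1" for i j
        using f(1) uv that by (auto simp: fan_labelling_def)
      ultimately show ?thesis by (auto simp: fan_def path_graph_def image_iff)
    qed
    ultimately show ?thesis by blast
  qed
  then have "parcs G = parcs (fan a f (n - 1))" by auto
  then have "G = fan a f (n - 1)" using f(2) by (simp add: fan_def)
  then show "\<exists>a f. inj_on f {..<n - 1} \<and> a \<notin> f ` {..<n - 1} \<and> G = fan a f (n - 1)" using i by blast
qed

lemma f_OP_path_4:
  assumes n: "n \<ge> 8"
  shows "int (f_OP n (path_graph 4)) = 2 * (int n)\<^sup>2 - 7 * int n + 2"
proof -
  let ?S = "num_copies (path_graph 4) ` (outerplanar_graphs n :: nat pair_pre_digraph set)"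
  let ?F = "fan 0 Suc (n - 1) :: nat pair_pre_digraph"
  have s: "Suc (n - 1) = n" using n by simp
  have i: "inj_on Suc {..<n - 1}" "0 \<notin> Suc ` {..<n - 1}" by auto
  have F: "num_copies (path_graph 4) ?F \<in> ?S"
    using fan_in_outerplanar_graphs[OF i] s by auto
  have eq: "int (num_copies (path_graph 4) ?F) = 2 * (int n)\<^sup>2 - 7 * int n + 2"
    using num_copies_fan[OF i] s n by simp
  have le: "k \<le> num_copies (path_graph 4) ?F" if "k \<in> ?S" for k
    using that num_copies_outerplanar(1)[OF _ n] eq by fastforce
  \<comment> \<open>There are infinitely many graphs on \<open>n\<close> natural numbers; the
    uniform bound makes the set of values finite, so that \<open>Max\<close> is meaningful.\<close>
  then have "finite ?S" by (meson finite_nat_iff_bounded_le subsetI atMost_iff)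
  then have "Max ?S = num_copies (path_graph 4) ?F" using F le by (intro Max_eqI) auto
  then show ?thesis using eq by (simp add: f_OP_def)
qed

theorem theorem3:
  fixes n :: nat
  shows "(n \<ge> 8 \<longrightarrow> int (f_OP n (path_graph 4)) = 2 * (int n)\<^sup>2 - 7 * int n + 2) \<and>
    (n \<ge> 9 \<longrightarrow>
       graph_join (complete_graph 1) (path_graph (n - 1)) \<in> outerplanar_graphs n \<and>
       num_copies (path_graph 4) (graph_join (complete_graph 1) (path_graph (n - 1)))
         = f_OP n (path_graph 4) \<and>
       (\<forall>G :: 'a pair_pre_digraph.
          G \<in> outerplanar_graphs n \<and> num_copies (path_graph 4) G = f_OP n (path_graph 4) \<longrightarrow>
          graph_iso G (graph_join (complete_graph 1) (path_graph (n - 1)))))"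
proof (intro conjI impI allI)
  show "int (f_OP n (path_graph 4)) = 2 * (int n)\<^sup>2 - 7 * int n + 2" if "n \<ge> 8"
    using f_OP_path_4[OF that] .
next
  assume n: "n \<ge> 9"
  then have s: "Suc (n - 1) = n" and n8: "n \<ge> 8" and n3: "n - 1 \<ge> 3" by auto
  note f_OP = f_OP_path_4[OF n8]
  have i: "inj_on (Inr :: nat \<Rightarrow> nat + nat) {..<n - 1}" "(Inl 0 :: nat + nat) \<notin> Inr ` {..<n - 1}" by auto
  show "graph_join (complete_graph 1) (path_graph (n - 1)) \<in> outerplanar_graphs n"
    unfolding graph_join_eq_fan using fan_in_outerplanar_graphs[OF i] s by simp
  have "int (num_copies (path_graph 4) (fan (Inl 0 :: nat + nat) Inr (n - 1))) = 2 * (int n)\<^sup>2 - 7 * int n + 2"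
    using num_copies_fan[OF i n3] unfolding s .
  then show "num_copies (path_graph 4) (graph_join (complete_graph 1) (path_graph (n - 1))) = f_OP n (path_graph 4)"
    unfolding graph_join_eq_fan using f_OP by linarith
  fix G :: "'a pair_pre_digraph"
  assume G: "G \<in> outerplanar_graphs n \<and> num_copies (path_graph 4) G = f_OP n (path_graph 4)"
  then have "int (num_copies (path_graph 4) G) = 2 * (int n)\<^sup>2 - 7 * int n + 2" using f_OP by simp
  then obtain a f where fan: "inj_on f {..<n - 1}" "a \<notin> f ` {..<n - 1}" "G = fan a f (n - 1)"
    using num_copies_outerplanar(2)[OF conjunct1[OF G] n8 n] by blast
  show "graph_iso G (graph_join (complete_graph 1) (path_graph (n - 1)))"
    unfolding graph_join_eq_fan fan(3) by (rule graph_iso_fan[OF fan(1,2) i])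
qed

end
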